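(* Let $C$ be a smooth projective connected curve of genus $g$ over an algebraically closed field. Let $V$ be a vector bundle on $C$ with $\mu(V)=\deg V/\operatorname{rk}V=g-1$ and $h^0(V)=0$, and let $\{x_0\}$, $\{x_1,\ldots,x_n\}$, $\{y_0\}$, $\{y_1,\ldots,y_n\}$ be disjoint sets of points of $C$ (all $2n+2$ points $x_0,\ldots,x_n,y_0,\ldots,y_n$ being distinct) such that $h^0(V(\sum_{i=1}^n x_i-\sum_{i=1}^n y_i))=0$. Consider the $(n+1)\times(n+1)$-matrix $A=(a_{ij})_{0\le i,j\le n}$ with entries $a_{ij}=m_3(V,x_j,y_i)$. Then $$m_3\Big(V\big(\textstyle\sum_{i=1}^n x_i-\sum_{i=1}^n y_i\big),x_0,y_0\Big)=|A|_{00},$$ where $|A|_{00}$ is the $(0,0)$-quasideterminant of $A$.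
   Context: $W|_p$ is the fibre of a vector bundle $W$ at $p$, $\omega_C$ the canonical bundle. A point $p$ is a base point of $W$ if $H^0(C,W)\to W|_p$ is zero. A triple $(V,x,y)$ ($V$ a vector bundle, $x,y\in C$) is good if $x\ne y$, $x$ is a base point of $\omega_C\otimes V^\vee$, and $y$ is a base point of $V$. For a good triple the map $p_x:H^0(C,V(x))\to V(x)|_x$ is surjective with kernel $H^0(C,V)$, and evaluation at $y$, $H^0(C,V(x))\to V(x)|_y\simeq V|_y$, vanishes on this kernel; $m_3(V,x,y):V(x)|_x\to V|_y$ is the unique linear map through which it factors. Since $V(x)|_x\simeq\omega_C^{-1}|_x\otimes V|_x$, it may also be viewed as a map $V|_x\to\omega_C|_x\otimes V|_y$. If $\mu(V)=g-1$ and $h^0(V)=0$, then $(V,x,y)$ is good for all $x\neq y$. For a divisor $D$ and a point $p$ not in its support, $V(D)|_p$ is identified with $V|_p$ using the rational section $1$ of $\mathcal{O}_C(D)$. With these identifications, both sides of the equality are linear maps $V(x_0)|_{x_0}\to V|_{y_0}$. Quasideterminant (Gelfand–Retakh): for a matrix $A=(a_{ij})$ with entries linear maps (where $a_{ij}$ maps the $j$-th source space to the $i$-th target space), let $A^{00}$ be the matrix obtained by deleting row $0$ and column $0$, $r=(a_{01},\ldots,a_{0n})$ the rest of row $0$, and $c=(a_{10},\ldots,a_{n0})^T$ the rest of column $0$. If $A^{00}$ is invertible (as a linear map between direct sums), then $|A|_{00}=a_{00}-r\,(A^{00})^{-1}\,c$. *)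

theory Defs
  imports
    "HOL-Algebra.Module"
    "HOL-Computational_Algebra.Polynomial"
    "HOL-Library.FuncSet"
    "HOL-Library.Function_Algebras"
    "Jordan_Normal_Form.Determinant"
begin

section \<open>Smooth projective curves\<close>

text \<open>
  An integral projective variety over the algebraically closed field \<open>'k\<close> is the closure of a point
  \<open>\<xi>\<close> of projective space with homogeneous coordinates in its function field \<open>'K\<close> (the generic
  point): a form \<open>F\<close> over \<open>'k\<close> vanishes on the variety iff \<open>F(\<xi>) = 0\<close>, and \<open>'K\<close> is the set of
  quotients \<open>F(\<xi>) / G(\<xi>)\<close> of forms of equal degree. The projective space has dimension
  \<open>CARD('i) - 1\<close>.
\<close>

record ('k, 'K, 'i) curve =
  emb :: "'k \<Rightarrow> 'K"
  coords :: "'i \<Rightarrow> 'K"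

text \<open>Value at \<open>z\<close> of the form of degree \<open>d\<close> with coefficients \<open>h (c e)\<close>, \<open>e\<close> ranging over the
  exponent vectors of total degree \<open>d\<close>.\<close>

definition form_val :: "('k \<Rightarrow> 'a::comm_ring_1) \<Rightarrow> nat \<Rightarrow> (('i::finite \<Rightarrow> nat) \<Rightarrow> 'k) \<Rightarrow> ('i \<Rightarrow> 'a) \<Rightarrow> 'a"
  where "form_val h d c z = (\<Sum>e | sum e UNIV = d. h (c e) * (\<Prod>i\<in>UNIV. z i ^ e i))"

text \<open>A closed point is the set of all its homogeneous coordinate vectors.\<close>

type_synonym ('k, 'i) point = "('i \<Rightarrow> 'k) set"

definition points :: "('k::field, 'K::field, 'i::finite) curve \<Rightarrow> ('k, 'i) point set"
  where "points C = {{(\<lambda>i. a * z i) | a. a \<noteq> 0} | z. (\<exists>i. z i \<noteq> 0) \<and>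
     (\<forall>d F. form_val (emb C) d F (coords C) = 0 \<longrightarrow> form_val id d F z = 0)}"

definition local_ring :: "('k::field, 'K::field, 'i::finite) curve \<Rightarrow> ('k, 'i) point \<Rightarrow> 'K set"
  where "local_ring C p = {form_val (emb C) d F (coords C) / form_val (emb C) d G (coords C) | d F G.
     \<forall>z\<in>p. form_val id d G z \<noteq> 0}"

definition max_ideal :: "('k::field, 'K::field, 'i::finite) curve \<Rightarrow> ('k, 'i) point \<Rightarrow> 'K set"
  where "max_ideal C p = {form_val (emb C) d F (coords C) / form_val (emb C) d G (coords C) | d F G.
     \<forall>z\<in>p. form_val id d G z \<noteq> 0 \<and> form_val id d F z = 0}"

text \<open>The quotient \<open>A / B\<close> of two \<open>'k\<close>-subspaces of a vector space with scalar multiplication \<open>sc\<close>,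
  as a module in the sense of HOL-Algebra; its ring multiplication and unit play no role.\<close>

definition coset_of :: "'v::ab_group_add set \<Rightarrow> 'v \<Rightarrow> 'v set"
  where "coset_of B a = (+) a ` B"

definition quotient_space :: "('k \<Rightarrow> 'v \<Rightarrow> 'v) \<Rightarrow> 'v set \<Rightarrow> 'v::ab_group_add set \<Rightarrow> ('k, 'v set) module"
  where "quotient_space sc A B =
    \<lparr>carrier = coset_of B ` A, mult = undefined, one = undefined,
     zero = B, add = (\<lambda>X Y. {u + v | u v. u \<in> X \<and> v \<in> Y}),
     module.smult = (\<lambda>a X. {sc a u + b | u b. u \<in> X \<and> b \<in> B})\<rparr>"

definition has_dim :: "('k, 'w) module \<Rightarrow> nat \<Rightarrow> bool"
  where "has_dim M n \<longleftrightarrow> (\<exists>b\<in>{..<n} \<rightarrow> carrier M. \<forall>v\<in>carrier M.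
     \<exists>!c. c \<in> extensional {..<n} \<and> v = (\<Oplus>\<^bsub>M\<^esub>i\<in>{..<n}. c i \<odot>\<^bsub>M\<^esub> b i))"

definition cotangent_space :: "('k::field, 'K::field, 'i::finite) curve \<Rightarrow> ('k, 'i) point \<Rightarrow> ('k, 'K set) module"
  where "cotangent_space C p = quotient_space (\<lambda>a f. emb C a * f) (max_ideal C p)
     {\<Sum>i<n. f i * g i | (n::nat) f g. \<forall>i<n. f i \<in> max_ideal C p \<and> g i \<in> max_ideal C p}"

text \<open>\<open>'K\<close> has transcendence degree one over \<open>'k\<close>: some \<open>t\<close> is transcendental over \<open>'k\<close>, and
  \<open>'K\<close> is algebraic over \<open>'k(t)\<close> (denominators are cleared in the algebraic relation).\<close>

definition trdeg_one :: "('k::field \<Rightarrow> 'K::field) \<Rightarrow> bool"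
  where "trdeg_one h \<longleftrightarrow> (\<exists>t. (\<forall>P. P \<noteq> 0 \<longrightarrow> poly (map_poly h P) t \<noteq> 0) \<and>
     (\<forall>f. \<exists>P :: 'k poly poly. P \<noteq> 0 \<and> poly (map_poly (\<lambda>Q. poly (map_poly h Q) t) P) f = 0))"

definition smooth_projective_curve :: "('k::alg_closed_field, 'K::field, 'i::finite) curve \<Rightarrow> bool"
  where "smooth_projective_curve C \<longleftrightarrow>
     field_hom (emb C) \<and>
     (\<exists>i. coords C i \<noteq> 0) \<and>
     (\<forall>f. \<exists>d F G. form_val (emb C) d G (coords C) \<noteq> 0 \<and>
        f = form_val (emb C) d F (coords C) / form_val (emb C) d G (coords C)) \<and>
     trdeg_one (emb C) \<and>
     (\<forall>p\<in>points C. has_dim (cotangent_space C p) 1)"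

definition ord :: "('k::field, 'K::field, 'i::finite) curve \<Rightarrow> ('k, 'i) point \<Rightarrow> 'K \<Rightarrow> int"
  where "ord C p f = (THE m. \<exists>t u. max_ideal C p = (\<lambda>a. t * a) ` local_ring C p \<and>
     u \<noteq> 0 \<and> u \<in> local_ring C p \<and> inverse u \<in> local_ring C p \<and> f = t powi m * u)"

text \<open>The genus is the dimension of \<open>H\<^sup>1(C, \<O>)\<close>. The flasque resolution
  \<open>0 \<rightarrow> \<O> \<rightarrow> K \<rightarrow> K/\<O> \<rightarrow> 0\<close> by the constant sheaf of rational functions and the direct sum of
  the skyscrapers \<open>K/\<O>\<^sub>p\<close> gives \<open>H\<^sup>1(C, \<O>) = (\<Oplus>\<^sub>p K/\<O>\<^sub>p) / K\<close>. The direct sum is written with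
  repartitions, that is families in \<open>K\<close> lying in \<open>\<O>\<^sub>p\<close> for almost all \<open>p\<close>.\<close>

definition H1_structure_sheaf ::
  "('k::field, 'K::field, 'i::finite) curve \<Rightarrow> ('k, (('k, 'i) point \<Rightarrow> 'K) set) module"
  where "H1_structure_sheaf C = quotient_space (\<lambda>a r p. emb C a * r p)
     {r. (\<forall>p. p \<notin> points C \<longrightarrow> r p = 0) \<and> finite {p \<in> points C. r p \<notin> local_ring C p}}
     {r. (\<forall>p. p \<notin> points C \<longrightarrow> r p = 0) \<and> (\<exists>f. \<forall>p\<in>points C. r p - f \<in> local_ring C p)}"

definition genus :: "('k::field, 'K::field, 'i::finite) curve \<Rightarrow> nat"
  where "genus C = (THE g. has_dim (H1_structure_sheaf C) g)"


section \<open>Vector bundles\<close>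

text \<open>
  A locally free sheaf of finite rank embeds into the constant sheaf of its generic stalk, here the
  \<open>'K\<close>-vector space \<open>'e\<close>, and is given by its stalks there: the sections over an open set are the
  vectors lying in the stalks at all its points.
\<close>

record ('k, 'K, 'i, 'e) vbundle =
  scl :: "'K \<Rightarrow> 'e \<Rightarrow> 'e"
  stalk :: "('k, 'i) point \<Rightarrow> 'e set"

definition rank :: "('k, 'K::field, 'i, 'e::ab_group_add) vbundle \<Rightarrow> nat"
  where "rank V = vector_space.dim (scl V) UNIV"

definition is_basis :: "('k, 'K::field, 'i, 'e::ab_group_add) vbundle \<Rightarrow> (nat \<Rightarrow> 'e) \<Rightarrow> bool"
  where "is_basis V b \<longleftrightarrow>
     (\<forall>v. \<exists>!c. c \<in> extensional {..<rank V} \<and> v = (\<Sum>i<rank V. scl V (c i) (b i)))"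

definition frame_at :: "('k::field, 'K::field, 'i::finite) curve \<Rightarrow>
    ('k, 'K, 'i, 'e::ab_group_add) vbundle \<Rightarrow> ('k, 'i) point \<Rightarrow> (nat \<Rightarrow> 'e) \<Rightarrow> bool"
  where "frame_at C V p b \<longleftrightarrow> is_basis V b \<and>
     stalk V p = {\<Sum>i<rank V. scl V (f i) (b i) | f. \<forall>i<rank V. f i \<in> local_ring C p}"

text \<open>Local freeness is required on basic Zariski open neighbourhoods, where a form \<open>G\<close> does not
  vanish.\<close>

definition vector_bundle :: "('k::field, 'K::field, 'i::finite) curve \<Rightarrow>
    ('k, 'K, 'i, 'e::ab_group_add) vbundle \<Rightarrow> bool"
  where "vector_bundle C V \<longleftrightarrow> vector_space (scl V) \<and>
     (\<forall>p\<in>points C. \<exists>d G b. (\<forall>z\<in>p. form_val id d G z \<noteq> 0) \<and>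
        (\<forall>q\<in>points C. (\<forall>z\<in>q. form_val id d G z \<noteq> 0) \<longrightarrow> frame_at C V q b))"

text \<open>Order at \<open>p\<close> of the rational section \<open>b\<^sub>0 \<and> \<dots> \<and> b\<^sub>r\<^sub>-\<^sub>1\<close> of \<open>det V\<close>.\<close>

definition det_ord :: "('k::field, 'K::field, 'i::finite) curve \<Rightarrow>
    ('k, 'K, 'i, 'e::ab_group_add) vbundle \<Rightarrow> (nat \<Rightarrow> 'e) \<Rightarrow> ('k, 'i) point \<Rightarrow> int"
  where "det_ord C V b p = (THE m. \<exists>e M. frame_at C V p e \<and> M \<in> carrier_mat (rank V) (rank V) \<and>
     (\<forall>j<rank V. b j = (\<Sum>i<rank V. scl V (M $$ (i, j)) (e i))) \<and> m = ord C p (det M))"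

definition degree_of :: "('k::field, 'K::field, 'i::finite) curve \<Rightarrow>
    ('k, 'K, 'i, 'e::ab_group_add) vbundle \<Rightarrow> int"
  where "degree_of C V = (let b = (SOME b. is_basis V b) in
     \<Sum>p | p \<in> points C \<and> det_ord C V b p \<noteq> 0. det_ord C V b p)"

definition slope :: "('k::field, 'K::field, 'i::finite) curve \<Rightarrow>
    ('k, 'K, 'i, 'e::ab_group_add) vbundle \<Rightarrow> rat"
  where "slope C V = of_int (degree_of C V) / of_nat (rank V)"

definition H0 :: "('k::field, 'K::field, 'i::finite) curve \<Rightarrow>
    ('k, 'K, 'i, 'e::ab_group_add) vbundle \<Rightarrow> 'e set"
  where "H0 C V = {s. \<forall>p\<in>points C. s \<in> stalk V p}"

definition pt_divisor :: "('k, 'i) point \<Rightarrow> ('k, 'i) point \<Rightarrow> int"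
  where "pt_divisor p = (\<lambda>q. if q = p then 1 else 0)"

text \<open>\<open>V(D)\<close> has stalks \<open>\<O>(D)\<^sub>p \<cdot> V\<^sub>p\<close>. Here and in \<open>fibre_ker\<close> no sums of products are needed,
  since fractional ideals of \<open>\<O>\<^sub>p\<close> are principal. The stalks, hence the fibres, of \<open>V(D)\<close> and \<open>V\<close>
  at points outside the support of \<open>D\<close> are equal, so the identification by the section \<open>1\<close> of
  \<open>\<O>(D)\<close> is the identity.\<close>

definition twist :: "('k::field, 'K::field, 'i::finite) curve \<Rightarrow>
    ('k, 'K, 'i, 'e::ab_group_add) vbundle \<Rightarrow> (('k, 'i) point \<Rightarrow> int) \<Rightarrow> ('k, 'K, 'i, 'e) vbundle"
  where "twist C V D = V\<lparr>stalk := (\<lambda>p.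
     {scl V f v | f v. (f = 0 \<or> ord C p f \<ge> - D p) \<and> v \<in> stalk V p})\<rparr>"

definition fibre_ker :: "('k::field, 'K::field, 'i::finite) curve \<Rightarrow>
    ('k, 'K, 'i, 'e::ab_group_add) vbundle \<Rightarrow> ('k, 'i) point \<Rightarrow> 'e set"
  where "fibre_ker C V p = {scl V f v | f v. f \<in> max_ideal C p \<and> v \<in> stalk V p}"

definition fibre :: "('k::field, 'K::field, 'i::finite) curve \<Rightarrow>
    ('k, 'K, 'i, 'e::ab_group_add) vbundle \<Rightarrow> ('k, 'i) point \<Rightarrow> ('k, 'e set) module"
  where "fibre C V p = quotient_space (\<lambda>a v. scl V (emb C a) v) (stalk V p) (fibre_ker C V p)"

definition evaluate :: "('k::field, 'K::field, 'i::finite) curve \<Rightarrow>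
    ('k, 'K, 'i, 'e::ab_group_add) vbundle \<Rightarrow> ('k, 'i) point \<Rightarrow> 'e \<Rightarrow> 'e set"
  where "evaluate C V p s = coset_of (fibre_ker C V p) s"


section \<open>The map \<open>m\<^sub>3\<close> and quasideterminants\<close>

text \<open>Linear maps are extensional, so that equal maps are equal functions.\<close>

definition linear_maps :: "('k, 'v) module \<Rightarrow> ('k, 'w) module \<Rightarrow> ('v \<Rightarrow> 'w) set"
  where "linear_maps S T = {m \<in> carrier S \<rightarrow>\<^sub>E carrier T.
     (\<forall>u\<in>carrier S. \<forall>v\<in>carrier S. m (u \<oplus>\<^bsub>S\<^esub> v) = m u \<oplus>\<^bsub>T\<^esub> m v) \<and>
     (\<forall>a. \<forall>u\<in>carrier S. m (a \<odot>\<^bsub>S\<^esub> u) = a \<odot>\<^bsub>T\<^esub> m u)}"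

text \<open>The unique linear map through which evaluation at \<open>y\<close> on \<open>H\<^sup>0(V(x))\<close> factors over evaluation
  at \<open>x\<close>. It is well defined exactly if evaluation at \<open>x\<close> is onto and its kernel \<open>H\<^sup>0(V)\<close> vanishes
  at \<open>y\<close>; this holds for good triples \<open>(V, x, y)\<close>.\<close>

definition m3 :: "('k::field, 'K::field, 'i::finite) curve \<Rightarrow>
    ('k, 'K, 'i, 'e::ab_group_add) vbundle \<Rightarrow> ('k, 'i) point \<Rightarrow> ('k, 'i) point \<Rightarrow> 'e set \<Rightarrow> 'e set"
  where "m3 C V x y = (let W = twist C V (pt_divisor x) in
     THE m. m \<in> linear_maps (fibre C W x) (fibre C V y) \<and>
       (\<forall>s\<in>H0 C W. m (evaluate C W x s) = evaluate C W y s))"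

text \<open>\<open>A i j\<close> maps \<open>S j\<close> to \<open>T i\<close> for \<open>i, j \<le> n\<close>. The map given by the matrix \<open>A\<close> with row and
  column \<open>0\<close> deleted acts on the direct sum of \<open>S 1, \<dots>, S n\<close>.\<close>

definition minor00 :: "(nat \<Rightarrow> ('k, 'v) module) \<Rightarrow> (nat \<Rightarrow> ('k, 'w) module) \<Rightarrow> nat \<Rightarrow>
    (nat \<Rightarrow> nat \<Rightarrow> 'v \<Rightarrow> 'w) \<Rightarrow> (nat \<Rightarrow> 'v) \<Rightarrow> (nat \<Rightarrow> 'w)"
  where "minor00 S T n A =
     (\<lambda>v\<in>(\<Pi>\<^sub>E j\<in>{1..n}. carrier (S j)). \<lambda>i\<in>{1..n}. \<Oplus>\<^bsub>T i\<^esub>j\<in>{1..n}. A i j (v j))"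

definition minor00_invertible :: "(nat \<Rightarrow> ('k, 'v) module) \<Rightarrow> (nat \<Rightarrow> ('k, 'w) module) \<Rightarrow> nat \<Rightarrow>
    (nat \<Rightarrow> nat \<Rightarrow> 'v \<Rightarrow> 'w) \<Rightarrow> bool"
  where "minor00_invertible S T n A \<longleftrightarrow> bij_betw (minor00 S T n A)
     (\<Pi>\<^sub>E j\<in>{1..n}. carrier (S j)) (\<Pi>\<^sub>E i\<in>{1..n}. carrier (T i))"

definition quasidet00 :: "(nat \<Rightarrow> ('k, 'v) module) \<Rightarrow> (nat \<Rightarrow> ('k, 'w) module) \<Rightarrow> nat \<Rightarrow>
    (nat \<Rightarrow> nat \<Rightarrow> 'v \<Rightarrow> 'w) \<Rightarrow> 'v \<Rightarrow> 'w"
  where "quasidet00 S T n A = (\<lambda>v\<in>carrier (S 0).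
     let w = inv_into (\<Pi>\<^sub>E j\<in>{1..n}. carrier (S j)) (minor00 S T n A) (\<lambda>i\<in>{1..n}. A i 0 v)
     in A 0 0 v \<ominus>\<^bsub>T 0\<^esub> (\<Oplus>\<^bsub>T 0\<^esub>j\<in>{1..n}. A 0 j (w j)))"

end

theory Submission
  imports Defs "Jordan_Normal_Form.Char_Poly"
begin

text \<open>
  Riemann-Roch enters only through \<open>H\<^sup>1(V) = 0\<close>, which makes evaluation at \<open>x\<close> an isomorphism of
  \<open>H\<^sup>0(V(x))\<close> with \<open>V(x)|\<^sub>x\<close>. Cohomology is computed with adeles: \<open>H\<^sup>1(V)\<close> is the space of all
  adeles modulo the integral and the constant ones. That the genus is finite follows from \<open>K\<close> being
  finite over some \<open>k(t)\<close>: polar parts at points where \<open>t\<close> is regular are realised by functions without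
  further poles there, and at the poles of \<open>t\<close> only boundedly many expansion coefficients remain.
  Comparing \<open>V\<close> with the lattice of a rational frame, whose local index is the order of a determinant,
  gives \<open>h\<^sup>1(V) \<le> r (g - 1) - deg V = 0\<close>. The constant functions enter only
  through \<open>h\<^sup>0(\<O>) \<ge> 1\<close>.

  A choice of polar parts \<open>v\<^sub>j\<close> at the points \<open>x\<^sub>j\<close> is the same as a section of \<open>V(x\<^sub>0 + \<dots> + x\<^sub>n)\<close>, and
  the value of this section at \<open>y\<^sub>i\<close> is \<open>\<Sum>\<^sub>j a\<^sub>i\<^sub>j v\<^sub>j\<close>. The sections of \<open>V(D + x\<^sub>0)\<close> are those vanishing at
  \<open>y\<^sub>1, \<dots>, y\<^sub>n\<close>, so \<open>(v\<^sub>1, \<dots>, v\<^sub>n)\<close> is determined by \<open>v\<^sub>0\<close> through the block \<open>A\<^sup>0\<^sup>0\<close>, whose kernel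
  \<open>H\<^sup>0(V(D))\<close> vanishes; the value at \<open>y\<^sub>0\<close> is then the quasideterminant applied to \<open>v\<^sub>0\<close>.
\<close>

section \<open>Linear algebra modulo a subspace\<close>

text \<open>Every comparison of dimensions is one extraction of a linear dependence: more vectors
  than generators, modulo a subspace. This stands in for ranks, exact sequences and Euler
  characteristics, and gives both the vanishing of \<open>H^1(V)\<close> and the surjectivity of the
  block \<open>A^00\<close>. The behaviour of zeros and poles has a single source: any two rational
  functions satisfy a polynomial relation over the ground field. It yields finiteness of zeros and
  bounded divisibility by a uniformiser. The vanishing of \<open>H^1\<close> is established for
  \<open>V\<close> only. \<open>V(D)\<close> is never given frames or a degree; evaluation at the
  point \<open>x 0\<close> is shown to be onto for it by correcting sections of
  \<open>V(x 0)\<close> at the points \<open>y 1, ..., y n\<close>. Genus, order, order of a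
  determinant and \<open>m3\<close> are definite descriptions, so each first requires existence and
  uniqueness.\<close>

lemma sum_fun_apply: "(\<Sum>x\<in>X. F x) p = (\<Sum>x\<in>X. F x p)" for F :: "'a \<Rightarrow> 'b \<Rightarrow> 'c::comm_monoid_add"
  by (induction X rule: infinite_finite_induct) auto

text \<open>Gaussian elimination by induction on the equations: an unknown \<open>j\<close> that
  occurs in equation \<open>t\<close> is removed together with that equation.\<close>

lemma homogeneous_system_nontrivial:
  fixes a :: "'i \<Rightarrow> 't \<Rightarrow> 'k::field"
  assumes "finite T" "finite I" "card T < card I"
  shows "\<exists>c. (\<exists>i\<in>I. c i \<noteq> 0) \<and> (\<forall>t\<in>T. (\<Sum>i\<in>I. c i * a i t) = 0)"
  using assms
proof (induction T arbitrary: I a rule: finite_induct)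
  case empty
  then have "I \<noteq> {}" by auto
  then show ?case by (intro exI[of _ "\<lambda>_. 1"]) auto
next
  case (insert t T)
  show ?case
  proof (cases "\<forall>i\<in>I. a i t = 0")
    case True
    have "card T < card I" using insert by simp
    from insert.IH[OF insert.prems(1) this] obtain c
      where "\<exists>i\<in>I. c i \<noteq> 0" "\<forall>s\<in>T. (\<Sum>i\<in>I. c i * a i s) = 0" by blast
    then show ?thesis using True by (intro exI[of _ c]) auto
  next
    case False
    then obtain j where j: "j \<in> I" "a j t \<noteq> 0" by auto
    \<comment> \<open>The system left after equation \<open>t\<close> has been used to express
      unknown \<open>j\<close> through the others.\<close>
    define a' where "a' i s = a i s - a i t / a j t * a j s" for i s
    have "finite (I - {j})" "card T < card (I - {j})"
      using insert j by (auto simp: card_Diff_singleton_if)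
    from insert.IH[OF this, of a'] obtain c
      where c: "\<exists>i\<in>I - {j}. c i \<noteq> 0" "\<forall>s\<in>T. (\<Sum>i\<in>I - {j}. c i * a' i s) = 0" by blast
    define e where "e = (\<Sum>i\<in>I - {j}. c i * a i t)"
    define d where "d = c(j := - e / a j t)"
    have sum_d: "(\<Sum>i\<in>I. d i * a i s) = (\<Sum>i\<in>I - {j}. c i * a i s) - e / a j t * a j s" for s
      using j insert.prems(1) by (simp add: sum.remove d_def cong: sum.cong_simp)
    have "(\<Sum>i\<in>I - {j}. c i * a' i s) = (\<Sum>i\<in>I - {j}. c i * a i s) - e / a j t * a j s" for s
      unfolding a'_def e_def
      by (simp add: right_diff_distrib sum_subtractf sum_distrib_right sum_divide_distrib mult.assoc)
    then have "\<forall>s\<in>T. (\<Sum>i\<in>I. d i * a i s) = 0" using c(2) sum_d by simp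
    moreover have "(\<Sum>i\<in>I. d i * a i t) = 0" using sum_d[of t] j by (simp add: e_def)
    moreover have "\<exists>i\<in>I. d i \<noteq> 0" using c(1) by (auto simp: d_def)
    ultimately show ?thesis by (intro exI[of _ d]) auto
  qed
qed

context vector_space
begin

text \<open>A nontrivial solution of the system formed by the coordinates \<open>a i t\<close>
  cancels all the \<open>w t\<close>, so the combination of the \<open>f i\<close> equals the same
  combination of the errors, which lie in \<open>B\<close>.\<close>

lemma dependent_mod:
  assumes B: "subspace B" and fin: "finite I" "finite T" and card: "card T < card I"
    and span: "\<And>i. i \<in> I \<Longrightarrow> f i - (\<Sum>t\<in>T. scale (a i t) (w t)) \<in> B"
  obtains c where "\<exists>i\<in>I. c i \<noteq> 0" "(\<Sum>i\<in>I. scale (c i) (f i)) \<in> B"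
proof -
  obtain c where c: "\<exists>i\<in>I. c i \<noteq> 0" "\<forall>t\<in>T. (\<Sum>i\<in>I. c i * a i t) = 0"
    using homogeneous_system_nontrivial[OF fin(2,1) card] by blast
  have "(\<Sum>i\<in>I. scale (c i) (\<Sum>t\<in>T. scale (a i t) (w t)))
      = (\<Sum>i\<in>I. \<Sum>t\<in>T. scale (c i * a i t) (w t))"
    by (simp add: scale_sum_right)
  also have "\<dots> = (\<Sum>t\<in>T. \<Sum>i\<in>I. scale (c i * a i t) (w t))" by (rule sum.swap)
  also have "\<dots> = (\<Sum>t\<in>T. scale (\<Sum>i\<in>I. c i * a i t) (w t))" by (simp add: scale_sum_left)
  also have "\<dots> = 0" using c(2) by simp
  finally have "(\<Sum>i\<in>I. scale (c i) (f i))
      = (\<Sum>i\<in>I. scale (c i) (f i - (\<Sum>t\<in>T. scale (a i t) (w t))))"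
    by (simp add: scale_right_diff_distrib sum_subtractf)
  also have "\<dots> \<in> B" by (intro subspace_sum[OF B] subspace_scale[OF B] span)
  finally show thesis using that c(1) by blast
qed

end

text \<open>The quotient \<open>A / B\<close> occurs below as cotangent space, as \<open>H^1\<close>
  of the structure sheaf and as fibre of a bundle. Module operations on cosets are reduced here to
  operations on representatives.\<close>

locale subspace_pair = vector_space sc
  for sc :: "'k::field \<Rightarrow> 'v::ab_group_add \<Rightarrow> 'v" +
  fixes A B :: "'v set"
  assumes A: "subspace A" and B: "subspace B" and BA: "B \<subseteq> A"
begin

abbreviation "Q \<equiv> quotient_space sc A B"

lemma coset_eq_iff: "coset_of B u = coset_of B v \<longleftrightarrow> u - v \<in> B"
proof
  assume "coset_of B u = coset_of B v"
  moreover have "u \<in> coset_of B u" using subspace_0[OF B] by (force simp: coset_of_def)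
  ultimately obtain b where "b \<in> B" "u = v + b" by (auto simp: coset_of_def)
  then show "u - v \<in> B" by simp
next
  assume uv: "u - v \<in> B"
  have *: "coset_of B u \<subseteq> coset_of B v" if "u - v \<in> B" for u v
  proof
    fix z assume "z \<in> coset_of B u"
    then obtain b where b: "b \<in> B" "z = u + b" by (auto simp: coset_of_def)
    then have "z = v + ((u - v) + b)" by simp
    then show "z \<in> coset_of B v"
      using subspace_add[OF B that b(1)] unfolding coset_of_def by blast
  qed
  have "v - u \<in> B" using subspace_neg[OF B uv] by simp
  then show "coset_of B u = coset_of B v" using *[OF uv] * by blast
qed

lemma coset_mem: "u \<in> A \<Longrightarrow> coset_of B u \<in> carrier Q"
  by (simp add: quotient_space_def)

lemma carrierE:
  assumes "X \<in> carrier Q" obtains u where "u \<in> A" "X = coset_of B u"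
  using assms by (auto simp: quotient_space_def)

lemma zero_coset: "\<zero>\<^bsub>Q\<^esub> = coset_of B 0"
  by (simp add: quotient_space_def coset_of_def)

lemma add_coset: "coset_of B u \<oplus>\<^bsub>Q\<^esub> coset_of B v = coset_of B (u + v)"
proof -
  have "{x + y | x y. x \<in> coset_of B u \<and> y \<in> coset_of B v} = coset_of B (u + v)"
  proof (intro equalityI subsetI)
    fix z assume "z \<in> {x + y | x y. x \<in> coset_of B u \<and> y \<in> coset_of B v}"
    then obtain b b' where "b \<in> B" "b' \<in> B" "z = (u + b) + (v + b')" by (auto simp: coset_of_def)
    then have "z = (u + v) + (b + b')" "b + b' \<in> B"
      using subspace_add[OF B] by (auto simp: algebra_simps)
    then show "z \<in> coset_of B (u + v)" unfolding coset_of_def by blast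
  next
    fix z assume "z \<in> coset_of B (u + v)"
    then obtain b where "b \<in> B" "z = (u + 0) + (v + b)" by (auto simp: coset_of_def algebra_simps)
    then show "z \<in> {x + y | x y. x \<in> coset_of B u \<and> y \<in> coset_of B v}"
      using subspace_0[OF B] unfolding coset_of_def by blast
  qed
  then show ?thesis by (simp add: quotient_space_def)
qed

lemma smult_coset: "a \<odot>\<^bsub>Q\<^esub> coset_of B u = coset_of B (sc a u)"
proof -
  have "{sc a x + b | x b. x \<in> coset_of B u \<and> b \<in> B} = coset_of B (sc a u)"
  proof (intro equalityI subsetI)
    fix z assume "z \<in> {sc a x + b | x b. x \<in> coset_of B u \<and> b \<in> B}"
    then obtain b b' where "b \<in> B" "b' \<in> B" "z = sc a (u + b) + b'" by (auto simp: coset_of_def)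
    then have "z = sc a u + (sc a b + b')" "sc a b + b' \<in> B"
      using subspace_add[OF B] subspace_scale[OF B] by (auto simp: algebra_simps)
    then show "z \<in> coset_of B (sc a u)" unfolding coset_of_def by blast
  next
    fix z assume "z \<in> coset_of B (sc a u)"
    then obtain b where "b \<in> B" "z = sc a (u + 0) + b" by (auto simp: coset_of_def)
    then show "z \<in> {sc a x + b | x b. x \<in> coset_of B u \<and> b \<in> B}"
      using subspace_0[OF B] unfolding coset_of_def by blast
  qed
  then show ?thesis by (simp add: quotient_space_def)
qed

lemma abelian_group_Q: "abelian_group Q"
proof (rule abelian_groupI)
  fix X assume "X \<in> carrier Q"
  then obtain u where u: "u \<in> A" "X = coset_of B u" by (rule carrierE)
  show "\<exists>Y\<in>carrier Q. Y \<oplus>\<^bsub>Q\<^esub> X = \<zero>\<^bsub>Q\<^esub>"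
    using u subspace_neg[OF A] by (intro bexI[of _ "coset_of B (- u)"])
      (auto simp: add_coset zero_coset coset_mem)
qed (auto elim!: carrierE simp: add_coset zero_coset algebra_simps
    intro!: coset_mem subspace_add[OF A] subspace_0[OF A])

lemma finsum_coset:
  assumes "\<And>i. i \<in> I \<Longrightarrow> f i \<in> A"
  shows "(\<Oplus>\<^bsub>Q\<^esub>i\<in>I. coset_of B (f i)) = coset_of B (\<Sum>i\<in>I. f i)"
proof (cases "finite I")
  case True
  interpret Q: abelian_group Q by (rule abelian_group_Q)
  from True assms show ?thesis
  proof (induction I rule: finite_induct)
    case (insert i I)
    have "(\<Oplus>\<^bsub>Q\<^esub>j\<in>insert i I. coset_of B (f j)) =
        coset_of B (f i) \<oplus>\<^bsub>Q\<^esub> (\<Oplus>\<^bsub>Q\<^esub>j\<in>I. coset_of B (f j))"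
      using insert by (intro Q.finsum_insert) (auto intro!: coset_mem)
    then show ?case using insert by (simp add: add_coset)
  qed (simp add: zero_coset)
next
  case False
  \<comment> \<open>Over an infinite index set both sums are zero by convention.\<close>
  then show ?thesis by (simp add: finsum_def finprod_def zero_coset)
qed

lemma minus_coset:
  assumes "u \<in> A" "v \<in> A"
  shows "coset_of B u \<ominus>\<^bsub>Q\<^esub> coset_of B v = coset_of B (u - v)"
proof -
  interpret Q: abelian_group Q by (rule abelian_group_Q)
  have "\<ominus>\<^bsub>Q\<^esub> coset_of B v = coset_of B (- v)"
    using assms subspace_neg[OF A] by (intro Q.minus_equality) (auto simp: add_coset zero_coset coset_mem)
  then show ?thesis by (simp add: a_minus_def add_coset)
qed

text \<open>Equality in the quotient becomes membership of a difference in \<open>B\<close>, so that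
  later counts can stay in the ambient space.\<close>

lemma has_dim_iff:
  "has_dim Q n \<longleftrightarrow> (\<exists>b. (\<forall>i<n. b i \<in> A) \<and> (\<forall>v\<in>A. \<exists>!c. c \<in> extensional {..<n} \<and>
     v - (\<Sum>i<n. sc (c i) (b i)) \<in> B))"
proof -
  have key: "(coset_of B v = (\<Oplus>\<^bsub>Q\<^esub>i\<in>{..<n}. c i \<odot>\<^bsub>Q\<^esub> coset_of B (b i)))
      \<longleftrightarrow> v - (\<Sum>i<n. sc (c i) (b i)) \<in> B" if "\<forall>i<n. b i \<in> A" for v c b
  proof -
    have "(\<Oplus>\<^bsub>Q\<^esub>i\<in>{..<n}. coset_of B (sc (c i) (b i))) = coset_of B (\<Sum>i<n. sc (c i) (b i))"
      using that by (intro finsum_coset subspace_scale[OF A]) auto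
    then show ?thesis by (simp add: smult_coset coset_eq_iff)
  qed
  show ?thesis
  proof
    assume "has_dim Q n"
    then obtain b where b: "b \<in> {..<n} \<rightarrow> carrier Q" "\<forall>v\<in>carrier Q.
       \<exists>!c. c \<in> extensional {..<n} \<and> v = (\<Oplus>\<^bsub>Q\<^esub>i\<in>{..<n}. c i \<odot>\<^bsub>Q\<^esub> b i)"
      unfolding has_dim_def by blast
    have "\<forall>i. \<exists>u. i < n \<longrightarrow> u \<in> A \<and> b i = coset_of B u" using b(1) by (fastforce elim: carrierE)
    then obtain u where u: "\<And>i. i < n \<Longrightarrow> u i \<in> A" "\<And>i. i < n \<Longrightarrow> b i = coset_of B (u i)" by metis
    interpret Q: abelian_group Q by (rule abelian_group_Q)
    have u': "\<forall>i<n. u i \<in> A" using u(1) by blast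
    have "(\<Oplus>\<^bsub>Q\<^esub>i\<in>{..<n}. c i \<odot>\<^bsub>Q\<^esub> b i) = (\<Oplus>\<^bsub>Q\<^esub>i\<in>{..<n}. c i \<odot>\<^bsub>Q\<^esub> coset_of B (u i))" for c
      by (rule Q.finsum_cong')
        (auto simp: u smult_coset intro!: coset_mem subspace_scale[OF A])
    then have eq: "(coset_of B v = (\<Oplus>\<^bsub>Q\<^esub>i\<in>{..<n}. c i \<odot>\<^bsub>Q\<^esub> b i))
        \<longleftrightarrow> v - (\<Sum>i<n. sc (c i) (u i)) \<in> B" for c v
      using key[OF u'] by (simp only:)
    have "\<exists>!c. c \<in> extensional {..<n} \<and> v - (\<Sum>i<n. sc (c i) (u i)) \<in> B" if "v \<in> A" for v
      using bspec[OF b(2) coset_mem[OF that]] unfolding eq .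
    then show "\<exists>b. (\<forall>i<n. b i \<in> A) \<and> (\<forall>v\<in>A. \<exists>!c. c \<in> extensional {..<n} \<and>
        v - (\<Sum>i<n. sc (c i) (b i)) \<in> B)"
      using u' by (intro exI[of _ u]) simp
  next
    assume "\<exists>b. (\<forall>i<n. b i \<in> A) \<and> (\<forall>v\<in>A. \<exists>!c. c \<in> extensional {..<n} \<and>
        v - (\<Sum>i<n. sc (c i) (b i)) \<in> B)"
    then obtain b where b: "\<forall>i<n. b i \<in> A" "\<forall>v\<in>A. \<exists>!c. c \<in> extensional {..<n} \<and>
        v - (\<Sum>i<n. sc (c i) (b i)) \<in> B" by blast
    have "\<exists>!c. c \<in> extensional {..<n} \<and> X = (\<Oplus>\<^bsub>Q\<^esub>i\<in>{..<n}. c i \<odot>\<^bsub>Q\<^esub> coset_of B (b i))"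
      if X: "X \<in> carrier Q" for X
    proof -
      obtain v where v: "v \<in> A" "X = coset_of B v" using X by (rule carrierE)
      show ?thesis unfolding v(2) key[OF b(1)] using b(2) v(1) by blast
    qed
    then show "has_dim Q n" unfolding has_dim_def
      using b(1) by (intro bexI[of _ "\<lambda>i. coset_of B (b i)"]) (auto intro!: coset_mem)
  qed
qed

lemma has_dim_indep:
  assumes "\<forall>v\<in>A. \<exists>!c. c \<in> extensional {..<n} \<and> v - (\<Sum>i<n. sc (c i) (b i)) \<in> B"
    and "(\<Sum>i<n. sc (c i) (b i)) \<in> B" "i < n"
  shows "c i = 0"
proof -
  have "\<exists>!c. c \<in> extensional {..<n} \<and> 0 - (\<Sum>i<n. sc (c i) (b i)) \<in> B"
    using assms(1) subspace_0[OF A] by blast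
  moreover have "0 - (\<Sum>i<n. sc (restrict c {..<n} i) (b i)) \<in> B"
    using subspace_neg[OF B assms(2)] by simp
  moreover have "0 - (\<Sum>i<n. sc (restrict (\<lambda>_. 0) {..<n} i) (b i)) \<in> B"
    using subspace_0[OF B] by simp
  ultimately have "restrict c {..<n} = restrict (\<lambda>_. 0) {..<n}" by blast
  then show ?thesis using assms(3) by (metis lessThan_iff restrict_apply')
qed

text \<open>Makes the description that defines \<open>genus\<close> unambiguous. A basis with more
  members than another would be dependent modulo \<open>B\<close>.\<close>

lemma has_dim_unique:
  assumes "has_dim Q m" "has_dim Q n" shows "m = n"
proof -
  have "m \<le> n" if mn: "has_dim Q m" "has_dim Q n" for m n :: nat
  proof (rule ccontr)
    assume "\<not> m \<le> n"
    obtain b where b: "\<forall>i<m. b i \<in> A" "\<forall>v\<in>A. \<exists>!c. c \<in> extensional {..<m} \<and>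
        v - (\<Sum>i<m. sc (c i) (b i)) \<in> B" using mn(1) unfolding has_dim_iff by blast
    obtain d where d: "\<forall>v\<in>A. \<exists>!c. c \<in> extensional {..<n} \<and>
        v - (\<Sum>i<n. sc (c i) (d i)) \<in> B" using mn(2) unfolding has_dim_iff by blast
    have "\<forall>j. \<exists>c. j < m \<longrightarrow> b j - (\<Sum>i<n. sc (c i) (d i)) \<in> B" using b(1) d by blast
    then obtain a where a: "\<And>j. j < m \<Longrightarrow> b j - (\<Sum>i<n. sc (a j i) (d i)) \<in> B" by metis
    have card: "card {..<n} < card {..<m}" using \<open>\<not> m \<le> n\<close> by simp
    show False
    proof (rule dependent_mod[OF B _ _ card, of b a d])
      fix c assume "\<exists>i\<in>{..<m}. c i \<noteq> 0" "(\<Sum>i<m. sc (c i) (b i)) \<in> B"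
      then show False using has_dim_indep[OF b(2)] by auto
    qed (use a in auto)
  qed
  then show ?thesis using assms by (simp add: le_antisym)
qed

text \<open>A family in \<open>A\<close> that is independent modulo \<open>B\<close> and of maximal
  length is a basis. The spanning family bounds the lengths; its members \<open>w t\<close> may lie
  outside \<open>A\<close>.\<close>

lemma has_dim_exists:
  assumes T: "finite T" and span: "\<And>v. v \<in> A \<Longrightarrow> \<exists>c. v - (\<Sum>t\<in>T. sc (c t) (w t)) \<in> B"
  shows "\<exists>n. has_dim Q n"
proof -
  define ind where "ind n \<longleftrightarrow> (\<exists>b. (\<forall>i<n. b i \<in> A) \<and>
    (\<forall>c. (\<Sum>i<n. sc (c i) (b i)) \<in> B \<longrightarrow> (\<forall>i<n. c i = 0)))" for n :: nat
  have "ind 0" by (simp add: ind_def)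
  moreover have "n \<le> card T" if ind_n: "ind n" for n :: nat
  proof (rule ccontr)
    assume "\<not> n \<le> card T"
    obtain b where b: "\<forall>i<n. b i \<in> A" "\<forall>c. (\<Sum>i<n. sc (c i) (b i)) \<in> B \<longrightarrow> (\<forall>i<n. c i = 0)"
      using ind_n unfolding ind_def by blast
    have "\<forall>j. \<exists>c. j < n \<longrightarrow> b j - (\<Sum>t\<in>T. sc (c t) (w t)) \<in> B" using b(1) span by blast
    then obtain a where a: "\<And>j. j < n \<Longrightarrow> b j - (\<Sum>t\<in>T. sc (a j t) (w t)) \<in> B" by metis
    have card: "card T < card {..<n}" using \<open>\<not> n \<le> card T\<close> by simp
    show False
    proof (rule dependent_mod[OF B _ _ card, of b a w])
      fix c assume "\<exists>i\<in>{..<n}. c i \<noteq> 0" "(\<Sum>i<n. sc (c i) (b i)) \<in> B"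
      then show False using b(2) by auto
    qed (use a T in auto)
  qed
  ultimately obtain n where n: "ind n" "\<And>m. ind m \<Longrightarrow> m \<le> n"
    using ex_has_greatest_nat[of ind 0 "\<lambda>n. n" "Suc (card T)"] by (auto simp: less_Suc_eq_le)
  obtain b where b: "\<forall>i<n. b i \<in> A" "\<And>c. (\<Sum>i<n. sc (c i) (b i)) \<in> B \<Longrightarrow> \<forall>i<n. c i = 0"
    using n(1) unfolding ind_def by blast
  have "\<exists>!c. c \<in> extensional {..<n} \<and> v - (\<Sum>i<n. sc (c i) (b i)) \<in> B" if v: "v \<in> A" for v
  proof -
    have "\<not> ind (Suc n)" using n(2)[of "Suc n"] by auto
    moreover have "\<forall>i<Suc n. (b(n := v)) i \<in> A" using b(1) v by (simp add: less_Suc_eq)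
    ultimately obtain c where c: "(\<Sum>i<Suc n. sc (c i) ((b(n := v)) i)) \<in> B" "\<not> (\<forall>i<Suc n. c i = 0)"
      unfolding ind_def by blast
    then have c1: "(\<Sum>i<n. sc (c i) (b i)) + sc (c n) v \<in> B" by simp
    \<comment> \<open>Were the coefficient of \<open>v\<close> zero, the relation would contradict
      the independence of the \<open>b i\<close>; hence it can be solved for
      \<open>v\<close>.\<close>
    have cn: "c n \<noteq> 0"
    proof
      assume "c n = 0"
      then have "\<forall>i<n. c i = 0" using c1 by (intro b(2)) simp
      with \<open>c n = 0\<close> c(2) show False by (simp add: less_Suc_eq)
    qed
    define d where "d = restrict (\<lambda>i. - c i / c n) {..<n}"
    have "sc (1 / c n) ((\<Sum>i<n. sc (c i) (b i)) + sc (c n) v) = v - (\<Sum>i<n. sc (d i) (b i))"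
      using cn by (simp add: scale_right_distrib scale_sum_right d_def sum_negf)
    then have d: "v - (\<Sum>i<n. sc (d i) (b i)) \<in> B" using subspace_scale[OF B c1] by metis
    show ?thesis
    proof (intro ex1I conjI)
      show "d \<in> extensional {..<n}" "v - (\<Sum>i<n. sc (d i) (b i)) \<in> B" using d by (auto simp: d_def)
      fix e assume e: "e \<in> extensional {..<n} \<and> v - (\<Sum>i<n. sc (e i) (b i)) \<in> B"
      then have "(v - (\<Sum>i<n. sc (d i) (b i))) - (v - (\<Sum>i<n. sc (e i) (b i))) \<in> B"
        using subspace_diff[OF B d] by blast
      then have "(\<Sum>i<n. sc (e i - d i) (b i)) \<in> B"
        by (simp add: scale_left_diff_distrib sum_subtractf)
      then have "\<forall>i<n. e i = d i" using b(2)[of "\<lambda>i. e i - d i"] by simp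
      then show "e = d" using e by (intro extensionalityI[of _ "{..<n}"]) (auto simp: d_def)
    qed
  qed
  then have "\<forall>v\<in>A. \<exists>!c. c \<in> extensional {..<n} \<and> v - (\<Sum>i<n. sc (c i) (b i)) \<in> B"
    by (rule ballI)
  with b(1) show ?thesis unfolding has_dim_iff by (intro exI[of _ n] exI[of _ b] conjI)
qed

end

section \<open>Forms and local rings\<close>

lemma finite_exponents: "finite {e :: 'i::finite \<Rightarrow> nat. sum e UNIV = d}"
proof (rule finite_subset)
  show "{e :: 'i \<Rightarrow> nat. sum e UNIV = d} \<subseteq> PiE UNIV (\<lambda>_. {..d})"
    by (auto simp: PiE_def member_le_sum)
qed (auto intro: finite_PiE)

text \<open>The convolution acts on coefficients and not on values, so that one product form can be
  evaluated at the generic point and at closed points alike.\<close>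

definition form_mult ::
    "nat \<Rightarrow> nat \<Rightarrow> (('i::finite \<Rightarrow> nat) \<Rightarrow> 'k::comm_ring_1) \<Rightarrow> (('i \<Rightarrow> nat) \<Rightarrow> 'k) \<Rightarrow> ('i \<Rightarrow> nat) \<Rightarrow> 'k"
  where "form_mult d d' F G e =
    (\<Sum>p | p \<in> {a. sum a UNIV = d} \<times> {b. sum b UNIV = d'} \<and> fst p + snd p = e. F (fst p) * G (snd p))"

definition form_monom :: "('i::finite \<Rightarrow> nat) \<Rightarrow> ('i \<Rightarrow> nat) \<Rightarrow> 'k::comm_ring_1"
  where "form_monom m e = (if e = m then 1 else 0)"

lemma form_val_scale:
  "form_val h d F (\<lambda>i. a * z i) = a ^ d * form_val h d F z" for z :: "'i::finite \<Rightarrow> 'a::comm_ring_1"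
proof -
  have "h (F e) * (\<Prod>i\<in>UNIV. (a * z i) ^ e i) = a ^ d * (h (F e) * (\<Prod>i\<in>UNIV. z i ^ e i))"
    if "sum e UNIV = d" for e
    using that by (simp add: power_mult_distrib prod.distrib power_sum[symmetric] mult_ac)
  then show ?thesis by (simp add: form_val_def sum_distrib_left)
qed

context comm_ring_hom
begin

lemma form_val_add: "form_val hom d (\<lambda>e. F e + G e) z = form_val hom d F z + form_val hom d G z"
  by (simp add: form_val_def hom_distribs distrib_right sum.distrib)

lemma form_val_smult: "form_val hom d (\<lambda>e. a * F e) z = hom a * form_val hom d F z"
  by (simp add: form_val_def hom_distribs sum_distrib_left mult.assoc)

lemma form_val_sum: "form_val hom d (\<lambda>e. \<Sum>s\<in>S. F s e) z = (\<Sum>s\<in>S. form_val hom d (F s) z)"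
  by (simp add: form_val_def hom_distribs sum_distrib_right) (rule sum.swap)

lemma form_val_monom: "form_val hom (sum m UNIV) (form_monom m) z = (\<Prod>i\<in>UNIV. z i ^ m i)"
proof -
  have "form_val hom (sum m UNIV) (form_monom m) z
      = (\<Sum>e | sum e UNIV = sum m UNIV. if e = m then (\<Prod>i\<in>UNIV. z i ^ e i) else 0)"
    unfolding form_val_def by (rule sum.cong) (auto simp: form_monom_def)
  then show ?thesis by (simp add: sum.delta finite_exponents)
qed

lemma form_val_power_coord:
  "form_val hom n (form_monom (\<lambda>k. if k = i then n else 0)) z = z i ^ n" for i :: "'i::finite"
proof -
  have "(\<Prod>k\<in>UNIV. z k ^ (if k = i then n else 0)) = (\<Prod>k\<in>UNIV. if k = i then z k ^ n else 1)"
    by (rule prod.cong) auto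
  then show ?thesis
    using form_val_monom[of "\<lambda>k. if k = i then n else 0" z] by (simp add: prod.delta)
qed

lemma form_val_mult:
  "form_val hom (d + d') (form_mult d d' F G) z = form_val hom d F z * form_val hom d' G z"
proof -
  let ?E = "\<lambda>d. {e :: 'c \<Rightarrow> nat. sum e UNIV = d}"
  let ?t = "\<lambda>p. (hom (F (fst p)) * hom (G (snd p))) * (\<Prod>i\<in>UNIV. z i ^ (fst p i + snd p i))"
  have "form_val hom d F z * form_val hom d' G z = (\<Sum>p\<in>?E d \<times> ?E d'. ?t p)"
    by (simp add: form_val_def sum_product sum.cartesian_product split_def power_add prod.distrib mult_ac)
  \<comment> \<open>Pairs of exponent vectors are grouped by their sum, the exponent vector of the
    product monomial.\<close>
  also have "\<dots> = (\<Sum>e\<in>?E (d + d'). \<Sum>p | p \<in> ?E d \<times> ?E d' \<and> fst p + snd p = e. ?t p)"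
    by (rule sum.group[symmetric]) (auto simp: finite_exponents sum.distrib)
  also have "\<dots> = form_val hom (d + d') (form_mult d d' F G) z"
    unfolding form_val_def
  proof (rule sum.cong[OF refl])
    fix e
    have "(\<Sum>p | p \<in> ?E d \<times> ?E d' \<and> fst p + snd p = e. ?t p) =
      (\<Sum>p | p \<in> ?E d \<times> ?E d' \<and> fst p + snd p = e. hom (F (fst p) * G (snd p)) * (\<Prod>i\<in>UNIV. z i ^ e i))"
      by (rule sum.cong[OF refl]) (auto simp: hom_distribs)
    then show "(\<Sum>p | p \<in> ?E d \<times> ?E d' \<and> fst p + snd p = e. ?t p) =
        hom (form_mult d d' F G e) * (\<Prod>i\<in>UNIV. z i ^ e i)"
      by (simp add: form_mult_def hom_distribs sum_distrib_right)
  qed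
  finally show ?thesis by simp
qed

end

lemma comm_ring_hom_id: "comm_ring_hom (id :: 'k::comm_ring_1 \<Rightarrow> 'k)"
  by unfold_locales auto

section \<open>Local rings and residues at closed points\<close>

locale smooth_curve =
  fixes C :: "('k::alg_closed_field, 'K::field, 'i::finite) curve"
  assumes smooth: "smooth_projective_curve C"
begin

abbreviation "\<O> \<equiv> local_ring C"
abbreviation "\<mm> \<equiv> max_ideal C"
abbreviation "h \<equiv> emb C"
abbreviation "gval d F \<equiv> form_val (emb C) d F (coords C)"
abbreviation "pval d F z \<equiv> form_val (id :: 'k \<Rightarrow> 'k) d F z"

sublocale emb: field_hom h
  using smooth by (simp add: smooth_projective_curve_def)

sublocale idh: comm_ring_hom "id :: 'k \<Rightarrow> 'k"
  by (rule comm_ring_hom_id)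

definition rep :: "('k, 'i) point \<Rightarrow> 'i \<Rightarrow> 'k"
  where "rep p = (SOME z. z \<in> p)"

lemma rep:
  assumes "p \<in> points C"
  shows "\<exists>i. rep p i \<noteq> 0" "gval d F = 0 \<Longrightarrow> pval d F (rep p) = 0"
    "p = {(\<lambda>i. a * rep p i) | a. a \<noteq> 0}"
proof -
  obtain z where z: "p = {(\<lambda>i. a * z i) | a. a \<noteq> 0}" "\<exists>i. z i \<noteq> 0"
      "\<And>d F. gval d F = 0 \<Longrightarrow> pval d F z = 0"
    using assms unfolding points_def by blast
  have "z \<in> p" unfolding z(1) by (intro CollectI exI[of _ 1]) auto
  then have "rep p \<in> p" unfolding rep_def by (rule someI[where P = "\<lambda>z. z \<in> p"])
  then obtain b where b: "b \<noteq> 0" "rep p = (\<lambda>i. b * z i)" unfolding z(1) by auto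
  show "\<exists>i. rep p i \<noteq> 0" using b z(2) by auto
  show "pval d F (rep p) = 0" if "gval d F = 0" using z(3)[OF that] b by (simp add: form_val_scale)
  show "p = {(\<lambda>i. a * rep p i) | a. a \<noteq> 0}"
  proof (intro equalityI subsetI)
    fix y assume "y \<in> p"
    then obtain a where "a \<noteq> 0" "y = (\<lambda>i. a * z i)" unfolding z(1) by auto
    then show "y \<in> {(\<lambda>i. a * rep p i) | a. a \<noteq> 0}"
      using b by (intro CollectI exI[of _ "a / b"]) auto
  next
    fix y assume "y \<in> {(\<lambda>i. a * rep p i) | a. a \<noteq> 0}"
    then obtain a where "a \<noteq> 0" "y = (\<lambda>i. a * rep p i)" by auto
    then have "a * b \<noteq> 0" "y = (\<lambda>i. (a * b) * z i)" using b by (auto simp: mult.assoc)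
    then show "y \<in> p" unfolding z(1) by blast
  qed
qed

lemma pval_point_iff:
  assumes "p \<in> points C"
  shows "(\<forall>z\<in>p. pval d F z = 0) \<longleftrightarrow> pval d F (rep p) = 0"
    and "(\<forall>z\<in>p. pval d F z \<noteq> 0) \<longleftrightarrow> pval d F (rep p) \<noteq> 0"
proof -
  have "rep p \<in> p"
    by (subst rep(3)[OF assms], intro CollectI exI[of _ 1]) auto
  moreover have "pval d F z = 0 \<longleftrightarrow> pval d F (rep p) = 0" if "z \<in> p" for z
  proof -
    obtain a where "a \<noteq> 0" "z = (\<lambda>i. a * rep p i)" using \<open>z \<in> p\<close> rep(3)[OF assms] by blast
    then show ?thesis by (simp add: form_val_scale)
  qed
  ultimately show "(\<forall>z\<in>p. pval d F z = 0) \<longleftrightarrow> pval d F (rep p) = 0"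
    and "(\<forall>z\<in>p. pval d F z \<noteq> 0) \<longleftrightarrow> pval d F (rep p) \<noteq> 0" by blast+
qed

text \<open>In the chart where coordinate \<open>i\<close> is nonzero a point is determined by its
  affine coordinates, since the chosen representatives then differ by the factor
  \<open>c\<close>.\<close>

lemma point_eqI:
  assumes "p \<in> points C" "q \<in> points C" "rep p i \<noteq> 0" "rep q i \<noteq> 0"
    and "\<And>j. rep p j / rep p i = rep q j / rep q i"
  shows "p = q"
proof -
  define c where "c = rep p i / rep q i"
  have c: "c \<noteq> 0" using assms by (simp add: c_def)
  have pq: "rep p = (\<lambda>j. c * rep q j)"
  proof
    fix j show "rep p j = c * rep q j"
      using assms(3,4) assms(5)[of j] by (simp add: c_def field_simps)
  qed
  have "p = {(\<lambda>i. a * (c * rep q i)) | a. a \<noteq> 0}" using rep(3)[OF assms(1)] pq by simp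
  also have "\<dots> = {(\<lambda>i. a * rep q i) | a. a \<noteq> 0}"
  proof (intro equalityI subsetI)
    fix y assume "y \<in> {(\<lambda>i. a * (c * rep q i)) | a. a \<noteq> 0}"
    then obtain a where "a \<noteq> 0" "y = (\<lambda>i. a * (c * rep q i))" by auto
    then show "y \<in> {(\<lambda>i. a * rep q i) | a. a \<noteq> 0}"
      using c by (intro CollectI exI[of _ "a * c"]) (auto simp: mult.assoc)
  next
    fix y assume "y \<in> {(\<lambda>i. a * rep q i) | a. a \<noteq> 0}"
    then obtain a where "a \<noteq> 0" "y = (\<lambda>i. a * rep q i)" by auto
    then show "y \<in> {(\<lambda>i. a * (c * rep q i)) | a. a \<noteq> 0}"
      using c by (intro CollectI exI[of _ "a / c"]) auto
  qed
  also have "\<dots> = q" using rep(3)[OF assms(2)] by simp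
  finally show ?thesis .
qed

lemma gval_nonzero: "p \<in> points C \<Longrightarrow> pval d G (rep p) \<noteq> 0 \<Longrightarrow> gval d G \<noteq> 0"
  using rep(2) by blast

lemma local_ringI:
  "p \<in> points C \<Longrightarrow> pval d G (rep p) \<noteq> 0 \<Longrightarrow> gval d F / gval d G \<in> \<O> p"
  unfolding local_ring_def using pval_point_iff by blast

lemma local_ringE:
  assumes "p \<in> points C" "f \<in> \<O> p"
  obtains d F G where "pval d G (rep p) \<noteq> 0" "f = gval d F / gval d G"
  using assms unfolding local_ring_def using pval_point_iff[OF assms(1)] by blast

text \<open>The value at \<open>p\<close> of a function regular there, that is the residue map of
  the local ring. For other functions the description is void and the value arbitrary.\<close>

definition res :: "('k, 'i) point \<Rightarrow> 'K \<Rightarrow> 'k"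
  where "res p f = (THE c. \<exists>d F G. pval d G (rep p) \<noteq> 0 \<and> f = gval d F / gval d G \<and>
     c = pval d F (rep p) / pval d G (rep p))"

text \<open>Cross multiplication turns two presentations of one function into a form of degree
  \<open>d + d'\<close> vanishing at the generic point, and such a form vanishes at every closed
  point.\<close>

lemma res_eq:
  assumes p: "p \<in> points C" and G: "pval d G (rep p) \<noteq> 0"
  shows "res p (gval d F / gval d G) = pval d F (rep p) / pval d G (rep p)"
  unfolding res_def
proof (rule the_equality)
  show "\<exists>d' F' G'. pval d' G' (rep p) \<noteq> 0 \<and> gval d F / gval d G = gval d' F' / gval d' G' \<and>
      pval d F (rep p) / pval d G (rep p) = pval d' F' (rep p) / pval d' G' (rep p)"
    using G by blast
  fix c assume "\<exists>d' F' G'. pval d' G' (rep p) \<noteq> 0 \<and> gval d F / gval d G = gval d' F' / gval d' G' \<and>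
      c = pval d' F' (rep p) / pval d' G' (rep p)"
  then obtain d' F' G' where G': "pval d' G' (rep p) \<noteq> 0"
    and eq: "gval d F / gval d G = gval d' F' / gval d' G'"
    and c: "c = pval d' F' (rep p) / pval d' G' (rep p)" by blast
  have "gval d F * gval d' G' = gval d G * gval d' F'"
    using eq gval_nonzero[OF p G] gval_nonzero[OF p G'] by (simp add: field_simps)
  then have "gval (d + d') (\<lambda>e. form_mult d d' F G' e + - 1 * form_mult d d' G F' e) = 0"
    unfolding emb.form_val_add emb.form_val_smult emb.form_val_mult by (simp add: hom_distribs)
  then have "pval (d + d') (\<lambda>e. form_mult d d' F G' e + - 1 * form_mult d d' G F' e) (rep p) = 0"
    by (rule rep(2)[OF p])
  then have "pval d F (rep p) * pval d' G' (rep p) = pval d G (rep p) * pval d' F' (rep p)"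
    unfolding idh.form_val_add idh.form_val_smult idh.form_val_mult by simp
  then show "c = pval d F (rep p) / pval d G (rep p)"
    unfolding c using G G' by (simp add: frac_eq_eq mult.commute)
qed

lemma local_ring_add:
  assumes p: "p \<in> points C" and "f \<in> \<O> p" "g \<in> \<O> p"
  shows "f + g \<in> \<O> p" "res p (f + g) = res p f + res p g"
proof -
  obtain d F G where G: "pval d G (rep p) \<noteq> 0" "f = gval d F / gval d G"
    using local_ringE[OF p assms(2)] .
  obtain d' F' G' where G': "pval d' G' (rep p) \<noteq> 0" "g = gval d' F' / gval d' G'"
    using local_ringE[OF p assms(3)] .
  let ?F = "\<lambda>e. form_mult d d' F G' e + form_mult d d' G F' e" and ?G = "form_mult d d' G G'"
  have 1: "f + g = gval (d + d') ?F / gval (d + d') ?G"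
    unfolding emb.form_val_add emb.form_val_mult G(2) G'(2)
    using gval_nonzero[OF p G(1)] gval_nonzero[OF p G'(1)] by (simp add: add_frac_eq mult.commute)
  have 2: "pval (d + d') ?G (rep p) \<noteq> 0" unfolding idh.form_val_mult using G(1) G'(1) by simp
  show "f + g \<in> \<O> p" unfolding 1 by (rule local_ringI[OF p 2])
  show "res p (f + g) = res p f + res p g"
    unfolding 1 res_eq[OF p 2] unfolding G(2) G'(2) res_eq[OF p G(1)] res_eq[OF p G'(1)]
      idh.form_val_add idh.form_val_mult using G(1) G'(1) by (simp add: field_simps)
qed

lemma local_ring_mult:
  assumes p: "p \<in> points C" and "f \<in> \<O> p" "g \<in> \<O> p"
  shows "f * g \<in> \<O> p" "res p (f * g) = res p f * res p g"
proof -
  obtain d F G where G: "pval d G (rep p) \<noteq> 0" "f = gval d F / gval d G"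
    using local_ringE[OF p assms(2)] .
  obtain d' F' G' where G': "pval d' G' (rep p) \<noteq> 0" "g = gval d' F' / gval d' G'"
    using local_ringE[OF p assms(3)] .
  let ?F = "form_mult d d' F F'" and ?G = "form_mult d d' G G'"
  have 1: "f * g = gval (d + d') ?F / gval (d + d') ?G"
    unfolding emb.form_val_mult using G(2) G'(2) by simp
  have 2: "pval (d + d') ?G (rep p) \<noteq> 0" unfolding idh.form_val_mult using G(1) G'(1) by simp
  show "f * g \<in> \<O> p" unfolding 1 by (rule local_ringI[OF p 2])
  show "res p (f * g) = res p f * res p g"
    unfolding 1 res_eq[OF p 2] unfolding G(2) G'(2) res_eq[OF p G(1)] res_eq[OF p G'(1)]
      idh.form_val_mult by simp
qed

lemma local_ring_const:
  assumes p: "p \<in> points C"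
  shows "h c \<in> \<O> p" "res p (h c) = c"
proof -
  let ?G = "form_monom (\<lambda>_. 0) :: ('i \<Rightarrow> nat) \<Rightarrow> 'k"
  have one: "gval 0 ?G = 1" "pval 0 ?G (rep p) = 1"
    using emb.form_val_monom[of "\<lambda>_. 0"] idh.form_val_monom[of "\<lambda>_. 0" "rep p"] by simp_all
  have eq: "h c = gval 0 (\<lambda>e. c * ?G e) / gval 0 ?G" by (simp add: emb.form_val_smult one)
  show "h c \<in> \<O> p" unfolding eq by (rule local_ringI[OF p]) (simp add: one)
  have "res p (gval 0 (\<lambda>e. c * ?G e) / gval 0 ?G) = pval 0 (\<lambda>e. c * ?G e) (rep p) / pval 0 ?G (rep p)"
    by (rule res_eq[OF p]) (simp add: one)
  then show "res p (h c) = c" unfolding eq[symmetric] by (simp add: idh.form_val_smult one)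
qed

lemma local_ring_0: "p \<in> points C \<Longrightarrow> 0 \<in> \<O> p" "p \<in> points C \<Longrightarrow> res p 0 = 0"
  using local_ring_const[of p 0] by simp_all

lemma local_ring_1: "p \<in> points C \<Longrightarrow> 1 \<in> \<O> p" "p \<in> points C \<Longrightarrow> res p 1 = 1"
  using local_ring_const[of p 1] by simp_all

lemma local_ring_uminus:
  assumes p: "p \<in> points C" and "f \<in> \<O> p"
  shows "- f \<in> \<O> p" "res p (- f) = - res p f"
  using local_ring_mult[OF p local_ring_const(1)[OF p, of "-1"] assms(2)] local_ring_const(2)[OF p, of "-1"]
  by (simp_all add: hom_distribs)

lemma local_ring_diff:
  assumes p: "p \<in> points C" and "f \<in> \<O> p" "g \<in> \<O> p"
  shows "f - g \<in> \<O> p" "res p (f - g) = res p f - res p g"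
  using local_ring_add[OF p assms(2) local_ring_uminus(1)[OF p assms(3)]]
    local_ring_uminus(2)[OF p assms(3)] by simp_all

lemma local_ring_sum:
  assumes p: "p \<in> points C" and "\<And>s. s \<in> S \<Longrightarrow> f s \<in> \<O> p"
  shows "sum f S \<in> \<O> p" "res p (sum f S) = (\<Sum>s\<in>S. res p (f s))"
proof -
  have "sum f S \<in> \<O> p \<and> res p (sum f S) = (\<Sum>s\<in>S. res p (f s))"
    using assms(2)
    by (induction S rule: infinite_finite_induct) (auto simp: local_ring_0 p local_ring_add)
  then show "sum f S \<in> \<O> p" "res p (sum f S) = (\<Sum>s\<in>S. res p (f s))" by auto
qed

lemma local_ring_prod:
  assumes p: "p \<in> points C" and "\<And>s. s \<in> S \<Longrightarrow> f s \<in> \<O> p"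
  shows "prod f S \<in> \<O> p" "res p (prod f S) = (\<Prod>s\<in>S. res p (f s))"
proof -
  have "prod f S \<in> \<O> p \<and> res p (prod f S) = (\<Prod>s\<in>S. res p (f s))"
    using assms(2)
    by (induction S rule: infinite_finite_induct) (auto simp: local_ring_1 p local_ring_mult)
  then show "prod f S \<in> \<O> p" "res p (prod f S) = (\<Prod>s\<in>S. res p (f s))" by auto
qed

lemma local_ring_power:
  assumes p: "p \<in> points C" and "f \<in> \<O> p"
  shows "f ^ n \<in> \<O> p" "res p (f ^ n) = res p f ^ n"
  using local_ring_prod[OF p, of "{..<n}" "\<lambda>_. f"] assms(2) by simp_all

lemma local_ring_unit:
  assumes p: "p \<in> points C" and f: "f \<in> \<O> p" "res p f \<noteq> 0"
  shows "f \<noteq> 0" "inverse f \<in> \<O> p"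
proof -
  obtain d F G where G: "pval d G (rep p) \<noteq> 0" "f = gval d F / gval d G"
    using local_ringE[OF p f(1)] .
  then have F: "pval d F (rep p) \<noteq> 0" using f(2) res_eq[OF p G(1), of F] by auto
  have "inverse f = gval d G / gval d F" using G(2) by simp
  then show "inverse f \<in> \<O> p" using local_ringI[OF p F, of G] by simp
  show "f \<noteq> 0" using f(2) local_ring_0(2)[OF p] by auto
qed

lemma max_ideal_iff: "p \<in> points C \<Longrightarrow> f \<in> \<mm> p \<longleftrightarrow> f \<in> \<O> p \<and> res p f = 0"
proof
  assume p: "p \<in> points C" and f: "f \<in> \<mm> p"
  obtain d F G where *: "f = gval d F / gval d G" "\<forall>z\<in>p. pval d G z \<noteq> 0 \<and> pval d F z = 0"
    using f unfolding max_ideal_def by blast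
  then have "pval d G (rep p) \<noteq> 0" "pval d F (rep p) = 0"
    using pval_point_iff[OF p, of d G] pval_point_iff[OF p, of d F] by blast+
  then show "f \<in> \<O> p \<and> res p f = 0" using local_ringI[OF p] res_eq[OF p] *(1) by simp
next
  assume p: "p \<in> points C" and f: "f \<in> \<O> p \<and> res p f = 0"
  then obtain d F G where G: "pval d G (rep p) \<noteq> 0" "f = gval d F / gval d G"
    using local_ringE[OF p] by blast
  then have "pval d F (rep p) = 0" using f res_eq[OF p G(1), of F] by auto
  then show "f \<in> \<mm> p" unfolding max_ideal_def
    using G pval_point_iff[OF p, of d G] pval_point_iff[OF p, of d F] by blast
qed

lemma generic_quotient:
  obtains d F G where "gval d G \<noteq> 0" "f = gval d F / gval d G"
  using smooth unfolding smooth_projective_curve_def by blast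

lemma coords_nonzero:
  assumes p: "p \<in> points C" and i: "rep p i \<noteq> 0"
  shows "coords C i \<noteq> 0"
  using gval_nonzero[OF p, of 1 "form_monom (\<lambda>k. if k = i then 1 else 0)"] i
    emb.form_val_power_coord[of 1 i "coords C"] idh.form_val_power_coord[of 1 i "rep p"] by simp

lemma form_quotient_local:
  assumes p: "p \<in> points C" and i: "rep p i \<noteq> 0"
  shows "gval d F / coords C i ^ d \<in> \<O> p"
    and "res p (gval d F / coords C i ^ d) = pval d F (rep p) / rep p i ^ d"
  using local_ringI[OF p, of d "form_monom (\<lambda>k. if k = i then d else 0)" F]
    res_eq[OF p, of d "form_monom (\<lambda>k. if k = i then d else 0)" F] i
  by (simp_all add: emb.form_val_power_coord idh.form_val_power_coord)

lemma coord_quotient_local: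
  assumes p: "p \<in> points C" and i: "rep p i \<noteq> 0"
  shows "coords C j / coords C i \<in> \<O> p"
    and "res p (coords C j / coords C i) = rep p j / rep p i"
  using form_quotient_local[OF p i, of 1 "form_monom (\<lambda>k. if k = j then 1 else 0)"]
  by (simp_all add: emb.form_val_power_coord idh.form_val_power_coord del: One_nat_def)

text \<open>Dividing numerator and denominator by the same power of a coordinate that is nonzero at
  \<open>p\<close> makes both regular.\<close>

lemma fraction_local_ring:
  assumes p: "p \<in> points C"
  obtains a b where "a \<in> \<O> p" "b \<in> \<O> p" "b \<noteq> 0" "f = a / b"
proof -
  obtain i where i: "rep p i \<noteq> 0" using rep(1)[OF p] by blast
  obtain d F G where *: "gval d G \<noteq> 0" "f = gval d F / gval d G" by (rule generic_quotient)
  have "f = (gval d F / coords C i ^ d) / (gval d G / coords C i ^ d)"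
    using * coords_nonzero[OF p i] by simp
  moreover have "gval d G / coords C i ^ d \<noteq> 0" using * coords_nonzero[OF p i] by simp
  ultimately show thesis using that form_quotient_local(1)[OF p i] by blast
qed

definition local_span :: "('k, 'i) point \<Rightarrow> ('j \<Rightarrow> 'K) \<Rightarrow> 'j set \<Rightarrow> 'K set"
  where "local_span p g J = {\<Sum>j\<in>J. c j * g j | c. \<forall>j\<in>J. c j \<in> \<O> p}"

lemma local_span_add:
  assumes p: "p \<in> points C" and "a \<in> local_span p g J" "b \<in> local_span p g J"
  shows "a + b \<in> local_span p g J"
proof -
  obtain c d where "a = (\<Sum>j\<in>J. c j * g j)" "\<forall>j\<in>J. c j \<in> \<O> p"
    "b = (\<Sum>j\<in>J. d j * g j)" "\<forall>j\<in>J. d j \<in> \<O> p" using assms(2,3) unfolding local_span_def by blast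
  then show ?thesis unfolding local_span_def
    by (intro CollectI exI[of _ "\<lambda>j. c j + d j"]) (auto simp: local_ring_add p distrib_right sum.distrib)
qed

lemma local_span_mult:
  assumes p: "p \<in> points C" and "a \<in> \<O> p" "b \<in> local_span p g J"
  shows "a * b \<in> local_span p g J"
proof -
  obtain d where "b = (\<Sum>j\<in>J. d j * g j)" "\<forall>j\<in>J. d j \<in> \<O> p" using assms(3) unfolding local_span_def by blast
  then show ?thesis unfolding local_span_def
    by (intro CollectI exI[of _ "\<lambda>j. a * d j"])
      (auto simp: local_ring_mult p assms(2) sum_distrib_left mult.assoc)
qed

lemma local_span_0: "p \<in> points C \<Longrightarrow> 0 \<in> local_span p g J"
  unfolding local_span_def by (intro CollectI exI[of _ "\<lambda>_. 0"]) (auto simp: local_ring_0)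

lemma local_span_sum:
  assumes p: "p \<in> points C" and "\<And>s. s \<in> S \<Longrightarrow> f s \<in> local_span p g J"
  shows "sum f S \<in> local_span p g J"
  using assms(2) by (induction S rule: infinite_finite_induct) (auto simp: local_span_0 p local_span_add)

lemma local_span_mem:
  assumes p: "p \<in> points C" and "finite J" "j \<in> J"
  shows "g j \<in> local_span p g J"
proof -
  have "(\<Sum>i\<in>J. (if i = j then 1 else 0) * g i) = (\<Sum>i\<in>J. if i = j then g i else 0)"
    by (rule sum.cong) auto
  then have "(\<Sum>i\<in>J. (if i = j then 1 else 0) * g i) = g j" using assms by (simp add: sum.delta)
  then show ?thesis unfolding local_span_def
    by (intro CollectI exI[of _ "\<lambda>i. if i = j then 1 else 0"]) (auto simp: local_ring_0 local_ring_1 p)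
qed

lemma local_span_cong_mult:
  assumes p: "p \<in> points C" and "x - x' \<in> local_span p g J" "y - y' \<in> local_span p g J"
    and "y \<in> \<O> p" "x' \<in> \<O> p"
  shows "x * y - x' * y' \<in> local_span p g J"
proof -
  have "x * y - x' * y' = y * (x - x') + x' * (y - y')" by (simp add: algebra_simps)
  then show ?thesis using assms by (simp add: local_span_add local_span_mult)
qed

lemma local_span_cong_prod:
  assumes p: "p \<in> points C" and "finite S"
    and "\<And>s. s \<in> S \<Longrightarrow> f s - f' s \<in> local_span p g J \<and> f s \<in> \<O> p \<and> f' s \<in> \<O> p"
  shows "prod f S - prod f' S \<in> local_span p g J"
  using assms(2,3)
  by (induction S rule: finite_induct)
    (auto simp: local_span_0 p intro!: local_span_cong_mult local_ring_prod)

text \<open>Finite generation, as needed for Nakayama's lemma. The generators are the affine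
  coordinates minus their values at \<open>p\<close>: a form vanishing at \<open>p\<close> is
  congruent, monomial by monomial, to its value at the constants \<open>c\<close>, which is
  zero.\<close>

lemma max_ideal_generators:
  assumes p: "p \<in> points C"
  obtains g :: "'i \<Rightarrow> 'K" where "\<And>j. g j \<in> \<mm> p" "\<mm> p \<subseteq> local_span p g UNIV"
proof -
  obtain i where i: "rep p i \<noteq> 0" using rep(1)[OF p] by blast
  have xi: "coords C i \<noteq> 0" by (rule coords_nonzero[OF p i])
  define w where "w j = coords C j / coords C i" for j
  define c where "c j = rep p j / rep p i" for j
  define g where "g j = w j - h (c j)" for j
  have w: "w j \<in> \<O> p" "res p (w j) = c j" for j
    unfolding w_def c_def by (rule coord_quotient_local[OF p i])+
  have hc: "h (c j) \<in> \<O> p" for j by (rule local_ring_const[OF p])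
  have "g j \<in> \<mm> p" for j
    unfolding max_ideal_iff[OF p] g_def using w hc by (simp add: local_ring_diff local_ring_const p)
  moreover have "f \<in> local_span p g UNIV" if f: "f \<in> \<mm> p" for f
  proof -
    obtain d F G where G: "pval d G (rep p) \<noteq> 0" "f = gval d F / gval d G"
      using local_ringE[OF p] f max_ideal_iff[OF p] by blast
    then have F: "pval d F (rep p) = 0" using f res_eq[OF p G(1), of F] max_ideal_iff[OF p] by auto
    have gj: "w j - h (c j) \<in> local_span p g UNIV" for j
      using local_span_mem[OF p, of UNIV j g] by (simp add: g_def)
    have "form_val h d F w - form_val h d F (\<lambda>j. h (c j)) =
       (\<Sum>e | sum e UNIV = d. h (F e) * ((\<Prod>j\<in>UNIV. w j ^ e j) - (\<Prod>j\<in>UNIV. h (c j) ^ e j)))"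
      by (simp add: form_val_def sum_subtractf right_diff_distrib)
    also have "\<dots> \<in> local_span p g UNIV"
    proof (intro local_span_sum local_span_mult local_ring_const local_span_cong_prod conjI
        local_ring_power w hc p finite)
      fix e :: "'i \<Rightarrow> nat" and j
      have "(\<Prod>l\<in>{..<e j}. w j) - (\<Prod>l\<in>{..<e j}. h (c j)) \<in> local_span p g UNIV"
        by (intro local_span_cong_prod conjI p w hc gj) simp
      then show "w j ^ e j - h (c j) ^ e j \<in> local_span p g UNIV" by simp
    qed
    also have "form_val h d F (\<lambda>j. h (c j)) = h (pval d F c)"
      by (simp add: form_val_def hom_distribs)
    also have "pval d F c = 0"
    proof -
      have "c = (\<lambda>j. inverse (rep p i) * rep p j)" by (auto simp: c_def field_simps)
      then show ?thesis using F by (simp add: form_val_scale)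
    qed
    also have "form_val h d F w = gval d F / coords C i ^ d"
    proof -
      have "w = (\<lambda>j. inverse (coords C i) * coords C j)" by (auto simp: w_def field_simps)
      then show ?thesis by (simp only: form_val_scale) (simp add: divide_inverse power_inverse)
    qed
    finally have 1: "gval d F / coords C i ^ d \<in> local_span p g UNIV" by simp
    \<comment> \<open>The denominator, dehomogenised in the same chart, has a nonzero value at
      \<open>p\<close> and is therefore a unit.\<close>
    have "inverse (gval d G / coords C i ^ d) \<in> \<O> p"
      using form_quotient_local[OF p i, of d G] G(1) i by (intro local_ring_unit[OF p]) auto
    from local_span_mult[OF p this 1] show ?thesis using xi G(2) by (simp add: field_simps)
  qed
  ultimately show thesis using that by blast
qed

section \<open>Separating points\<close>

text \<open>The two by two minors of the coordinates of \<open>q\<close> against the variables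
  vanish at \<open>q\<close>. If all those involving the chart coordinate \<open>i\<close> vanished
  at \<open>p\<close> as well, the two coordinate vectors would be proportional.\<close>

lemma linear_form_separating:
  assumes p: "p \<in> points C" and q: "q \<in> points C" and "p \<noteq> q"
  obtains F where "pval 1 F (rep p) \<noteq> 0" "pval 1 F (rep q) = 0"
proof -
  obtain i where i: "rep q i \<noteq> 0" using rep(1)[OF q] by blast
  obtain k where k: "rep p k \<noteq> 0" using rep(1)[OF p] by blast
  have "\<exists>j. rep q i * rep p j \<noteq> rep q j * rep p i"
  proof (rule ccontr)
    assume "\<not> ?thesis"
    then have eq: "rep q i * rep p j = rep q j * rep p i" for j by blast
    have pi: "rep p i \<noteq> 0" using eq[of k] i k by auto
    have "p = q" using eq pi i by (intro point_eqI[OF p q pi i]) (simp add: field_simps)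
    with \<open>p \<noteq> q\<close> show False ..
  qed
  then obtain j where j: "rep q i * rep p j \<noteq> rep q j * rep p i" by blast
  let ?X = "\<lambda>j. form_monom (\<lambda>k. if k = j then 1 else 0) :: ('i \<Rightarrow> nat) \<Rightarrow> 'k"
  let ?F = "\<lambda>e. rep q i * ?X j e + (- rep q j) * ?X i e"
  have "pval 1 ?F z = rep q i * z j - rep q j * z i" for z
    using idh.form_val_power_coord[of 1 i z] idh.form_val_power_coord[of 1 j z]
    unfolding idh.form_val_add idh.form_val_smult by simp
  then show thesis using that[of ?F] j by simp
qed

text \<open>A product of one separating linear form for each point of \<open>Q\<close>. Fixing the
  degree at \<open>card Q\<close> makes the forms built for different points addable.\<close>

lemma form_separating:
  assumes p: "p \<in> points C" and "finite Q" "Q \<subseteq> points C" "p \<notin> Q"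
  shows "\<exists>F. pval (card Q) F (rep p) \<noteq> 0 \<and> (\<forall>q\<in>Q. pval (card Q) F (rep q) = 0)"
  using assms(2-4)
proof (induction Q rule: finite_induct)
  case empty
  have "pval 0 (form_monom (\<lambda>_. 0)) (rep p) = 1"
    using idh.form_val_monom[of "\<lambda>_. 0" "rep p"] by simp
  then show ?case by (metis card.empty empty_iff zero_neq_one)
next
  case (insert q Q)
  then obtain F where F: "pval (card Q) F (rep p) \<noteq> 0" "\<forall>q\<in>Q. pval (card Q) F (rep q) = 0" by blast
  obtain L where L: "pval 1 L (rep p) \<noteq> 0" "pval 1 L (rep q) = 0"
    using linear_form_separating[OF p, of q] insert.prems by blast
  have "pval (card (insert q Q)) (form_mult 1 (card Q) L F) z = pval 1 L z * pval (card Q) F z" for z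
    using insert.hyps idh.form_val_mult[of 1 "card Q" L F z] by simp
  then have "pval (card (insert q Q)) (form_mult 1 (card Q) L F) (rep p) \<noteq> 0"
    "\<forall>q'\<in>insert q Q. pval (card (insert q Q)) (form_mult 1 (card Q) L F) (rep q') = 0"
    using F L by auto
  then show ?case by blast
qed

text \<open>The quotient of the form separating \<open>p\<close> from the rest of \<open>P\<close>
  by the sum of all such forms. At a point \<open>q\<close> of \<open>P\<close> only the form
  belonging to \<open>q\<close> survives in the denominator.\<close>

lemma idempotent_mod:
  assumes P: "finite P" "P \<subseteq> points C" "p \<in> P"
  obtains e where "\<And>q. q \<in> P \<Longrightarrow> e \<in> \<O> q" "\<And>q. q \<in> P \<Longrightarrow> res q e = (if q = p then 1 else 0)"
proof -
  define d where "d = card P - 1"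
  have "\<forall>q. \<exists>F. q \<in> P \<longrightarrow> pval d F (rep q) \<noteq> 0 \<and> (\<forall>q'\<in>P - {q}. pval d F (rep q') = 0)"
  proof
    fix q
    show "\<exists>F. q \<in> P \<longrightarrow> pval d F (rep q) \<noteq> 0 \<and> (\<forall>q'\<in>P - {q}. pval d F (rep q') = 0)"
    proof (cases "q \<in> P")
      case True
      then show ?thesis
        using form_separating[of q "P - {q}"] P by (auto simp: d_def card_Diff_singleton)
    qed simp
  qed
  then obtain F where F: "\<And>q. q \<in> P \<Longrightarrow> pval d (F q) (rep q) \<noteq> 0"
    "\<And>q q'. q \<in> P \<Longrightarrow> q' \<in> P \<Longrightarrow> q' \<noteq> q \<Longrightarrow> pval d (F q) (rep q') = 0" by (metis Diff_iff singletonD)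
  define G where "G = (\<lambda>e. \<Sum>q\<in>P. F q e)"
  have G: "pval d G (rep q) = pval d (F q) (rep q)" if "q \<in> P" for q
  proof -
    have "pval d G (rep q) = (\<Sum>q'\<in>P. if q' = q then pval d (F q) (rep q) else 0)"
      unfolding G_def idh.form_val_sum using F(2) that by (intro sum.cong) auto
    then show ?thesis using that P by (simp add: sum.delta)
  qed
  show thesis
  proof
    fix q assume q: "q \<in> P"
    have Gq: "pval d G (rep q) \<noteq> 0" using G F q by simp
    have qC: "q \<in> points C" using q P by auto
    show "gval d (F p) / gval d G \<in> \<O> q" by (rule local_ringI[OF qC Gq])
    show "res q (gval d (F p) / gval d G) = (if q = p then 1 else 0)"
      unfolding res_eq[OF qC Gq] using F G q P(3) by auto
  qed
qed

end

section \<open>The function field over a rational subfield\<close>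


text \<open>\<open>f\<close> may send the leading coefficient to zero, so the sum runs to
  \<open>degree P\<close> and not to the degree of the image.\<close>

lemma poly_map_poly_altdef:
  fixes x :: "'b::comm_semiring_1"
  assumes "f 0 = 0"
  shows "poly (map_poly f P) x = (\<Sum>i\<le>degree P. f (coeff P i) * x ^ i)"
proof -
  have "poly (map_poly f P) x = (\<Sum>i\<le>degree (map_poly f P). coeff (map_poly f P) i * x ^ i)"
    by (rule poly_altdef)
  also have "\<dots> = (\<Sum>i\<le>degree P. coeff (map_poly f P) i * x ^ i)"
    by (rule sum.mono_neutral_left)
      (use degree_map_poly_le[of f P] in \<open>auto simp: coeff_eq_0\<close>)
  finally show ?thesis by (simp add: coeff_map_poly assms)
qed

lemma poly_map_poly_pCons:
  fixes x :: "'b::comm_semiring_1"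
  assumes "f 0 = 0"
  shows "poly (map_poly f (pCons a P)) x = f a + x * poly (map_poly f P) x"
proof -
  have "map_poly f (pCons a P) = pCons (f a) (map_poly f P)"
    by (intro poly_eqI) (simp add: coeff_map_poly assms coeff_pCons split: nat.splits)
  then show ?thesis by simp
qed

text \<open>For nonzero \<open>x\<close>, powers of the variable can be cancelled from
  \<open>P\<close>. The nonzero constant coefficient later exhibits \<open>x\<close> as a divisor of
  an element of the coefficient ring.\<close>

lemma root_nonzero_constant_coeff:
  fixes x :: "'b::idom"
  assumes "f 0 = 0" "P \<noteq> 0" "poly (map_poly f P) x = 0" "x \<noteq> 0"
  shows "\<exists>a P'. a \<noteq> 0 \<and> poly (map_poly f (pCons a P')) x = 0"
  using assms(2,3)
proof (induction P)
  case (pCons a P)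
  show ?case
  proof (cases "a = 0")
    case True
    then have "P \<noteq> 0" "poly (map_poly f P) x = 0"
      using pCons.prems assms by (auto simp: poly_map_poly_pCons)
    then show ?thesis by (rule pCons.IH)
  qed (use pCons.prems in blast)
qed simp

context smooth_curve
begin

definition ev :: "'K \<Rightarrow> 'k poly \<Rightarrow> 'K"
  where "ev t Q = poly (map_poly h Q) t"

sublocale ev: comm_ring_hom "ev t" for t
proof -
  interpret map_poly_comm_ring_hom h ..
  show "comm_ring_hom (ev t)" by unfold_locales (auto simp: ev_def hom_distribs)
qed

lemma ev_pCons: "ev t (pCons a Q) = h a + t * ev t Q"
  by (simp add: ev_def poly_map_poly_pCons)

lemma ev_monom: "ev t (monom c n) = h c * t ^ n"
  by (simp add: ev_def map_poly_monom poly_monom)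

lemma ev_smult: "ev t (smult c Q) = h c * ev t Q"
  using ev.hom_mult[of t "[:c:]" Q] by (simp add: ev_pCons)

lemma ev_altdef: "degree Q \<le> n \<Longrightarrow> ev t Q = (\<Sum>i\<le>n. h (coeff Q i) * t ^ i)"
proof -
  assume "degree Q \<le> n"
  then have "(\<Sum>i\<le>degree Q. h (coeff Q i) * t ^ i) = (\<Sum>i\<le>n. h (coeff Q i) * t ^ i)"
    by (intro sum.mono_neutral_left) (auto simp: coeff_eq_0)
  then show ?thesis by (simp add: ev_def poly_map_poly_altdef)
qed

lemma vector_space_K: "vector_space (\<lambda>c (f :: 'K). h c * f)"
  by unfold_locales (auto simp: hom_distribs algebra_simps)

text \<open>The span of \<open>U\<close> over the field \<open>'k(t)\<close>, with denominators
  cleared. For transcendental \<open>t\<close>, \<open>rat_span t U = UNIV\<close> says that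
  \<open>U\<close> generates \<open>'K\<close> over \<open>'k(t)\<close>.\<close>

definition rat_span :: "'K \<Rightarrow> 'K set \<Rightarrow> 'K set"
  where "rat_span t U = {f. \<exists>q p. q \<noteq> 0 \<and> ev t q * f = (\<Sum>u\<in>U. ev t (p u) * u)}"

lemma rat_span_add:
  assumes "f \<in> rat_span t U" "g \<in> rat_span t U" shows "f + g \<in> rat_span t U"
proof -
  obtain q p q' p' where *: "q \<noteq> 0" "ev t q * f = (\<Sum>u\<in>U. ev t (p u) * u)"
    "q' \<noteq> 0" "ev t q' * g = (\<Sum>u\<in>U. ev t (p' u) * u)" using assms unfolding rat_span_def by blast
  have "ev t (q * q') * (f + g) = ev t q' * (ev t q * f) + ev t q * (ev t q' * g)"
    by (simp add: ev.hom_mult algebra_simps)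
  also have "\<dots> = (\<Sum>u\<in>U. ev t (q' * p u + q * p' u) * u)"
    unfolding *(2,4) by (simp add: sum_distrib_left sum.distrib ev.hom_add ev.hom_mult algebra_simps)
  finally show ?thesis unfolding rat_span_def
    using *(1,3) by (intro CollectI exI[of _ "q * q'"] exI[of _ "\<lambda>u. q' * p u + q * p' u"]) auto
qed

lemma rat_span_smult:
  assumes "f \<in> rat_span t U" shows "ev t c * f \<in> rat_span t U"
proof -
  obtain q p where *: "q \<noteq> 0" "ev t q * f = (\<Sum>u\<in>U. ev t (p u) * u)"
    using assms unfolding rat_span_def by blast
  have "ev t q * (ev t c * f) = ev t c * (ev t q * f)" by (rule mult.left_commute)
  also have "\<dots> = (\<Sum>u\<in>U. ev t (c * p u) * u)"
    unfolding *(2) by (simp add: sum_distrib_left ev.hom_mult mult.assoc)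
  finally show ?thesis unfolding rat_span_def
    using *(1) by (intro CollectI exI[of _ q] exI[of _ "\<lambda>u. c * p u"]) auto
qed

lemma rat_span_0: "0 \<in> rat_span t U"
  unfolding rat_span_def by (intro CollectI exI[of _ 1] exI[of _ "\<lambda>_. 0"]) auto

lemma rat_span_sum: "(\<And>s. s \<in> S \<Longrightarrow> f s \<in> rat_span t U) \<Longrightarrow> sum f S \<in> rat_span t U"
  by (induction S rule: infinite_finite_induct) (auto simp: rat_span_0 rat_span_add)

lemma rat_span_cancel:
  assumes "q \<noteq> 0" "ev t q * f \<in> rat_span t U" shows "f \<in> rat_span t U"
proof -
  obtain q' p where "q' \<noteq> 0" "ev t q' * (ev t q * f) = (\<Sum>u\<in>U. ev t (p u) * u)"
    using assms unfolding rat_span_def by blast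
  then show ?thesis unfolding rat_span_def using assms(1)
    by (intro CollectI exI[of _ "q' * q"] exI[of _ p]) (auto simp: ev.hom_mult mult.assoc)
qed

lemma rat_span_mem: "finite U \<Longrightarrow> u \<in> U \<Longrightarrow> u \<in> rat_span t U"
proof -
  assume U: "finite U" "u \<in> U"
  have "(\<Sum>v\<in>U. ev t (if v = u then 1 else 0) * v) = (\<Sum>v\<in>U. if v = u then v else 0)"
    by (rule sum.cong) auto
  then show ?thesis unfolding rat_span_def
    using U by (intro CollectI exI[of _ 1] exI[of _ "\<lambda>v. if v = u then 1 else 0"]) (simp add: sum.delta)
qed

lemma rat_span_mult:
  assumes fin: "finite U" "finite U'" and "f \<in> rat_span t U" "g \<in> rat_span t U'"
  shows "f * g \<in> rat_span t ((\<lambda>(u, v). u * v) ` (U \<times> U'))"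
proof -
  obtain q p q' p' where *: "q \<noteq> 0" "ev t q * f = (\<Sum>u\<in>U. ev t (p u) * u)"
    "q' \<noteq> 0" "ev t q' * g = (\<Sum>u\<in>U'. ev t (p' u) * u)" using assms(3,4) unfolding rat_span_def by blast
  have "ev t (q * q') * (f * g) = (ev t q * f) * (ev t q' * g)" by (simp add: ev.hom_mult mult_ac)
  also have "\<dots> = (\<Sum>u\<in>U. \<Sum>v\<in>U'. ev t (p u * p' v) * (u * v))"
    unfolding *(2,4) sum_product by (simp add: ev.hom_mult mult_ac)
  also have "\<dots> \<in> rat_span t ((\<lambda>(u, v). u * v) ` (U \<times> U'))"
    using fin by (intro rat_span_sum rat_span_smult rat_span_mem) auto
  finally show ?thesis by (rule rat_span_cancel[rotated]) (use * in auto)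
qed

definition transcendental :: "'K \<Rightarrow> bool"
  where "transcendental t \<longleftrightarrow> (\<forall>Q. Q \<noteq> 0 \<longrightarrow> ev t Q \<noteq> 0)"

definition algebraic_over :: "'K \<Rightarrow> 'K \<Rightarrow> bool"
  where "algebraic_over t f \<longleftrightarrow> (\<exists>P. P \<noteq> 0 \<and> poly (map_poly (ev t) P) f = 0)"

text \<open>The leading coefficient of the relation for \<open>w\<close> is invertible over the
  rational subfield, so powers from the degree on reduce to lower ones.\<close>

lemma rat_span_powers:
  assumes t: "transcendental t" and w: "algebraic_over t w"
  shows "\<exists>U. finite U \<and> (\<forall>n. w ^ n \<in> rat_span t U)"
proof -
  obtain P where P: "P \<noteq> 0" "poly (map_poly (ev t) P) w = 0" using w unfolding algebraic_over_def by blast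
  define d where "d = degree P"
  have sum0: "(\<Sum>i<d. ev t (coeff P i) * w ^ i) + ev t (coeff P d) * w ^ d = 0"
    using P(2) unfolding poly_map_poly_altdef[where f = "ev t", OF ev.hom_zero] by (simp add: d_def lessThan_Suc_atMost[symmetric])
  have lead: "coeff P d \<noteq> 0" using P(1) by (simp add: d_def)
  let ?U = "(\<lambda>i. w ^ i) ` {..<d}"
  have "w ^ n \<in> rat_span t ?U" for n
  proof (induction n rule: less_induct)
    case (less n)
    show ?case
    proof (cases "n < d")
      case True
      then show ?thesis by (intro rat_span_mem) auto
    next
      case False
      then have "ev t (coeff P d) * w ^ n = (ev t (coeff P d) * w ^ d) * w ^ (n - d)"
        by (simp add: power_add[symmetric] mult.assoc)
      also have "ev t (coeff P d) * w ^ d = - (\<Sum>i<d. ev t (coeff P i) * w ^ i)"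
        using sum0 by (simp add: add_eq_0_iff2)
      also have "- (\<Sum>i<d. ev t (coeff P i) * w ^ i) * w ^ (n - d)
          = (\<Sum>i<d. ev t (- coeff P i) * w ^ (i + (n - d)))"
        by (simp add: sum_distrib_right sum_negf power_add mult.assoc ev.hom_uminus)
      also have "\<dots> \<in> rat_span t ?U"
        using False by (intro rat_span_sum rat_span_smult less.IH) auto
      finally show ?thesis by (rule rat_span_cancel[OF lead])
    qed
  qed
  then show ?thesis by (intro exI[of _ ?U]) auto
qed

text \<open>One finite set must serve all exponents at once, because forms of every degree are
  evaluated at the coordinates.\<close>

lemma rat_span_monomials:
  assumes t: "transcendental t" "\<And>f. algebraic_over t f" and "finite J"
  shows "\<exists>U. finite U \<and> (\<forall>e :: 'j \<Rightarrow> nat. (\<Prod>j\<in>J. w j ^ e j) \<in> rat_span t U)"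
  using assms(3)
proof (induction J rule: finite_induct)
  case empty
  have "1 \<in> rat_span t {1}" by (rule rat_span_mem) auto
  then show ?case by (intro exI[of _ "{1}"]) auto
next
  case (insert j J)
  then obtain U where U: "finite U" "\<forall>e. (\<Prod>j\<in>J. w j ^ e j) \<in> rat_span t U" by blast
  obtain U' where U': "finite U'" "\<forall>n. w j ^ n \<in> rat_span t U'" using rat_span_powers[OF t] by blast
  have "(\<Prod>i\<in>insert j J. w i ^ e i) \<in> rat_span t ((\<lambda>(u, v). u * v) ` (U' \<times> U))" for e
    using rat_span_mult[OF U'(1) U(1)] U(2) U'(2) insert.hyps by simp
  then show ?case using U(1) U'(1) by (intro exI[of _ "(\<lambda>(u, v). u * v) ` (U' \<times> U)"]) auto
qed

text \<open>The affine coordinates generate \<open>'K\<close> as a field and are algebraic over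
  \<open>'k(t)\<close>, so forms in them lie in one finite span. Quotients reduce to forms: a
  relation for the denominator \<open>g\<close> with nonzero constant coefficient \<open>a\<close>
  writes \<open>a / g\<close> as a polynomial in \<open>g\<close>.\<close>

lemma finite_over_rational:
  obtains t U where "transcendental t" "finite U" "rat_span t U = UNIV"
proof -
  obtain t where t: "transcendental t" "\<And>f. algebraic_over t f"
    using smooth unfolding smooth_projective_curve_def trdeg_one_def transcendental_def
      algebraic_over_def ev_def by blast
  obtain i where xi: "coords C i \<noteq> 0" using smooth unfolding smooth_projective_curve_def by blast
  define w where "w j = inverse (coords C i) * coords C j" for j
  obtain U where U: "finite U" "\<And>e. (\<Prod>j\<in>UNIV. w j ^ e j) \<in> rat_span t U"
    using rat_span_monomials[OF t, of UNIV w] by auto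
  have form: "form_val h d F w \<in> rat_span t U" for d F
  proof -
    have "h (F e) * (\<Prod>j\<in>UNIV. w j ^ e j) \<in> rat_span t U" for e
      using rat_span_smult[OF U(2), of "[:F e:]" e] by (simp add: ev_pCons)
    then show ?thesis unfolding form_val_def by (intro rat_span_sum)
  qed
  have "f \<in> rat_span t U" for f
  proof -
    obtain d F G where G: "gval d G \<noteq> 0" "f = gval d F / gval d G" by (rule generic_quotient)
    have wF: "form_val h d F w = inverse (coords C i) ^ d * gval d F" for F
      unfolding w_def form_val_scale ..
    define g where "g = form_val h d G w"
    have g: "g \<noteq> 0" using G(1) xi by (simp add: g_def wF)
    have f: "f = form_val h d F w / g" using G(2) xi by (simp add: g_def wF)
    obtain P where "P \<noteq> 0" "poly (map_poly (ev t) P) g = 0" using t(2) unfolding algebraic_over_def by blast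
    from root_nonzero_constant_coeff[OF _ this g] obtain a P'
      where P': "a \<noteq> 0" "poly (map_poly (ev t) (pCons a P')) g = 0" by auto
    \<comment> \<open>The numerator times a power of \<open>g\<close> is again a form in the
      \<open>w j\<close>, of higher degree.\<close>
    have Fg: "form_val h d F w * g ^ n \<in> rat_span t U" for n
    proof -
      have "\<exists>d' F'. form_val h d F w * g ^ n = form_val h d' F' w"
      proof (induction n)
        case (Suc n)
        then obtain d' F' where "form_val h d F w * g ^ n = form_val h d' F' w" by blast
        then have "form_val h d F w * g ^ Suc n = form_val h (d + d') (form_mult d d' G F') w"
          unfolding emb.form_val_mult by (simp add: g_def mult_ac)
        then show ?case by blast
      qed auto
      then show ?thesis using form by auto
    qed
    have "ev t a = - g * poly (map_poly (ev t) P') g"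
      using P'(2) by (simp add: poly_map_poly_pCons eq_neg_iff_add_eq_0)
    then have "ev t a * f = - (poly (map_poly (ev t) P') g * form_val h d F w)"
      unfolding f using g by simp
    also have "\<dots> = (\<Sum>i\<le>degree P'. ev t (- coeff P' i) * (form_val h d F w * g ^ i))"
      by (simp add: poly_map_poly_altdef sum_distrib_left sum_negf ev.hom_uminus mult_ac)
    also have "\<dots> \<in> rat_span t U" by (intro rat_span_sum rat_span_smult Fg)
    finally show ?thesis by (rule rat_span_cancel[OF P'(1)])
  qed
  then show thesis using that[OF t(1) U(1)] by blast
qed

lemma common_denominator:
  assumes "rat_span t U = UNIV" "finite X"
  shows "\<exists>q p. q \<noteq> 0 \<and> (\<forall>x\<in>X. ev t q * x = (\<Sum>u\<in>U. ev t (p x u) * u))"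
  using assms(2)
proof (induction X rule: finite_induct)
  case (insert x X)
  then obtain q p where q: "q \<noteq> 0" "\<forall>y\<in>X. ev t q * y = (\<Sum>u\<in>U. ev t (p y u) * u)" by blast
  have "x \<in> rat_span t U" using assms by blast
  then obtain q' p' where q': "q' \<noteq> 0" "ev t q' * x = (\<Sum>u\<in>U. ev t (p' u) * u)"
    unfolding rat_span_def by blast
  define r where "r y u = (if y = x then q * p' u else q' * p y u)" for y u
  have "ev t (q * q') * y = (\<Sum>u\<in>U. ev t (r y u) * u)" if "y \<in> insert x X" for y
  proof (cases "y = x")
    case True
    have "ev t (q * q') * x = ev t q * (ev t q' * x)" by (simp add: ev.hom_mult)
    also have "\<dots> = (\<Sum>u\<in>U. ev t (r x u) * u)"
      unfolding q'(2) by (simp add: r_def sum_distrib_left ev.hom_mult mult.assoc)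
    finally show ?thesis using True by simp
  next
    case False
    have "ev t (q * q') * y = ev t q' * (ev t q * y)" by (simp add: ev.hom_mult)
    also have "ev t q * y = (\<Sum>u\<in>U. ev t (p y u) * u)" using q(2) that False by blast
    finally show ?thesis using False by (simp add: r_def sum_distrib_left ev.hom_mult mult.assoc)
  qed
  then show ?case using q(1) q'(1) by (intro exI[of _ "q * q'"] exI[of _ r]) auto
qed (auto intro: exI[of _ 1])

text \<open>The \<open>(m + 1)\<^sup>2\<close> monomials \<open>a\<^sup>i b\<^sup>j\<close> with \<open>i, j \<le> m\<close> lie, after clearing a common denominator,
  in a space whose dimension grows only linearly in \<open>m\<close>.\<close>

lemma algebraic_dependence: "algebraic_over a b"
proof -
  obtain t U where t: "transcendental t" and U: "finite U" "rat_span t U = UNIV"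
    by (rule finite_over_rational)
  \<comment> \<open>Multiplication by \<open>a\<close>, multiplication by \<open>b\<close> and the
    element 1 get one common denominator \<open>q\<close> in terms of \<open>U\<close>.\<close>
  have "finite ((\<lambda>u. a * u) ` U \<union> (\<lambda>u. b * u) ` U \<union> {1})" using U by auto
  from common_denominator[OF U(2) this] obtain q p where q: "q \<noteq> 0"
    and "\<forall>x\<in>(\<lambda>u. a * u) ` U \<union> (\<lambda>u. b * u) ` U \<union> {1}. ev t q * x = (\<Sum>v\<in>U. ev t (p x v) * v)"
    by blast
  then have p: "\<And>u. u \<in> U \<Longrightarrow> ev t q * (a * u) = (\<Sum>v\<in>U. ev t (p (a * u) v) * v)"
    "\<And>u. u \<in> U \<Longrightarrow> ev t q * (b * u) = (\<Sum>v\<in>U. ev t (p (b * u) v) * v)"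
    "ev t q = (\<Sum>v\<in>U. ev t (p 1 v) * v)" by auto
  \<comment> \<open>\<open>\<delta>\<close> bounds the degrees of \<open>q\<close> and of all
    numerators, hence the growth of degree in one multiplication.\<close>
  define \<delta> where "\<delta> = degree q + (\<Sum>u\<in>U. \<Sum>v\<in>U. degree (p (a * u) v) + degree (p (b * u) v))
    + (\<Sum>v\<in>U. degree (p 1 v))"
  have deg_ab: "degree (p (a * u) v) \<le> \<delta>" "degree (p (b * u) v) \<le> \<delta>" if "u \<in> U" "v \<in> U" for u v
  proof -
    have "degree (p (a * u) v) + degree (p (b * u) v)
        \<le> (\<Sum>v\<in>U. degree (p (a * u) v) + degree (p (b * u) v))"
      using that U(1) by (intro member_le_sum) auto
    also have "\<dots> \<le> (\<Sum>u\<in>U. \<Sum>v\<in>U. degree (p (a * u) v) + degree (p (b * u) v))"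
      using that U(1) by (intro member_le_sum[where f = "\<lambda>u. \<Sum>v\<in>U. degree (p (a * u) v) + degree (p (b * u) v)"]) auto
    finally show "degree (p (a * u) v) \<le> \<delta>" "degree (p (b * u) v) \<le> \<delta>" unfolding \<delta>_def by linarith+
  qed
  have deg_1: "degree (p 1 v) \<le> \<delta>" if "v \<in> U" for v
    using member_le_sum[of v U "\<lambda>v. degree (p 1 v)"] that U(1) unfolding \<delta>_def by simp
  have deg_q: "degree q \<le> \<delta>" unfolding \<delta>_def by simp
  define L where "L m = {\<Sum>u\<in>U. ev t (r u) * u | r. \<forall>u\<in>U. degree (r u) \<le> m}" for m
  have step: "ev t q * (c * x) \<in> L (m + \<delta>)"
    if x: "x \<in> L m" and c: "\<And>u. u \<in> U \<Longrightarrow> ev t q * (c * u) = (\<Sum>v\<in>U. ev t (s u v) * v)"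
      "\<And>u v. u \<in> U \<Longrightarrow> v \<in> U \<Longrightarrow> degree (s u v) \<le> \<delta>" for c x m s
  proof -
    obtain r where r: "x = (\<Sum>u\<in>U. ev t (r u) * u)" "\<forall>u\<in>U. degree (r u) \<le> m"
      using x unfolding L_def by blast
    have "ev t q * (c * x) = (\<Sum>u\<in>U. ev t (r u) * (ev t q * (c * u)))"
      unfolding r(1) by (simp add: sum_distrib_left mult_ac)
    also have "\<dots> = (\<Sum>u\<in>U. \<Sum>v\<in>U. ev t (r u * s u v) * v)"
      by (rule sum.cong) (auto simp: c(1) sum_distrib_left ev.hom_mult mult.assoc)
    also have "\<dots> = (\<Sum>v\<in>U. ev t (\<Sum>u\<in>U. r u * s u v) * v)"
      by (subst sum.swap) (simp add: ev.hom_sum sum_distrib_right)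
    finally have "ev t q * (c * x) = (\<Sum>v\<in>U. ev t (\<Sum>u\<in>U. r u * s u v) * v)" .
    moreover have "degree (\<Sum>u\<in>U. r u * s u v) \<le> m + \<delta>" if "v \<in> U" for v
      using r(2) c(2) that by (intro degree_sum_le U(1) order_trans[OF degree_mult_le] add_mono) auto
    ultimately show ?thesis unfolding L_def by (intro CollectI exI[of _ "\<lambda>v. \<Sum>u\<in>U. r u * s u v"]) auto
  qed
  have stepa: "ev t q * (a * x) \<in> L (m + \<delta>)" if "x \<in> L m" for x m
    using step[OF that p(1) deg_ab(1)] .
  have stepb: "ev t q * (b * x) \<in> L (m + \<delta>)" if "x \<in> L m" for x m
    using step[OF that p(2) deg_ab(2)] .
  have step1: "ev t q * x \<in> L (m + \<delta>)" if "x \<in> L m" for x m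
  proof -
    have "(\<Sum>v\<in>U. ev t (if v = u then q else 0) * v) = ev t q * (1 * u)" if "u \<in> U" for u
    proof -
      have "(\<Sum>v\<in>U. ev t (if v = u then q else 0) * v) = (\<Sum>v\<in>U. if v = u then ev t q * v else 0)"
        by (rule sum.cong) auto
      then show ?thesis using that U(1) by (simp add: sum.delta)
    qed
    from step[OF that, of 1 "\<lambda>u v. if v = u then q else 0"] this deg_q show ?thesis by simp
  qed
  \<comment> \<open>One factor \<open>q\<close> is spent on each factor \<open>a\<close> or
    \<open>b\<close>, one on each of \<open>k\<close> padding steps, and one on expressing 1 in
    terms of \<open>U\<close>.\<close>
  have mono: "ev t q ^ (i + j + k + 1) * (a ^ i * b ^ j) \<in> L ((i + j + k + 1) * \<delta>)" for i j k
  proof (induction k)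
    case 0
    show ?case
    proof (induction i)
      case 0
      show ?case
      proof (induction j)
        case 0
        have "ev t q \<in> L \<delta>" unfolding L_def using p(3) deg_1 by blast
        then show ?case by simp
      next
        case (Suc j)
        from stepb[OF this] show ?case by (simp add: mult_ac add_ac)
      qed
    next
      case (Suc i)
      from stepa[OF this] show ?case by (simp add: mult_ac add_ac)
    qed
  next
    case (Suc k)
    from step1[OF this] show ?case by (simp add: mult_ac add_ac)
  qed
  define n where "n = card U"
  \<comment> \<open>Chosen so that \<open>n * (N + 1)\<close>, which is
    \<open>2 * n * \<delta> * m + n * \<delta> + n\<close>, is at most \<open>m * m + m\<close> and
    thus below the number of monomials.\<close>
  define m where "m = 2 * n * \<delta> + n"
  define N where "N = (2 * m + 1) * \<delta>"
  \<comment> \<open>Padding by \<open>2 * m - i - j\<close> gives all monomials the same power of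
    \<open>q\<close>, which then cancels from the relation.\<close>
  have mono': "ev t q ^ (2 * m + 1) * (a ^ i * b ^ j) \<in> L N" if "i \<le> m" "j \<le> m" for i j
    using mono[of i j "2 * m - i - j"] that by (simp add: N_def)
  have "\<forall>ij\<in>{..m} \<times> {..m}. \<exists>r. ev t q ^ (2 * m + 1) * (a ^ fst ij * b ^ snd ij) = (\<Sum>u\<in>U. ev t (r u) * u)
      \<and> (\<forall>u\<in>U. degree (r u) \<le> N)"
  proof
    fix ij assume "ij \<in> {..m} \<times> {..m}"
    then have "ev t q ^ (2 * m + 1) * (a ^ fst ij * b ^ snd ij) \<in> L N" by (intro mono') auto
    then show "\<exists>r. ev t q ^ (2 * m + 1) * (a ^ fst ij * b ^ snd ij) = (\<Sum>u\<in>U. ev t (r u) * u)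
      \<and> (\<forall>u\<in>U. degree (r u) \<le> N)" unfolding L_def by (rule CollectD)
  qed
  from bchoice[OF this] obtain r where
    "\<forall>ij\<in>{..m} \<times> {..m}. ev t q ^ (2 * m + 1) * (a ^ fst ij * b ^ snd ij) = (\<Sum>u\<in>U. ev t (r ij u) * u)
      \<and> (\<forall>u\<in>U. degree (r ij u) \<le> N)" ..
  then have r: "\<And>ij. ij \<in> {..m} \<times> {..m} \<Longrightarrow>
      ev t q ^ (2 * m + 1) * (a ^ fst ij * b ^ snd ij) = (\<Sum>u\<in>U. ev t (r ij u) * u)"
    "\<And>ij u. ij \<in> {..m} \<times> {..m} \<Longrightarrow> u \<in> U \<Longrightarrow> degree (r ij u) \<le> N" by blast+
  have nN: "card (U \<times> {..N}) < card ({..m} \<times> {..m})"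
  proof -
    have "n * (N + 1) = 2 * n * \<delta> * m + n * \<delta> + n" by (simp add: N_def algebra_simps)
    also have "\<dots> \<le> 2 * n * \<delta> * m + m" by (simp add: m_def)
    also have "\<dots> \<le> m * m + m" by (simp add: m_def algebra_simps)
    also have "\<dots> < (m + 1) * (m + 1)" by (simp add: algebra_simps)
    finally show ?thesis by (simp add: n_def card_cartesian_product)
  qed
  interpret K: vector_space "\<lambda>c (f :: 'K). h c * f" by (rule vector_space_K)
  have sub0: "K.subspace {0}" by (simp add: K.subspace_def)
  obtain c where c: "\<exists>ij\<in>{..m} \<times> {..m}. c ij \<noteq> 0"
    "(\<Sum>ij\<in>{..m} \<times> {..m}. h (c ij) * (ev t q ^ (2 * m + 1) * (a ^ fst ij * b ^ snd ij))) \<in> {0}"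
  proof (rule K.dependent_mod[OF sub0 _ _ nN, of "\<lambda>ij. ev t q ^ (2 * m + 1) * (a ^ fst ij * b ^ snd ij)"
        "\<lambda>ij ul. coeff (r ij (fst ul)) (snd ul)" "\<lambda>ul. t ^ snd ul * fst ul"])
    fix ij assume ij: "ij \<in> {..m} \<times> {..m}"
    have "(\<Sum>ul\<in>U \<times> {..N}. h (coeff (r ij (fst ul)) (snd ul)) * (t ^ snd ul * fst ul)) =
        (\<Sum>u\<in>U. \<Sum>l\<le>N. h (coeff (r ij u) l) * (t ^ l * u))"
      by (simp add: sum.cartesian_product split_def)
    also have "\<dots> = (\<Sum>u\<in>U. ev t (r ij u) * u)"
      using r(2)[OF ij] by (intro sum.cong) (auto simp: ev_altdef[of _ N] sum_distrib_right mult.assoc)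
    finally show "ev t q ^ (2 * m + 1) * (a ^ fst ij * b ^ snd ij) -
        (\<Sum>ul\<in>U \<times> {..N}. h (coeff (r ij (fst ul)) (snd ul)) * (t ^ snd ul * fst ul)) \<in> {0}"
      using r(1)[OF ij] by simp
  qed (use U in auto)
  have evq: "ev t q \<noteq> 0" using t q unfolding transcendental_def by blast
  have "ev t q ^ (2 * m + 1) * (\<Sum>ij\<in>{..m} \<times> {..m}. h (c ij) * (a ^ fst ij * b ^ snd ij)) =
      (\<Sum>ij\<in>{..m} \<times> {..m}. h (c ij) * (ev t q ^ (2 * m + 1) * (a ^ fst ij * b ^ snd ij)))"
    by (simp add: sum_distrib_left mult_ac)
  then have c0: "(\<Sum>ij\<in>{..m} \<times> {..m}. h (c ij) * (a ^ fst ij * b ^ snd ij)) = 0" using c(2) evq by simp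
  \<comment> \<open>The relation is read as a polynomial in \<open>b\<close> whose coefficients are
    polynomials in \<open>a\<close>.\<close>
  define P where "P = (\<Sum>j\<le>m. monom (\<Sum>i\<le>m. monom (c (i, j)) i) j)"
  interpret mp: map_poly_comm_ring_hom "ev a" ..
  have "poly (map_poly (ev a) P) b = (\<Sum>j\<le>m. (\<Sum>i\<le>m. h (c (i, j)) * a ^ i) * b ^ j)"
    by (simp add: P_def mp.hom_sum poly_sum map_poly_monom poly_monom ev.hom_sum ev_monom)
  also have "\<dots> = (\<Sum>i\<le>m. \<Sum>j\<le>m. h (c (i, j)) * (a ^ i * b ^ j))"
    by (subst sum.swap) (simp add: sum_distrib_right mult.assoc)
  also have "\<dots> = 0" using c0 by (simp add: sum.cartesian_product split_def)
  finally have "poly (map_poly (ev a) P) b = 0" .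
  moreover have "P \<noteq> 0"
  proof
    assume P0: "P = 0"
    obtain i j where ij: "i \<le> m" "j \<le> m" "c (i, j) \<noteq> 0" using c(1) by auto
    have "coeff (coeff P j) i = c (i, j)"
      using ij(1,2) by (simp add: P_def coeff_sum coeff_monom sum.delta if_distrib cong: if_cong)
    then show False using P0 ij(3) by simp
  qed
  ultimately show ?thesis unfolding algebraic_over_def by blast
qed

end

section \<open>Discrete valuations\<close>

lemma poly_nonzero_decompose:
  fixes Q :: "'a::idom poly"
  assumes "Q \<noteq> 0"
  obtains s Q' where "Q = monom 1 s * Q'" "coeff Q' 0 \<noteq> 0"
proof -
  have "\<exists>s Q'. Q = monom 1 s * Q' \<and> coeff Q' 0 \<noteq> 0"
    using assms
  proof (induction Q)
    case (pCons a Q)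
    show ?case
    proof (cases "a = 0")
      case True
      then have "Q \<noteq> 0" using pCons.prems by auto
      then obtain s Q' where "Q = monom 1 s * Q'" "coeff Q' 0 \<noteq> 0" using pCons.IH by blast
      moreover have "pCons 0 (monom 1 s * Q') = monom 1 (Suc s) * Q'"
        by (simp add: monom_Suc)
      ultimately show ?thesis using True by blast
    next
      case False
      then show ?thesis by (intro exI[of _ 0] exI[of _ "pCons a Q"]) auto
    qed
  qed simp
  then show thesis using that by blast
qed

text \<open>Dividing out the inner variable as long as it divides all coefficients leaves a
  polynomial that stays nonzero when this variable is set to zero. Each division lowers the degree
  of the leading coefficient, so the process ends. It serves to specialise an algebraic relation at
  a zero of a function.\<close>

lemma poly_poly_reduce:
  fixes P :: "'a::idom poly poly"
  assumes "P \<noteq> 0"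
  shows "\<exists>s P'. P = smult (monom 1 s) P' \<and> map_poly (\<lambda>Q. coeff Q 0) P' \<noteq> 0"
  using assms
proof (induction "degree (lead_coeff P)" arbitrary: P rule: less_induct)
  case less
  show ?case
  proof (cases "map_poly (\<lambda>Q. coeff Q 0) P = 0")
    case True
    define P' where "P' = map_poly (poly_shift 1) P"
    have c0: "coeff (coeff P l) 0 = 0" for l
      using arg_cong[OF True, of "\<lambda>R. coeff R l"] by (simp add: coeff_map_poly)
    have "coeff P l = monom 1 1 * coeff P' l" for l
      by (rule poly_eqI) (use c0 in \<open>auto simp: P'_def coeff_map_poly coeff_monom_mult coeff_poly_shift Suc_le_eq\<close>)
    then have P: "P = smult (monom 1 1) P'" by (intro poly_eqI) simp
    have P'0: "P' \<noteq> 0" using less.prems P by auto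
    have "lead_coeff P = monom 1 1 * lead_coeff P'" by (subst (1 2) P) simp
    then have "degree (lead_coeff P) = Suc (degree (lead_coeff P'))"
      using P'0 by (simp add: degree_mult_eq degree_monom_eq)
    then obtain s P'' where "P' = smult (monom 1 s) P''" "map_poly (\<lambda>Q. coeff Q 0) P'' \<noteq> 0"
      using less.hyps[of P'] P'0 by auto
    then show ?thesis using P by (intro exI[of _ "Suc s"] exI[of _ P'']) (auto simp: mult_monom)
  next
    case False
    then show ?thesis by (intro exI[of _ 0] exI[of _ P]) auto
  qed
qed

context smooth_curve
begin

lemma local_ring_ev:
  assumes p: "p \<in> points C" and t: "t \<in> \<O> p"
  shows "ev t Q \<in> \<O> p" "res p (ev t Q) = poly Q (res p t)"
proof -
  have "ev t Q \<in> \<O> p \<and> res p (ev t Q) = poly Q (res p t)"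
    by (induction Q) (auto simp: ev_pCons local_ring_0 local_ring_add local_ring_mult local_ring_const p t)
  then show "ev t Q \<in> \<O> p" "res p (ev t Q) = poly Q (res p t)" by auto
qed

section \<open>Maximal ideals and Nakayama's lemma\<close>

lemma max_ideal_local: "p \<in> points C \<Longrightarrow> f \<in> \<mm> p \<Longrightarrow> f \<in> \<O> p"
  by (simp add: max_ideal_iff)

lemma max_ideal_add: "p \<in> points C \<Longrightarrow> f \<in> \<mm> p \<Longrightarrow> g \<in> \<mm> p \<Longrightarrow> f + g \<in> \<mm> p"
  by (simp add: max_ideal_iff local_ring_add)

lemma max_ideal_mult: "p \<in> points C \<Longrightarrow> f \<in> \<O> p \<Longrightarrow> g \<in> \<mm> p \<Longrightarrow> f * g \<in> \<mm> p"
  by (simp add: max_ideal_iff local_ring_mult)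

lemma max_ideal_0: "p \<in> points C \<Longrightarrow> 0 \<in> \<mm> p"
  by (simp add: max_ideal_iff local_ring_0)

lemma max_ideal_sum: "p \<in> points C \<Longrightarrow> (\<And>s. s \<in> S \<Longrightarrow> f s \<in> \<mm> p) \<Longrightarrow> sum f S \<in> \<mm> p"
  by (induction S rule: infinite_finite_induct) (auto simp: max_ideal_add max_ideal_0)

definition max_ideal_sq :: "('k, 'i) point \<Rightarrow> 'K set"
  where "max_ideal_sq p = {\<Sum>i<n. f i * g i | (n::nat) f g. \<forall>i<n. f i \<in> \<mm> p \<and> g i \<in> \<mm> p}"

lemma max_ideal_sq_subset: "p \<in> points C \<Longrightarrow> max_ideal_sq p \<subseteq> \<mm> p"
  by (auto simp: max_ideal_sq_def intro!: max_ideal_sum max_ideal_mult max_ideal_local)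

lemma max_ideal_sq_add:
  assumes "a \<in> max_ideal_sq p" "b \<in> max_ideal_sq p" shows "a + b \<in> max_ideal_sq p"
proof -
  obtain m :: nat and f g where a: "a = (\<Sum>i<m. f i * g i)" "\<forall>i<m. f i \<in> \<mm> p \<and> g i \<in> \<mm> p"
    using assms(1) unfolding max_ideal_sq_def by blast
  obtain n :: nat and f' g' where b: "b = (\<Sum>i<n. f' i * g' i)" "\<forall>i<n. f' i \<in> \<mm> p \<and> g' i \<in> \<mm> p"
    using assms(2) unfolding max_ideal_sq_def by blast
  define F where "F i = (if i < m then f i else f' (i - m))" for i
  define G where "G i = (if i < m then g i else g' (i - m))" for i
  have "(\<Sum>i<m + n. F i * G i) = (\<Sum>i<m. F i * G i) + (\<Sum>i=m..<m + n. F i * G i)"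
    by (metis atLeast0LessThan le_add1 sum.atLeastLessThan_concat zero_le)
  also have "(\<Sum>i=m..<m + n. F i * G i) = (\<Sum>i<n. F (i + m) * G (i + m))"
    using sum.shift_bounds_nat_ivl[of "\<lambda>i. F i * G i" 0 m n] by (simp add: atLeast0LessThan add.commute)
  finally have "a + b = (\<Sum>i<m + n. F i * G i)" by (simp add: a b F_def G_def)
  moreover have "\<forall>i<m + n. F i \<in> \<mm> p \<and> G i \<in> \<mm> p" using a(2) b(2) by (auto simp: F_def G_def)
  ultimately show ?thesis unfolding max_ideal_sq_def by blast
qed

lemma cotangent_pair:
  assumes p: "p \<in> points C"
  shows "subspace_pair (\<lambda>a f. h a * f) (\<mm> p) (max_ideal_sq p)"
proof -
  interpret K: vector_space "\<lambda>c (f :: 'K). h c * f" by (rule vector_space_K)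
  have "K.subspace (\<mm> p)"
    unfolding K.subspace_def by (auto simp: max_ideal_0 max_ideal_add max_ideal_mult local_ring_const p)
  moreover have "K.subspace (max_ideal_sq p)"
    unfolding K.subspace_def
  proof (intro conjI ballI allI max_ideal_sq_add)
    show "0 \<in> max_ideal_sq p" unfolding max_ideal_sq_def by (intro CollectI exI[of _ 0]) auto
    fix c x assume "x \<in> max_ideal_sq p"
    then obtain n :: nat and f g where "x = (\<Sum>i<n. f i * g i)" "\<forall>i<n. f i \<in> \<mm> p \<and> g i \<in> \<mm> p"
      unfolding max_ideal_sq_def by blast
    then have "h c * x = (\<Sum>i<n. (h c * f i) * g i)" "\<forall>i<n. h c * f i \<in> \<mm> p \<and> g i \<in> \<mm> p"
      by (auto simp: sum_distrib_left mult.assoc max_ideal_mult local_ring_const p)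
    then show "h c * x \<in> max_ideal_sq p" unfolding max_ideal_sq_def
      by (intro CollectI exI[of _ n] exI[of _ "\<lambda>i. h c * f i"] exI[of _ g]) auto
  qed
  ultimately show ?thesis
    using max_ideal_sq_subset[OF p] by unfold_locales
qed

text \<open>Smoothness says that a lift \<open>\<pi>\<close> of a basis of the cotangent space
  generates the maximal ideal modulo its square. As the ideal is finitely generated, Nakayama's
  lemma removes the square.\<close>

lemma max_ideal_principal:
  assumes p: "p \<in> points C"
  shows "\<exists>\<pi>. \<pi> \<noteq> 0 \<and> \<mm> p = (\<lambda>a. \<pi> * a) ` \<O> p"
proof -
  interpret S: subspace_pair "\<lambda>a f. h a * f" "\<mm> p" "max_ideal_sq p" by (rule cotangent_pair[OF p])
  have "has_dim S.Q 1"
    using smooth p unfolding smooth_projective_curve_def cotangent_space_def max_ideal_sq_def by blast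
  then obtain b where b: "\<forall>i<1. b i \<in> \<mm> p" "\<forall>v\<in>\<mm> p. \<exists>!c. c \<in> extensional {..<1::nat} \<and>
      v - (\<Sum>i<1. h (c i) * b i) \<in> max_ideal_sq p"
    unfolding S.has_dim_iff by (elim exE conjE)
  define \<pi> where "\<pi> = b 0"
  have \<pi>: "\<pi> \<in> \<mm> p" using b(1) by (simp add: \<pi>_def)
  have \<pi>0: "\<pi> \<noteq> 0"
  proof
    assume "\<pi> = 0"
    then have "(\<Sum>i<1. h ((\<lambda>_. 1) i) * b i) \<in> max_ideal_sq p"
      using S.subspace_0[OF S.B] by (simp add: \<pi>_def)
    from S.has_dim_indep[OF b(2) this, of 0] show False by simp
  qed
  have dec: "\<exists>c. v - h c * \<pi> \<in> max_ideal_sq p" if v: "v \<in> \<mm> p" for v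
  proof -
    obtain c where "v - (\<Sum>i<1. h (c i) * b i) \<in> max_ideal_sq p" using b(2) v by blast
    then show ?thesis by (auto simp: \<pi>_def)
  qed
  obtain g :: "'i \<Rightarrow> 'K" where g: "\<And>j. g j \<in> \<mm> p" "\<mm> p \<subseteq> local_span p g UNIV"
    using max_ideal_generators[OF p] by blast
  \<comment> \<open>Preparation for the module \<open>M J\<close> generated by \<open>\<pi>\<close>
    and the \<open>g j\<close> with \<open>j\<close> in \<open>J\<close>; the aim is to shrink
    \<open>J\<close> from all indices to none.\<close>
  have mO: "x \<in> \<O> p" if "x \<in> \<mm> p" for x using that max_ideal_local[OF p] by blast
  define M where "M J = {\<pi> * a + s | a s. a \<in> \<O> p \<and> s \<in> local_span p g J}" for J
  have M_add: "x + y \<in> M J" if xy: "x \<in> M J" "y \<in> M J" for x y J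
  proof -
    obtain a s a' s' where "x = \<pi> * a + s" "a \<in> \<O> p" "s \<in> local_span p g J"
      "y = \<pi> * a' + s'" "a' \<in> \<O> p" "s' \<in> local_span p g J" using xy unfolding M_def by blast
    then show ?thesis unfolding M_def
      by (intro CollectI exI[of _ "a + a'"] exI[of _ "s + s'"])
        (auto simp: algebra_simps local_ring_add local_span_add p)
  qed
  have M_mult: "f * x \<in> M J" if f: "f \<in> \<O> p" and x: "x \<in> M J" for f x J
  proof -
    obtain a s where "x = \<pi> * a + s" "a \<in> \<O> p" "s \<in> local_span p g J" using x unfolding M_def by blast
    then show ?thesis unfolding M_def using f
      by (intro CollectI exI[of _ "f * a"] exI[of _ "f * s"])
        (auto simp: algebra_simps local_ring_mult local_span_mult p)
  qed
  have M_span: "s \<in> M J" if "s \<in> local_span p g J" for s J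
    unfolding M_def using that by (intro CollectI exI[of _ 0] exI[of _ s]) (auto simp: local_ring_0 p)
  \<comment> \<open>Nakayama's lemma for \<open>\<mm> / \<pi>\<O>\<close>, removing one generator at a time.\<close>
  have step: "\<mm> p \<subseteq> M J" if J: "finite J" "j \<notin> J" and MJ: "\<mm> p \<subseteq> M (insert j J)" for j J
  proof -
    \<comment> \<open>\<open>S\<close> is the part of \<open>M (insert j J)\<close> whose
      coefficients at the \<open>g l\<close> lie in the maximal ideal; it absorbs the square of that
      ideal.\<close>
    define S where "S = {\<pi> * a + (\<Sum>l\<in>insert j J. c l * g l) | a c. a \<in> \<O> p \<and> (\<forall>l\<in>insert j J. c l \<in> \<mm> p)}"
    have S_add: "x + y \<in> S" if xy: "x \<in> S" "y \<in> S" for x y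
    proof -
      obtain a c where x: "x = \<pi> * a + (\<Sum>l\<in>insert j J. c l * g l)" "a \<in> \<O> p" "\<forall>l\<in>insert j J. c l \<in> \<mm> p"
        using xy(1) unfolding S_def by blast
      obtain a' c' where y: "y = \<pi> * a' + (\<Sum>l\<in>insert j J. c' l * g l)" "a' \<in> \<O> p" "\<forall>l\<in>insert j J. c' l \<in> \<mm> p"
        using xy(2) unfolding S_def by blast
      have "x + y = \<pi> * (a + a') + (\<Sum>l\<in>insert j J. (c l + c' l) * g l)"
        unfolding x y by (simp only: distrib_left distrib_right sum.distrib add_ac)
      then show ?thesis unfolding S_def using x y
        by (intro CollectI exI[of _ "a + a'"] exI[of _ "\<lambda>l. c l + c' l"])
          (auto simp: local_ring_add max_ideal_add p)
    qed
    have S_mult: "f * x \<in> S" if f: "f \<in> \<mm> p" and x: "x \<in> M (insert j J)" for f x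
    proof -
      obtain a c where x: "x = \<pi> * a + (\<Sum>l\<in>insert j J. c l * g l)" "a \<in> \<O> p" "\<forall>l\<in>insert j J. c l \<in> \<O> p"
        using x unfolding M_def local_span_def by blast
      have "f * x = \<pi> * (f * a) + (\<Sum>l\<in>insert j J. (c l * f) * g l)"
        unfolding x by (simp only: distrib_left sum_distrib_left mult_ac)
      then show ?thesis unfolding S_def using x f mO[OF f]
        by (intro CollectI exI[of _ "f * a"] exI[of _ "\<lambda>l. c l * f"])
          (auto simp: local_ring_mult max_ideal_mult p)
    qed
    have S0: "0 \<in> S" unfolding S_def
      by (intro CollectI exI[of _ 0] exI[of _ "\<lambda>_. 0"]) (auto simp: local_ring_0 max_ideal_0 p)
    obtain c where "g j - h c * \<pi> \<in> max_ideal_sq p" using dec g(1) by blast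
    then obtain n :: nat and f f' where ff: "g j - h c * \<pi> = (\<Sum>i<n. f i * f' i)" "\<forall>i<n. f i \<in> \<mm> p \<and> f' i \<in> \<mm> p"
      unfolding max_ideal_sq_def by blast
    have "(\<Sum>i<m. f i * f' i) \<in> S" if "m \<le> n" for m
      using that by (induction m) (use S0 S_add S_mult ff(2) MJ in \<open>auto simp: subset_eq\<close>)
    then have "g j - h c * \<pi> \<in> S" using ff(1) by simp
    then obtain a \<mu> where a: "g j - h c * \<pi> = \<pi> * a + (\<Sum>l\<in>insert j J. \<mu> l * g l)" "a \<in> \<O> p"
      "\<forall>l\<in>insert j J. \<mu> l \<in> \<mm> p" unfolding S_def by blast
    have "g j = \<pi> * (h c + a) + \<mu> j * g j + (\<Sum>l\<in>J. \<mu> l * g l)"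
      using a(1) J by (simp add: algebra_simps)
    \<comment> \<open>\<open>1 - \<mu> j\<close> is a unit because \<open>\<mu> j\<close> vanishes
      at \<open>p\<close>, so \<open>g j\<close> is expressed by \<open>\<pi>\<close> and the
      remaining generators.\<close>
    then have eq: "(1 - \<mu> j) * g j = \<pi> * (h c + a) + (\<Sum>l\<in>J. \<mu> l * g l)" by (simp add: algebra_simps)
    have "(\<Sum>l\<in>J. \<mu> l * g l) \<in> local_span p g J" unfolding local_span_def using a(3) mO by blast
    then have "(1 - \<mu> j) * g j \<in> M J" unfolding eq M_def using a(2)
      by (intro CollectI exI[of _ "h c + a"] exI[of _ "\<Sum>l\<in>J. \<mu> l * g l"])
        (auto simp: local_ring_add local_ring_const p)
    moreover have \<mu>1: "1 - \<mu> j \<in> \<O> p" "res p (1 - \<mu> j) \<noteq> 0"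
      using a(3) by (auto simp: max_ideal_iff p local_ring_diff local_ring_1)
    ultimately have "inverse (1 - \<mu> j) * ((1 - \<mu> j) * g j) \<in> M J"
      using M_mult local_ring_unit[OF p] by blast
    then have gj: "g j \<in> M J" using local_ring_unit(1)[OF p \<mu>1] by (simp add: mult.assoc[symmetric])
    have "x \<in> M J" if "x \<in> \<mm> p" for x
    proof -
      obtain a c where x: "x = \<pi> * a + (\<Sum>l\<in>insert j J. c l * g l)" "a \<in> \<O> p" "\<forall>l\<in>insert j J. c l \<in> \<O> p"
        using MJ \<open>x \<in> \<mm> p\<close> unfolding M_def local_span_def by blast
      have "\<pi> * a + (\<Sum>l\<in>J. c l * g l) \<in> M J" unfolding M_def local_span_def using x by blast
      moreover have "c j * g j \<in> M J" using gj x(3) by (intro M_mult) auto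
      ultimately have "(\<pi> * a + (\<Sum>l\<in>J. c l * g l)) + c j * g j \<in> M J" by (rule M_add)
      then show ?thesis unfolding x(1) using J by (simp add: algebra_simps)
    qed
    then show ?thesis by blast
  qed
  \<comment> \<open>Here \<open>J\<close> collects the generators already removed.\<close>
  have "\<mm> p \<subseteq> M (UNIV - J)" if "finite J" for J
    using that
  proof (induction J rule: finite_induct)
    case empty
    then show ?case using g(2) M_span by auto
  next
    case (insert j J)
    have "insert j (UNIV - insert j J) = UNIV - J" using insert.hyps by auto
    then show ?case using insert.IH by (intro step[of "UNIV - insert j J" j]) auto
  qed
  from this[of UNIV] have "\<mm> p \<subseteq> M {}" by simp
  then have "\<mm> p \<subseteq> (\<lambda>a. \<pi> * a) ` \<O> p" unfolding M_def local_span_def by auto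
  moreover have "(\<lambda>a. \<pi> * a) ` \<O> p \<subseteq> \<mm> p"
    using max_ideal_mult[OF p _ \<pi>] by (auto simp: mult.commute)
  ultimately show ?thesis using \<pi>0 by blast
qed

section \<open>Uniformisers and orders\<close>

definition unif :: "('k, 'i) point \<Rightarrow> 'K"
  where "unif p = (SOME \<pi>. \<pi> \<noteq> 0 \<and> \<mm> p = (\<lambda>a. \<pi> * a) ` \<O> p)"

lemma unif:
  assumes "p \<in> points C"
  shows "unif p \<noteq> 0" "\<mm> p = (\<lambda>a. unif p * a) ` \<O> p" "unif p \<in> \<mm> p" "unif p \<in> \<O> p" "res p (unif p) = 0"
proof -
  show 1: "unif p \<noteq> 0" "\<mm> p = (\<lambda>a. unif p * a) ` \<O> p"
    using someI_ex[OF max_ideal_principal[OF assms]] unfolding unif_def by blast+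
  have "unif p * 1 \<in> \<mm> p" unfolding 1(2) using local_ring_1[OF assms] by blast
  then show "unif p \<in> \<mm> p" "unif p \<in> \<O> p" "res p (unif p) = 0" by (auto simp: max_ideal_iff assms)
qed

text \<open>Takes the place of Krull's intersection theorem. A relation between the uniformiser and
  \<open>f\<close> with nonzero constant coefficient \<open>Q\<close> expresses \<open>Q\<close>,
  evaluated at the uniformiser, as \<open>f\<close> times a regular function. If \<open>s\<close> is
  the order of \<open>Q\<close> at zero, divisibility of \<open>f\<close> by the power
  \<open>s + 1\<close> would make a unit vanish at \<open>p\<close>.\<close>

lemma unif_power_dvd_bounded:
  assumes p: "p \<in> points C" and f: "f \<noteq> 0" "f \<in> \<O> p"
  shows "\<exists>n. \<forall>a\<in>\<O> p. f \<noteq> unif p ^ n * a"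
proof (rule ccontr)
  assume "\<not> ?thesis"
  then have div: "\<exists>a\<in>\<O> p. f = unif p ^ n * a" for n by blast
  obtain P where P: "P \<noteq> 0" "poly (map_poly (ev (unif p)) P) f = 0"
    using algebraic_dependence[of "unif p" f] unfolding algebraic_over_def by blast
  obtain Q P' where Q: "Q \<noteq> 0" "poly (map_poly (ev (unif p)) (pCons Q P')) f = 0"
    using root_nonzero_constant_coeff[where f = "ev (unif p)", OF ev.hom_zero P f(1)] by blast
  define X where "X = poly (map_poly (ev (unif p)) P') f"
  have X: "X \<in> \<O> p"
    unfolding X_def poly_map_poly_altdef[where f = "ev (unif p)", OF ev.hom_zero]
    by (intro local_ring_sum local_ring_mult local_ring_power local_ring_ev p f unif)
  obtain s Q' where Q': "Q = monom 1 s * Q'" "coeff Q' 0 \<noteq> 0" by (rule poly_nonzero_decompose[OF Q(1)])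
  have eq: "unif p ^ s * ev (unif p) Q' + f * X = 0"
    using Q(2) by (simp add: poly_map_poly_pCons Q'(1) ev.hom_mult ev_monom X_def)
  obtain a where a: "a \<in> \<O> p" "f = unif p ^ Suc s * a" using div by blast
  have "unif p ^ s * (ev (unif p) Q' + unif p * a * X) = 0"
    using eq unfolding a(2) by (simp add: algebra_simps)
  then have "ev (unif p) Q' = - (unif p * a * X)"
    using unif(1)[OF p] by (simp add: eq_neg_iff_add_eq_0)
  then have "res p (ev (unif p) Q') = 0"
    using unif[OF p] a(1) X by (simp add: local_ring_uminus local_ring_mult p)
  then show False using Q'(2) unif[OF p] by (simp add: local_ring_ev p poly_0_coeff_0)
qed

definition unit_at :: "('k, 'i) point \<Rightarrow> 'K \<Rightarrow> bool"
  where "unit_at p u \<longleftrightarrow> u \<noteq> 0 \<and> u \<in> \<O> p \<and> inverse u \<in> \<O> p"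

lemma unit_at_iff: "p \<in> points C \<Longrightarrow> unit_at p u \<longleftrightarrow> u \<in> \<O> p \<and> res p u \<noteq> 0"
proof
  assume p: "p \<in> points C" and u: "unit_at p u"
  then have "res p u * res p (inverse u) = res p 1"
    using local_ring_mult(2)[OF p, of u "inverse u"] by (simp add: unit_at_def)
  then have "res p u \<noteq> 0" using local_ring_1(2)[OF p] by auto
  then show "u \<in> \<O> p \<and> res p u \<noteq> 0" using u by (simp add: unit_at_def)
qed (auto simp: unit_at_def local_ring_unit)

lemma unit_at_mult: "p \<in> points C \<Longrightarrow> unit_at p u \<Longrightarrow> unit_at p v \<Longrightarrow> unit_at p (u * v)"
  by (simp add: unit_at_def local_ring_mult)

lemma unit_at_inverse: "unit_at p u \<Longrightarrow> unit_at p (inverse u)"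
  by (simp add: unit_at_def)

lemma unit_at_powi: "p \<in> points C \<Longrightarrow> unit_at p u \<Longrightarrow> unit_at p (u powi m)"
  by (cases "m \<ge> 0")
    (auto simp: power_int_def unit_at_def local_ring_power power_inverse[symmetric])

text \<open>The exponent is one less than the least power of the uniformiser that fails to divide
  \<open>f\<close>; the cofactor then avoids the maximal ideal.\<close>

lemma local_unif_decompose:
  assumes p: "p \<in> points C" and f: "f \<noteq> 0" "f \<in> \<O> p"
  shows "\<exists>n u. unit_at p u \<and> f = unif p ^ n * u"
proof -
  define N where "N = (LEAST n. \<forall>a\<in>\<O> p. f \<noteq> unif p ^ n * a)"
  have N: "\<forall>a\<in>\<O> p. f \<noteq> unif p ^ N * a"
    unfolding N_def using unif_power_dvd_bounded[OF p f] by (rule LeastI_ex)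
  have "N \<noteq> 0" using N f(2) by (metis mult_1 power_0)
  then obtain n where n: "N = Suc n" by (cases N) auto
  have "\<not> (\<forall>a\<in>\<O> p. f \<noteq> unif p ^ n * a)"
    using n unfolding N_def by (intro not_less_Least) simp
  then obtain u where u: "u \<in> \<O> p" "f = unif p ^ n * u" by blast
  have "u \<notin> \<mm> p"
  proof
    assume "u \<in> \<mm> p"
    then obtain a where "a \<in> \<O> p" "u = unif p * a" unfolding unif(2)[OF p] by blast
    then show False using N u n by (auto simp: mult.assoc)
  qed
  then show ?thesis using u by (auto simp: unit_at_iff p max_ideal_iff)
qed

lemma unif_decompose:
  assumes p: "p \<in> points C" and f: "f \<noteq> 0"
  obtains m u where "unit_at p u" "f = unif p powi m * u"
proof -
  obtain a b where ab: "a \<in> \<O> p" "b \<in> \<O> p" "b \<noteq> 0" "f = a / b" by (rule fraction_local_ring[OF p])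
  then have "a \<noteq> 0" using f by auto
  obtain n u where u: "unit_at p u" "a = unif p ^ n * u" using local_unif_decompose[OF p \<open>a \<noteq> 0\<close> ab(1)] by blast
  obtain n' v where v: "unit_at p v" "b = unif p ^ n' * v" using local_unif_decompose[OF p ab(3,2)] by blast
  have "f = unif p powi (int n - int n') * (u * inverse v)"
    using ab(4) u v unif(1)[OF p] by (simp add: power_int_diff field_simps)
  then show thesis using that unit_at_mult[OF p u(1) unit_at_inverse[OF v(1)]] by blast
qed

lemma unit_at_unif_powi:
  assumes p: "p \<in> points C" and "unit_at p (unif p powi m)"
  shows "m = 0"
proof (rule ccontr)
  assume "m \<noteq> 0"
  have *: "\<not> unit_at p (unif p ^ n)" if "n > 0" for n
    using that unif[OF p] by (simp add: unit_at_iff p local_ring_power)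
  have "unit_at p (unif p powi \<bar>m\<bar>)"
    using assms(2) unit_at_inverse[OF assms(2)] by (cases "m \<ge> 0") (auto simp: power_int_minus)
  moreover have "unif p powi \<bar>m\<bar> = unif p ^ nat \<bar>m\<bar>" by (simp add: power_int_def)
  ultimately show False using *[of "nat \<bar>m\<bar>"] \<open>m \<noteq> 0\<close> by simp
qed

text \<open>The description in \<open>ord\<close> ranges over all generators of the maximal ideal.
  Any of them is \<open>unif p\<close> times a unit \<open>b\<close>, so all exponents can be
  compared for the single generator \<open>unif p\<close>.\<close>

lemma ord_eq:
  assumes p: "p \<in> points C" and u: "unit_at p u" and f: "f = unif p powi m * u"
  shows "ord C p f = m"
  unfolding ord_def
proof (rule the_equality)
  show "\<exists>t u. \<mm> p = (\<lambda>a. t * a) ` \<O> p \<and> u \<noteq> 0 \<and> u \<in> \<O> p \<and> inverse u \<in> \<O> p \<and> f = t powi m * u"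
    using unif(2)[OF p] u f unfolding unit_at_def by blast
  fix m' assume "\<exists>t u. \<mm> p = (\<lambda>a. t * a) ` \<O> p \<and> u \<noteq> 0 \<and> u \<in> \<O> p \<and> inverse u \<in> \<O> p \<and> f = t powi m' * u"
  then obtain t v where t: "\<mm> p = (\<lambda>a. t * a) ` \<O> p" and v: "unit_at p v" "f = t powi m' * v"
    unfolding unit_at_def by blast
  obtain a where a: "a \<in> \<O> p" "unif p = t * a" using unif(3)[OF p] unfolding t by blast
  have "t * 1 \<in> \<mm> p" unfolding t using local_ring_1[OF p] by blast
  then obtain b where b: "b \<in> \<O> p" "t = unif p * b" unfolding unif(2)[OF p] by auto
  have "unif p * (b * a) = unif p * 1" using a(2) b(2) by (metis mult.assoc mult.right_neutral)
  then have "b * a = 1" using unif(1)[OF p] by (simp only: mult_cancel_left) simp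
  then have "inverse b = a" "b \<noteq> 0" by (auto intro: inverse_unique)
  then have ub: "unit_at p b" using a(1) b(1) by (simp add: unit_at_def)
  have bm: "unit_at p (b powi m' * v)" by (intro unit_at_mult unit_at_powi p ub v)
  have "unif p powi m * u = unif p powi m' * (b powi m' * v)"
    using f v(2) b(2) by (simp add: power_int_mult_distrib mult.assoc)
  then have "unif p powi (m - m') = (b powi m' * v) * inverse u"
    using unif(1)[OF p] u by (simp add: power_int_diff unit_at_def field_simps)
  then have "m - m' = 0"
    using unit_at_mult[OF p bm unit_at_inverse[OF u]] by (intro unit_at_unif_powi[OF p]) simp
  then show "m' = m" by simp
qed

lemma ord_decompose:
  assumes p: "p \<in> points C" and f: "f \<noteq> 0"
  obtains u where "unit_at p u" "f = unif p powi ord C p f * u"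
  using unif_decompose[OF assms] ord_eq[OF p] by metis

lemma ord_mult:
  assumes p: "p \<in> points C" and "f \<noteq> 0" "g \<noteq> 0"
  shows "ord C p (f * g) = ord C p f + ord C p g"
proof -
  obtain u where u: "unit_at p u" "f = unif p powi ord C p f * u" by (rule ord_decompose[OF p assms(2)])
  obtain v where v: "unit_at p v" "g = unif p powi ord C p g * v" by (rule ord_decompose[OF p assms(3)])
  show ?thesis
    by (rule ord_eq[OF p unit_at_mult[OF p u(1) v(1)]])
      (subst u(2), subst v(2), simp add: power_int_add unif(1)[OF p])
qed

lemma ord_unit: "p \<in> points C \<Longrightarrow> unit_at p u \<Longrightarrow> ord C p u = 0"
  by (rule ord_eq[of p u]) auto

lemma ord_unif_powi: "p \<in> points C \<Longrightarrow> ord C p (unif p powi m) = m"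
  by (rule ord_eq[of p 1]) (auto simp: unit_at_def local_ring_1)

lemma ord_1: "p \<in> points C \<Longrightarrow> ord C p 1 = 0"
  by (rule ord_unit) (auto simp: unit_at_def local_ring_1)

lemma ord_inverse: "p \<in> points C \<Longrightarrow> f \<noteq> 0 \<Longrightarrow> ord C p (inverse f) = - ord C p f"
  using ord_mult[of p f "inverse f"] ord_1[of p] by simp

lemma local_ring_iff_ord:
  assumes p: "p \<in> points C"
  shows "f \<in> \<O> p \<longleftrightarrow> f = 0 \<or> ord C p f \<ge> 0"
proof (cases "f = 0")
  case False
  obtain u where u: "unit_at p u" "f = unif p powi ord C p f * u" by (rule ord_decompose[OF p False])
  have "f \<in> \<O> p" if "ord C p f \<ge> 0"
  proof -
    have "unif p powi ord C p f = unif p ^ nat (ord C p f)" using that by (simp add: power_int_def)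
    moreover have "unif p ^ nat (ord C p f) * u \<in> \<O> p"
      using u(1) by (intro local_ring_mult local_ring_power p unif) (auto simp: unit_at_def)
    ultimately show ?thesis using u(2) by simp
  qed
  moreover have "ord C p f \<ge> 0" if f: "f \<in> \<O> p"
  proof -
    obtain n v where "unit_at p v" "f = unif p ^ n * v" using local_unif_decompose[OF p False f] by blast
    then have "ord C p f = int n" by (intro ord_eq[OF p]) auto
    then show ?thesis by simp
  qed
  ultimately show ?thesis using False by blast
qed (simp add: local_ring_0 p)

lemma max_ideal_iff_ord:
  assumes p: "p \<in> points C"
  shows "f \<in> \<mm> p \<longleftrightarrow> f = 0 \<or> ord C p f \<ge> 1"
proof (cases "f = 0")
  case False
  have "f \<in> \<mm> p \<longleftrightarrow> inverse (unif p) * f \<in> \<O> p"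
  proof
    assume "f \<in> \<mm> p"
    then show "inverse (unif p) * f \<in> \<O> p"
      unfolding unif(2)[OF p] using unif(1)[OF p] by (auto simp: mult.assoc[symmetric])
  next
    assume "inverse (unif p) * f \<in> \<O> p"
    then have "unif p * (inverse (unif p) * f) \<in> \<mm> p" unfolding unif(2)[OF p] by blast
    then show "f \<in> \<mm> p" using unif(1)[OF p] by (simp add: mult.assoc[symmetric])
  qed
  also have "\<dots> \<longleftrightarrow> ord C p f \<ge> 1"
    using False unif(1)[OF p] ord_unif_powi[OF p, of 1]
    by (auto simp: local_ring_iff_ord p ord_mult ord_inverse)
  finally show ?thesis using False by simp
qed (simp add: max_ideal_0 p)

lemma inverse_max_ideal:
  assumes "p \<in> points C" "f \<notin> \<O> p" shows "inverse f \<in> \<mm> p" "f \<noteq> 0"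
  using assms by (auto simp: local_ring_iff_ord max_ideal_iff_ord ord_inverse)

section \<open>Zeros, poles and approximation at finitely many points\<close>

lemma ord_power: "p \<in> points C \<Longrightarrow> f \<noteq> 0 \<Longrightarrow> ord C p (f ^ n) = int n * ord C p f"
  by (induction n) (auto simp: ord_1 ord_mult algebra_simps)

lemma max_ideal_power_mult:
  assumes p: "p \<in> points C" and x: "x \<in> \<mm> p" and N: "N \<ge> nat (- ord C p f)" "N > 0"
  shows "x ^ N * f \<in> \<O> p"
proof (cases "x = 0 \<or> f = 0")
  case True
  \<comment> \<open>\<open>N > 0\<close> enters here: for \<open>x = 0\<close> and a function
    \<open>f\<close> with a pole, the power zero would leave \<open>f\<close> itself.\<close>
  then show ?thesis using N(2) by (auto simp: local_ring_0 p power_0_left)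
next
  case False
  then have "ord C p x \<ge> 1" using x by (simp add: max_ideal_iff_ord p)
  then have "int N * 1 \<le> int N * ord C p x" by (intro mult_left_mono) auto
  then have "int N * ord C p x + ord C p f \<ge> 0" using N by linarith
  then show ?thesis using False by (simp add: local_ring_iff_ord p ord_mult ord_power)
qed

text \<open>In each chart an algebraic relation between \<open>f\<close> and an affine coordinate,
  reduced at \<open>f = 0\<close>, becomes a nonzero polynomial over \<open>'k\<close> satisfied by
  the value of that coordinate at every zero of \<open>f\<close>. So only finitely many coordinate
  vectors occur.\<close>

lemma finite_zeros:
  assumes f: "f \<noteq> 0"
  shows "finite {p \<in> points C. f \<in> \<mm> p}"
proof -
  have "finite {p \<in> points C. f \<in> \<mm> p \<and> rep p i \<noteq> 0}" for i
  proof -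
    define w where "w j = coords C j / coords C i" for j
    have "\<forall>j. \<exists>P. map_poly (\<lambda>Q. coeff Q 0) P \<noteq> 0 \<and> poly (map_poly (ev f) P) (w j) = 0"
    proof
      fix j
      obtain P where P: "P \<noteq> 0" "poly (map_poly (ev f) P) (w j) = 0"
        using algebraic_dependence[of f "w j"] unfolding algebraic_over_def by blast
      obtain s P' where P': "P = smult (monom 1 s) P'" "map_poly (\<lambda>Q. coeff Q 0) P' \<noteq> 0"
        using poly_poly_reduce[OF P(1)] by blast
      have "poly (map_poly (ev f) P) (w j) = f ^ s * poly (map_poly (ev f) P') (w j)"
        unfolding P'(1) map_poly_smult[of "ev f", OF ev.hom_zero ev.hom_mult] by (simp add: ev_monom)
      then show "\<exists>P. map_poly (\<lambda>Q. coeff Q 0) P \<noteq> 0 \<and> poly (map_poly (ev f) P) (w j) = 0"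
        using P(2) P'(2) f by auto
    qed
    then obtain P where P: "\<And>j. map_poly (\<lambda>Q. coeff Q 0) (P j) \<noteq> 0"
      "\<And>j. poly (map_poly (ev f) (P j)) (w j) = 0" by metis
    define R where "R j = {x. poly (map_poly (\<lambda>Q. coeff Q 0) (P j)) x = 0}" for j
    have finR: "finite (R j)" for j unfolding R_def by (rule poly_roots_finite[OF P(1)])
    let ?Z = "{p \<in> points C. f \<in> \<mm> p \<and> rep p i \<noteq> 0}"
    let ?c = "\<lambda>p j. rep p j / rep p i"
    have "?c ` ?Z \<subseteq> PiE UNIV R"
    proof (rule image_subsetI)
      fix p assume "p \<in> ?Z"
      then have p: "p \<in> points C" and fp: "f \<in> \<O> p" "res p f = 0" and i: "rep p i \<noteq> 0"
        by (auto simp: max_ideal_iff)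
      have "?c p j \<in> R j" for j
      proof -
        have w: "w j \<in> \<O> p" "res p (w j) = ?c p j"
          unfolding w_def by (rule coord_quotient_local[OF p i])+
        \<comment> \<open>Since \<open>f\<close> has residue 0 at \<open>p\<close>, each coefficient
          contributes its constant term.\<close>
        have "res p (poly (map_poly (ev f) (P j)) (w j)) = (\<Sum>l\<le>degree (P j). coeff (coeff (P j) l) 0 * ?c p j ^ l)"
          unfolding poly_map_poly_altdef[where f = "ev f", OF ev.hom_zero]
          using w fp by (simp add: local_ring_sum local_ring_mult local_ring_power local_ring_ev p poly_0_coeff_0)
        then have "(\<Sum>l\<le>degree (P j). coeff (coeff (P j) l) 0 * ?c p j ^ l) = 0"
          unfolding P(2) by (simp add: local_ring_0 p)
        then show ?thesis
          unfolding R_def by (simp add: poly_map_poly_altdef[where f = "\<lambda>Q. coeff Q 0"])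
      qed
      then show "?c p \<in> PiE UNIV R" by auto
    qed
    then have "finite (?c ` ?Z)" by (rule finite_subset) (auto intro: finite_PiE finR)
    moreover have "inj_on ?c ?Z"
    proof (rule inj_onI)
      fix p q assume "p \<in> ?Z" "q \<in> ?Z" and eq: "?c p = ?c q"
      then show "p = q" using fun_cong[OF eq] by (intro point_eqI[of p q i]) blast+
    qed
    ultimately show ?thesis by (rule finite_imageD)
  qed
  then have "finite (\<Union>i. {p \<in> points C. f \<in> \<mm> p \<and> rep p i \<noteq> 0})" by auto
  moreover have "{p \<in> points C. f \<in> \<mm> p} \<subseteq> (\<Union>i. {p \<in> points C. f \<in> \<mm> p \<and> rep p i \<noteq> 0})"
    using rep(1) by auto
  ultimately show ?thesis by (rule rev_finite_subset)
qed

lemma finite_poles: "finite {p \<in> points C. f \<notin> \<O> p}"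
proof (cases "f = 0")
  case False
  have "finite {p \<in> points C. inverse f \<in> \<mm> p}" using False by (intro finite_zeros) simp
  then show ?thesis by (rule rev_finite_subset) (auto dest: inverse_max_ideal)
next
  case True
  then have "{p \<in> points C. f \<notin> \<O> p} = {}" using local_ring_0(1) by blast
  then show ?thesis by (simp only: finite.emptyI)
qed

text \<open>The weight \<open>E p = 1 - (1 - e p ^ N) ^ N\<close> is close to 1 at \<open>p\<close>
  and to 0 at the other points of \<open>P\<close>, in both cases to order at least
  \<open>N\<close>. The weighted sum of the \<open>r p\<close> then differs from \<open>r q\<close>
  by a function regular at \<open>q\<close>.\<close>

lemma semilocal_approximation:
  assumes P: "finite P" "P \<subseteq> points C"
  shows "\<exists>f. \<forall>p\<in>P. r p - f \<in> \<O> p"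
proof -
  have "\<forall>p. \<exists>e. p \<in> P \<longrightarrow> (\<forall>q\<in>P. e \<in> \<O> q \<and> res q e = (if q = p then 1 else 0))"
    using idempotent_mod[OF P] by metis
  then obtain e where e: "\<And>p q. p \<in> P \<Longrightarrow> q \<in> P \<Longrightarrow> e p \<in> \<O> q"
    "\<And>p q. p \<in> P \<Longrightarrow> q \<in> P \<Longrightarrow> res q (e p) = (if q = p then 1 else 0)" by metis
  \<comment> \<open>\<open>N\<close> bounds the pole of every \<open>r p\<close> at every point of
    \<open>P\<close>, because \<open>r p\<close> must also be suppressed away from
    \<open>p\<close>.\<close>
  define N where "N = Suc (\<Sum>p\<in>P. \<Sum>q\<in>P. nat (- ord C q (r p)))"
  have N: "nat (- ord C q (r p)) \<le> N" if "p \<in> P" "q \<in> P" for p q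
  proof -
    have "nat (- ord C q (r p)) \<le> (\<Sum>q\<in>P. nat (- ord C q (r p)))"
      using that P by (intro member_le_sum) auto
    also have "\<dots> \<le> (\<Sum>p\<in>P. \<Sum>q\<in>P. nat (- ord C q (r p)))"
      using that P by (intro member_le_sum[where f = "\<lambda>p. \<Sum>q\<in>P. nat (- ord C q (r p))"]) auto
    finally show ?thesis by (simp add: N_def)
  qed
  have N0: "N > 0" by (simp add: N_def)
  define E where "E p = 1 - (1 - e p ^ N) ^ N" for p
  have "r q - (\<Sum>p\<in>P. E p * r p) \<in> \<O> q" if q: "q \<in> P" for q
  proof -
    have qC: "q \<in> points C" using q P by auto
    have "1 - e q ^ N \<in> \<mm> q"
      using e q by (simp add: max_ideal_iff qC local_ring_diff local_ring_power local_ring_1)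
    then have 1: "(1 - e q ^ N) ^ N * r q \<in> \<O> q" by (rule max_ideal_power_mult[OF qC _ N[OF q q] N0])
    have 2: "E p * r p \<in> \<O> q" if p: "p \<in> P - {q}" for p
    proof -
      have p': "p \<in> P" "q \<noteq> p" using p by blast+
      have ep: "e p \<in> \<mm> q" using e[OF p'(1) q] p'(2) by (simp add: max_ideal_iff qC)
      have "E p = e p ^ N * (\<Sum>l<N. (1 - e p ^ N) ^ l)"
        unfolding E_def by (subst one_diff_power_eq) simp
      then have "E p * r p = (e p ^ N * r p) * (\<Sum>l<N. (1 - e p ^ N) ^ l)" by (simp add: mult_ac)
      also have "\<dots> \<in> \<O> q"
        by (intro local_ring_mult local_ring_sum local_ring_power local_ring_diff local_ring_1 qC
            max_ideal_power_mult[OF qC ep N[OF p'(1) q] N0] e p' q)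
      finally show ?thesis .
    qed
    have "(\<Sum>p\<in>P. E p * r p) = E q * r q + (\<Sum>p\<in>P - {q}. E p * r p)" by (rule sum.remove) (use P q in auto)
    then have "r q - (\<Sum>p\<in>P. E p * r p) = (1 - e q ^ N) ^ N * r q - (\<Sum>p\<in>P - {q}. E p * r p)"
      by (simp add: E_def algebra_simps)
    also have "\<dots> \<in> \<O> q" by (intro local_ring_diff local_ring_sum qC 1 2)
    finally show ?thesis .
  qed
  then show ?thesis by blast
qed

end

section \<open>Finiteness of the genus\<close>

text \<open>\<open>e\<close> is invertible modulo every power of \<open>X - \<alpha>\<close> since
  it does not vanish at \<alpha>; the induction determines \<open>c\<close> one power at a
  time.\<close>

lemma poly_approximation:
  fixes a e :: "'a::field poly"
  assumes "poly e \<alpha> \<noteq> 0"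
  shows "\<exists>c a'. a - c * e = [:- \<alpha>, 1:] ^ N * a'"
proof (induction N)
  case 0
  show ?case by (intro exI[of _ 0] exI[of _ a]) simp
next
  case (Suc N)
  then obtain c a' where IH: "a - c * e = [:- \<alpha>, 1:] ^ N * a'" by blast
  define v where "v = poly a' \<alpha> / poly e \<alpha>"
  have "poly (a' - smult v e) \<alpha> = 0" using assms by (simp add: v_def)
  then obtain a'' where a'': "a' - smult v e = [:- \<alpha>, 1:] * a''"
    unfolding poly_eq_0_iff_dvd by (rule dvdE)
  have "a - (c + smult v ([:- \<alpha>, 1:] ^ N)) * e = (a - c * e) - smult v ([:- \<alpha>, 1:] ^ N) * e"
    by (simp add: algebra_simps)
  also have "\<dots> = [:- \<alpha>, 1:] ^ N * (a' - smult v e)" unfolding IH by (simp add: right_diff_distrib)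
  also have "\<dots> = [:- \<alpha>, 1:] ^ Suc N * a''" unfolding a'' by (simp only: power_Suc mult_ac)
  finally show ?case by blast
qed

context smooth_curve
begin

lemma ev_linear: "ev t [:- \<alpha>, 1:] = t - h \<alpha>"
  by (simp add: ev_pCons hom_distribs)

lemma transcendental_nonconst: "transcendental t \<Longrightarrow> t - h \<alpha> \<noteq> 0"
  using ev_linear[of t \<alpha>] unfolding transcendental_def by (metis pCons_eq_0_iff zero_neq_one)

text \<open>A pole of \<open>f\<close> at a point where \<open>t\<close> is regular is cancelled by
  a power of \<open>t\<close> minus its value there.\<close>

lemma regular_multiple:
  assumes t: "transcendental t"
  shows "\<exists>q. q \<noteq> 0 \<and> (\<forall>p\<in>points C. t \<in> \<O> p \<longrightarrow> ev t q * f \<in> \<O> p)"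
proof -
  define B where "B = {p \<in> points C. f \<notin> \<O> p}"
  have B: "finite B" unfolding B_def by (rule finite_poles)
  define N where "N p = Suc (nat (- ord C p f))" for p
  \<comment> \<open>At a pole of \<open>t\<close> the value \<open>res p t\<close> is arbitrary; the
    factor is still a nonzero polynomial and does no harm.\<close>
  define F where "F p = [:- res p t, 1:] ^ N p" for p
  have "ev t (\<Prod>p\<in>B. F p) * f \<in> \<O> p" if p: "p \<in> points C" and tp: "t \<in> \<O> p" for p
  proof (cases "p \<in> B")
    case True
    have "t - h (res p t) \<in> \<mm> p"
      by (simp add: max_ideal_iff p local_ring_diff local_ring_const tp)
    then have "(t - h (res p t)) ^ N p * f \<in> \<O> p" by (rule max_ideal_power_mult[OF p]) (auto simp: N_def)
    then have 1: "ev t (F p) * f \<in> \<O> p" by (simp only: F_def ev.hom_power ev_linear)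
    have "ev t (\<Prod>p\<in>B. F p) * f = ev t (\<Prod>q\<in>B - {p}. F q) * (ev t (F p) * f)"
      using True B by (simp add: prod.remove ev.hom_mult mult_ac)
    also have "\<dots> \<in> \<O> p" by (intro local_ring_mult local_ring_ev p tp 1)
    finally show ?thesis .
  next
    case False
    then show ?thesis using p by (intro local_ring_mult local_ring_ev p tp) (auto simp: B_def)
  qed
  moreover have "(\<Prod>p\<in>B. F p) \<noteq> 0" using B by (simp add: F_def)
  ultimately show ?thesis by blast
qed

text \<open>Multiplying the generators by nonzero polynomials in \<open>t\<close> keeps them
  generating, so they can be taken regular wherever \<open>t\<close> is.\<close>

lemma finite_over_rational_regular:
  obtains t U where "transcendental t" "finite U" "rat_span t U = UNIV"
    "\<And>u p. u \<in> U \<Longrightarrow> p \<in> points C \<Longrightarrow> t \<in> \<O> p \<Longrightarrow> u \<in> \<O> p"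
proof -
  obtain t U where t: "transcendental t" and U: "finite U" "rat_span t U = UNIV"
    by (rule finite_over_rational)
  obtain q where q: "\<And>u. q u \<noteq> 0" "\<And>u p. p \<in> points C \<Longrightarrow> t \<in> \<O> p \<Longrightarrow> ev t (q u) * u \<in> \<O> p"
    using regular_multiple[OF t] by metis
  define U' where "U' = (\<lambda>u. ev t (q u) * u) ` U"
  have U': "finite U'" using U(1) by (simp add: U'_def)
  have mem: "u \<in> rat_span t U'" if "u \<in> U" for u
    using rat_span_mem[OF U', of "ev t (q u) * u"] that q(1) by (auto simp: U'_def intro: rat_span_cancel)
  have "f \<in> rat_span t U'" for f
  proof -
    have "f \<in> rat_span t U" using U(2) by blast
    then obtain c a where c: "c \<noteq> 0" "ev t c * f = (\<Sum>u\<in>U. ev t (a u) * u)" unfolding rat_span_def by blast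
    have "ev t c * f \<in> rat_span t U'" unfolding c(2) by (intro rat_span_sum rat_span_smult mem)
    then show ?thesis by (rule rat_span_cancel[OF c(1)])
  qed
  then have "rat_span t U' = UNIV" by blast
  then show thesis using that[OF t U'] q(2) unfolding U'_def by blast
qed

text \<open>The polar parts at the points over \<open>\<alpha>\<close> are realised by \<open>\<Sum>\<^sub>u (c\<^sub>u(t) / (t - \<alpha>)\<^sup>N) u\<close>, which is
  regular wherever \<open>t\<close> is regular and different from \<open>\<alpha>\<close>.\<close>

lemma polar_part_at:
  assumes t: "transcendental t" and U: "rat_span t U = UNIV"
    and reg: "\<And>u p. u \<in> U \<Longrightarrow> p \<in> points C \<Longrightarrow> t \<in> \<O> p \<Longrightarrow> u \<in> \<O> p"
  shows "\<exists>f. (\<forall>p\<in>points C. t \<in> \<O> p \<longrightarrow> res p t = \<alpha> \<longrightarrow> r p - f \<in> \<O> p) \<and>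
    (\<forall>p\<in>points C. t \<in> \<O> p \<longrightarrow> res p t \<noteq> \<alpha> \<longrightarrow> f \<in> \<O> p)"
proof -
  define \<tau> where "\<tau> = t - h \<alpha>"
  have \<tau>0: "\<tau> \<noteq> 0" unfolding \<tau>_def by (rule transcendental_nonconst[OF t])
  define P where "P = {p \<in> points C. t \<in> \<O> p \<and> res p t = \<alpha>}"
  have "P \<subseteq> {p \<in> points C. \<tau> \<in> \<mm> p}"
    by (auto simp: P_def \<tau>_def max_ideal_iff local_ring_diff local_ring_const)
  then have "finite P" by (rule finite_subset) (rule finite_zeros[OF \<tau>0])
  \<comment> \<open>Only finitely many points lie over \<alpha>. At these \<open>g\<close> has the
    prescribed polar parts, but it may have further poles elsewhere.\<close>
  then obtain g where g: "\<forall>p\<in>P. r p - g \<in> \<O> p"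
    using semilocal_approximation[of P r] by (auto simp: P_def)
  have "g \<in> rat_span t U" using U by blast
  then obtain b a where b: "b \<noteq> 0" "ev t b * g = (\<Sum>u\<in>U. ev t (a u) * u)" unfolding rat_span_def by blast
  \<comment> \<open>The multiplicity of \<alpha> in the denominator of \<open>g\<close>; the
    cofactor \<open>e\<close> is a unit over \<alpha>.\<close>
  define N where "N = order \<alpha> b"
  obtain e where e: "b = [:- \<alpha>, 1:] ^ N * e" "poly e \<alpha> \<noteq> 0"
    using order_decomp[OF b(1), of \<alpha>] unfolding N_def poly_eq_0_iff_dvd by blast
  have "e \<noteq> 0" using e(2) by auto
  then have eve: "ev t e \<noteq> 0" using t unfolding transcendental_def by blast
  have evb: "ev t b = \<tau> ^ N * ev t e"
    unfolding \<tau>_def by (subst e(1)) (simp only: ev.hom_mult ev.hom_power ev_linear)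
  \<comment> \<open>The numerators are divided by \<open>e\<close> modulo the power \<open>N\<close>
    of \<open>X - \<alpha>\<close>. Then \<open>g - f\<close> has denominator \<open>e\<close>
    alone, while \<open>f\<close> has denominator \<open>\<tau> ^ N\<close> alone.\<close>
  have "\<forall>u. \<exists>c a'. a u - c * e = [:- \<alpha>, 1:] ^ N * a'"
    using poly_approximation[OF e(2)] by blast
  then obtain c a' where ca: "\<And>u. a u - c u * e = [:- \<alpha>, 1:] ^ N * a' u"
    unfolding choice_iff by blast
  have evca: "ev t (a u) = ev t (c u) * ev t e + \<tau> ^ N * ev t (a' u)" for u
  proof -
    have "ev t (a u) - ev t (c u) * ev t e = \<tau> ^ N * ev t (a' u)"
      using arg_cong[OF ca[of u], of "ev t"]
      by (simp only: ev.hom_minus ev.hom_mult ev.hom_power ev_linear \<tau>_def)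
    then show ?thesis by (simp only: diff_eq_eq add.commute)
  qed
  define f where "f = (\<Sum>u\<in>U. ev t (c u) * u) / \<tau> ^ N"
  have "ev t b * (g - f) = (\<Sum>u\<in>U. ev t (a u) * u) - ev t e * (\<Sum>u\<in>U. ev t (c u) * u)"
    using \<tau>0 by (simp add: right_diff_distrib b(2)[symmetric] f_def evb)
  also have "\<dots> = (\<Sum>u\<in>U. \<tau> ^ N * (ev t (a' u) * u))"
    unfolding sum_distrib_left sum_subtractf[symmetric]
    by (intro sum.cong refl) (simp only: evca, simp add: algebra_simps)
  also have "\<dots> = \<tau> ^ N * (\<Sum>u\<in>U. ev t (a' u) * u)" by (simp add: sum_distrib_left)
  finally have "\<tau> ^ N * (ev t e * (g - f)) = \<tau> ^ N * (\<Sum>u\<in>U. ev t (a' u) * u)"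
    by (simp only: evb mult.assoc)
  then have eq: "ev t e * (g - f) = (\<Sum>u\<in>U. ev t (a' u) * u)" using \<tau>0 by simp
  have "g - f = (ev t e * (g - f)) * inverse (ev t e)" using eve by simp
  then have gf: "g - f = (\<Sum>u\<in>U. ev t (a' u) * u) * inverse (ev t e)" unfolding eq .
  have "r p - f \<in> \<O> p" if p: "p \<in> points C" "t \<in> \<O> p" "res p t = \<alpha>" for p
  proof -
    have "res p (ev t e) \<noteq> 0" using local_ring_ev(2)[OF p(1,2), of e] e(2) unfolding p(3) by argo
    then have ie: "inverse (ev t e) \<in> \<O> p" by (rule local_ring_unit(2)[OF p(1) local_ring_ev(1)[OF p(1,2)]])
    have "g - f \<in> \<O> p" unfolding gf
      by (intro local_ring_mult local_ring_sum local_ring_ev p reg[OF _ p(1,2)] ie)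
    then have "(r p - g) + (g - f) \<in> \<O> p" using g p by (intro local_ring_add) (auto simp: P_def)
    then show ?thesis by simp
  qed
  moreover have "f \<in> \<O> p" if p: "p \<in> points C" "t \<in> \<O> p" "res p t \<noteq> \<alpha>" for p
  proof -
    have "\<tau> \<in> \<O> p" "res p \<tau> \<noteq> 0"
      using p(3) unfolding \<tau>_def by (simp_all add: local_ring_diff local_ring_const p(1,2))
    then have i\<tau>: "inverse \<tau> \<in> \<O> p" by (rule local_ring_unit(2)[OF p(1)])
    have "(\<Sum>u\<in>U. ev t (c u) * u) \<in> \<O> p"
      by (intro local_ring_mult local_ring_sum local_ring_ev p reg[OF _ p(1,2)])
    then have "(\<Sum>u\<in>U. ev t (c u) * u) * inverse \<tau> ^ N \<in> \<O> p"
      using local_ring_power(1)[OF p(1) i\<tau>] by (rule local_ring_mult(1)[OF p(1)])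
    then show ?thesis by (simp add: f_def divide_inverse power_inverse)
  qed
  ultimately show ?thesis by blast
qed

text \<open>There is one correcting function for each value of \<open>t\<close> at a point where
  \<open>r\<close> is not regular. Each is regular over the other values, so their sum keeps all the
  prescribed polar parts.\<close>

lemma polar_part_finite:
  assumes t: "transcendental t" and U: "rat_span t U = UNIV"
    and reg: "\<And>u p. u \<in> U \<Longrightarrow> p \<in> points C \<Longrightarrow> t \<in> \<O> p \<Longrightarrow> u \<in> \<O> p"
    and r: "finite {p \<in> points C. r p \<notin> \<O> p}"
  shows "\<exists>f. \<forall>p\<in>points C. t \<in> \<O> p \<longrightarrow> r p - f \<in> \<O> p"
proof -
  obtain F where F: "\<And>\<alpha> p. p \<in> points C \<Longrightarrow> t \<in> \<O> p \<Longrightarrow> res p t = \<alpha> \<Longrightarrow> r p - F \<alpha> \<in> \<O> p"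
    "\<And>\<alpha> p. p \<in> points C \<Longrightarrow> t \<in> \<O> p \<Longrightarrow> res p t \<noteq> \<alpha> \<Longrightarrow> F \<alpha> \<in> \<O> p"
    using polar_part_at[OF t U reg, where r = r] by metis
  define A where "A = (\<lambda>p. res p t) ` {p \<in> points C. r p \<notin> \<O> p}"
  have A: "finite A" using r by (simp add: A_def)
  have "r p - (\<Sum>\<alpha>\<in>A. F \<alpha>) \<in> \<O> p" if p: "p \<in> points C" "t \<in> \<O> p" for p
  proof (cases "res p t \<in> A")
    case True
    have "r p - (\<Sum>\<alpha>\<in>A. F \<alpha>) = (r p - F (res p t)) - (\<Sum>\<alpha>\<in>A - {res p t}. F \<alpha>)"
      using A True by (simp add: sum.remove)
    also have "\<dots> \<in> \<O> p" by (intro local_ring_diff local_ring_sum F p) auto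
    finally show ?thesis .
  next
    case False
    then have "r p \<in> \<O> p" using p by (auto simp: A_def)
    then show ?thesis using False by (intro local_ring_diff local_ring_sum F p) auto
  qed
  then show ?thesis by blast
qed

lemma inverse_power_ev:
  assumes "t \<noteq> 0" "degree Q \<le> n"
  shows "inverse t ^ n * ev t Q = (\<Sum>i\<le>n. h (coeff Q i) * inverse t ^ (n - i))"
proof -
  have "inverse t ^ n * (h (coeff Q i) * t ^ i) = h (coeff Q i) * inverse t ^ (n - i)" if "i \<le> n" for i
  proof -
    have "inverse t ^ n = inverse t ^ (n - i) * inverse t ^ i" using that by (simp add: power_add[symmetric])
    moreover have "inverse t ^ i * t ^ i = 1" using assms(1) by (simp add: power_mult_distrib[symmetric])
    ultimately show ?thesis by (simp add: mult_ac)
  qed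
  then show ?thesis unfolding ev_altdef[OF assms(2)] sum_distrib_left
    by (intro sum.cong[OF refl]) (simp only: atMost_iff)
qed

text \<open>In powers of \<open>inverse t\<close>, which vanishes at the poles of \<open>t\<close>,
  only the coefficient of degree \<open>n\<close> survives at such a pole.\<close>

lemma inverse_power_ev_local:
  assumes p: "p \<in> points C" and t: "t \<notin> \<O> p" and deg: "degree Q \<le> n"
  shows "inverse t ^ n * ev t Q \<in> \<O> p" "res p (inverse t ^ n * ev t Q) = coeff Q n"
proof -
  have s: "inverse t \<in> \<O> p" "res p (inverse t) = 0" "t \<noteq> 0"
    using inverse_max_ideal[OF p t] by (auto simp: max_ideal_iff p)
  have *: "h (coeff Q i) * inverse t ^ (n - i) \<in> \<O> p" for i
    by (intro local_ring_mult local_ring_const local_ring_power p s)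
  show "inverse t ^ n * ev t Q \<in> \<O> p"
    unfolding inverse_power_ev[OF s(3) deg] by (intro local_ring_sum p *)
  have "res p (inverse t ^ n * ev t Q) = (\<Sum>i\<le>n. coeff Q i * 0 ^ (n - i))"
    unfolding inverse_power_ev[OF s(3) deg]
    by (simp add: local_ring_sum[OF p *] local_ring_mult local_ring_const local_ring_power p s)
  also have "\<dots> = (\<Sum>i\<le>n. if i = n then coeff Q n else 0)" by (rule sum.cong) (auto simp: power_0_left)
  finally show "res p (inverse t ^ n * ev t Q) = coeff Q n" by simp
qed

text \<open>The expansion of the rational function \<open>a / b\<close> of \<open>t\<close> at
  infinity: division in powers of \<open>inverse t\<close>, with remainder from the power
  \<open>N\<close> on.\<close>

lemma expansion_at_infinity:
  assumes t: "t \<noteq> 0" and b: "b \<noteq> 0" and a: "degree a \<le> degree b"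
  shows "\<exists>c a'. degree a' \<le> degree b \<and>
    ev t a = ev t b * (\<Sum>m<N. h (c m) * inverse t ^ m) + inverse t ^ N * ev t a'"
proof (induction N)
  case 0
  show ?case using a by (intro exI[of _ "\<lambda>_. 0"] exI[of _ a]) simp
next
  case (Suc N)
  then obtain c a' where IH: "degree a' \<le> degree b"
    "ev t a = ev t b * (\<Sum>m<N. h (c m) * inverse t ^ m) + inverse t ^ N * ev t a'" by blast
  \<comment> \<open>The value of \<open>a' / b\<close> at infinity. Subtracting
    \<open>smult v b\<close> removes the coefficient of degree \<open>degree b\<close>, which leaves
    room for the factor \<open>t\<close> in \<open>pCons 0 d\<close>.\<close>
  define v where "v = coeff a' (degree b) / lead_coeff b"
  define d where "d = a' - smult v b"
  have "degree d \<le> degree b" unfolding d_def using IH(1) by (intro degree_diff_le) auto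
  then have d: "coeff d i = 0" if "i \<ge> degree b" for i
    using that b IH(1) coeff_eq_0[of a' i] coeff_eq_0[of b i]
    by (cases "i = degree b") (auto simp: d_def v_def)
  have deg: "degree (pCons 0 d) \<le> degree b"
    by (rule degree_le) (auto simp: coeff_pCons d split: nat.split)
  have "ev t a' = h v * ev t b + ev t d" by (simp add: d_def ev.hom_minus ev_smult)
  also have "ev t d = inverse t * ev t (pCons 0 d)" using t by (simp add: ev_pCons)
  finally have "ev t a = ev t b * (\<Sum>m<Suc N. h ((c(N := v)) m) * inverse t ^ m)
      + inverse t ^ Suc N * ev t (pCons 0 d)"
    unfolding IH(2) by (simp add: algebra_simps)
  then show ?case using deg by blast
qed

text \<open>One function takes care of the points where \<open>t\<close> is regular, another
  function \<open>g\<close> of the poles of \<open>t\<close>. The numerators of \<open>g\<close> are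
  divided by its denominator: the quotients give a function regular where \<open>t\<close> is, the
  remainders expand in powers of \<open>inverse t\<close>, and from the power \<open>M\<close> on
  the terms are regular at the poles of \<open>t\<close>.\<close>

lemma H1_finite_spanning:
  "\<exists>(T :: ('K \<times> nat) set) w. finite T \<and> (\<forall>r. finite {p \<in> points C. r p \<notin> \<O> p} \<longrightarrow>
     (\<exists>c f. \<forall>p\<in>points C. r p - (\<Sum>x\<in>T. h (c x) * w x p) - f \<in> \<O> p)) \<and>
     (\<forall>x p. p \<notin> points C \<longrightarrow> w x p = 0) \<and> (\<forall>x. finite {p \<in> points C. w x p \<notin> \<O> p})"
proof -
  obtain t U where t: "transcendental t" and U: "finite U" "rat_span t U = UNIV"
    and reg: "\<And>u p. u \<in> U \<Longrightarrow> p \<in> points C \<Longrightarrow> t \<in> \<O> p \<Longrightarrow> u \<in> \<O> p"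
    by (rule finite_over_rational_regular) blast
  have t0: "t \<noteq> 0" using transcendental_nonconst[OF t, of 0] by simp
  define P where "P = {p \<in> points C. t \<notin> \<O> p}"
  have P: "finite P" unfolding P_def by (rule finite_poles)
  define M where "M = Suc (\<Sum>u\<in>U. \<Sum>p\<in>P. nat (- ord C p u))"
  have sM: "inverse t ^ M * u \<in> \<O> p" if "u \<in> U" "p \<in> P" for u p
  proof -
    have "nat (- ord C p u) \<le> (\<Sum>p\<in>P. nat (- ord C p u))" using that P by (intro member_le_sum) auto
    also have "\<dots> \<le> (\<Sum>u\<in>U. \<Sum>p\<in>P. nat (- ord C p u))"
      using that U(1) by (intro member_le_sum[where f = "\<lambda>u. \<Sum>p\<in>P. nat (- ord C p u)"]) auto
    finally show ?thesis using that inverse_max_ideal[of p t]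
      by (intro max_ideal_power_mult) (auto simp: P_def M_def)
  qed
  define w where "w x p = (if p \<in> P then inverse t ^ snd x * fst x else 0)" for x :: "'K \<times> nat" and p
  have "\<exists>c f. \<forall>p\<in>points C. r p - (\<Sum>x\<in>U \<times> {..<M}. h (c x) * w x p) - f \<in> \<O> p"
    if r: "finite {p \<in> points C. r p \<notin> \<O> p}" for r
  proof -
    obtain f0 where f0: "\<And>p. p \<in> points C \<Longrightarrow> t \<in> \<O> p \<Longrightarrow> r p - f0 \<in> \<O> p"
      using polar_part_finite[OF t U(2) reg r] by blast
    obtain g where g: "\<And>p. p \<in> P \<Longrightarrow> (r p - f0) - g \<in> \<O> p"
      using semilocal_approximation[OF P, of "\<lambda>p. r p - f0"] by (auto simp: P_def)
    have "g \<in> rat_span t U" using U by blast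
    then obtain b a where b: "b \<noteq> 0" "ev t b * g = (\<Sum>u\<in>U. ev t (a u) * u)" unfolding rat_span_def by blast
    have evb: "ev t b \<noteq> 0" using t b(1) unfolding transcendental_def by blast
    have "degree (a u mod b) \<le> degree b" for u
      using degree_mod_less[OF b(1), of "a u"] by auto
    then have "\<exists>c a'. degree a' \<le> degree b \<and> ev t (a u mod b) =
        ev t b * (\<Sum>m<M. h (c m) * inverse t ^ m) + inverse t ^ M * ev t a'" for u
      by (intro expansion_at_infinity t0 b(1))
    then obtain c a' where a': "\<And>u. degree (a' u) \<le> degree b" "\<And>u. ev t (a u mod b) =
        ev t b * (\<Sum>m<M. h (c u m) * inverse t ^ m) + inverse t ^ M * ev t (a' u)" by metis
    \<comment> \<open>The polynomial parts form a global function. Being regular where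
      \<open>t\<close> is, it leaves the effect of \<open>f0\<close> there intact.\<close>
    define f where "f = (\<Sum>u\<in>U. ev t (a u div b) * u)"
    define S where "S = (\<Sum>u\<in>U. \<Sum>m<M. h (c u m) * (inverse t ^ m * u))"
    have "ev t (a u) = ev t (a u div b) * ev t b + ev t (a u mod b)" for u
      by (metis div_mult_mod_eq ev.hom_add ev.hom_mult)
    then have "ev t b * g = (\<Sum>u\<in>U. ev t b * (ev t (a u div b) * u)
        + ev t b * (\<Sum>m<M. h (c u m) * (inverse t ^ m * u)) + (inverse t ^ M * u) * ev t (a' u))"
      unfolding b(2) a'(2) by (intro sum.cong refl) (simp add: algebra_simps sum_distrib_left sum_distrib_right)
    also have "\<dots> = ev t b * (f + S) + (\<Sum>u\<in>U. (inverse t ^ M * u) * ev t (a' u))"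
      by (simp add: f_def S_def sum.distrib sum_distrib_left distrib_left)
    finally have eq: "ev t b * (g - (f + S)) = (\<Sum>u\<in>U. (inverse t ^ M * u) * ev t (a' u))"
      by (simp only: right_diff_distrib diff_eq_eq add.commute)
    have "g - f - S = (ev t b * (g - (f + S))) * inverse (ev t b)"
      by (simp add: diff_diff_eq mult.commute[of "ev t b"] mult.assoc evb)
    then have gfS: "g - f - S = (\<Sum>u\<in>U. (inverse t ^ M * u) * (ev t (a' u) / ev t b))"
      unfolding eq by (simp only: sum_distrib_right divide_inverse mult.assoc)
    have "r p - (\<Sum>x\<in>U \<times> {..<M}. h (c (fst x) (snd x)) * w x p) - (f0 + f) \<in> \<O> p"
      if p: "p \<in> points C" for p
    proof (cases "p \<in> P")
      case True
      then have tp: "t \<notin> \<O> p" by (simp add: P_def)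
      let ?n = "degree b"
      \<comment> \<open>Numerator and denominator are both divided by \<open>t ^ ?n\<close>; the
        denominator then takes the leading coefficient of \<open>b\<close> as value and is a
        unit.\<close>
      have "inverse (inverse t ^ ?n * ev t b) \<in> \<O> p"
        using inverse_power_ev_local[OF p tp, of b ?n] b(1) by (intro local_ring_unit(2)[OF p]) auto
      then have "(inverse t ^ ?n * ev t (a' u)) * inverse (inverse t ^ ?n * ev t b) \<in> \<O> p" for u
        by (rule local_ring_mult(1)[OF p inverse_power_ev_local(1)[OF p tp a'(1)]])
      moreover have "(inverse t ^ ?n * ev t (a' u)) * inverse (inverse t ^ ?n * ev t b) = ev t (a' u) / ev t b" for u
        using t0 by (simp add: divide_inverse)
      ultimately have "ev t (a' u) / ev t b \<in> \<O> p" for u by simp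
      then have "g - f - S \<in> \<O> p" unfolding gfS
        by (intro local_ring_sum local_ring_mult(1)[OF p sM[OF _ True]] p)
      then have "((r p - f0) - g) + (g - f - S) \<in> \<O> p" using g[OF True] by (intro local_ring_add p)
      moreover have "(\<Sum>x\<in>U \<times> {..<M}. h (c (fst x) (snd x)) * w x p) = S"
        using True by (simp add: w_def S_def sum.cartesian_product split_def)
      ultimately show ?thesis by (simp add: algebra_simps)
    next
      case False
      then have tp: "t \<in> \<O> p" using p by (simp add: P_def)
      have "f \<in> \<O> p" unfolding f_def by (intro local_ring_sum local_ring_mult local_ring_ev p tp reg[OF _ p tp])
      then have "(r p - f0) - f \<in> \<O> p" by (rule local_ring_diff(1)[OF p f0[OF p tp]])
      then show ?thesis using False by (simp add: w_def algebra_simps)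
    qed
    then show ?thesis
      by (intro exI[of _ "\<lambda>x. c (fst x) (snd x)"] exI[of _ "f0 + f"]) blast
  qed
  moreover have "finite (U \<times> {..<M})" using U(1) by simp
  moreover have "\<forall>x p. p \<notin> points C \<longrightarrow> w x p = 0" by (auto simp: w_def P_def)
  moreover have "finite {p \<in> points C. w x p \<notin> \<O> p}" for x
    by (rule finite_subset[OF _ P]) (auto simp: w_def local_ring_0)
  ultimately show ?thesis by blast
qed

section \<open>The genus as a number of spanning adeles\<close>

lemma vector_space_repartitions: "vector_space (\<lambda>a (r :: ('k, 'i) point \<Rightarrow> 'K) p. h a * r p)"
  by unfold_locales (auto simp: hom_distribs algebra_simps fun_eq_iff)

lemma finite_poles_add:
  assumes "finite {p \<in> points C. f p \<notin> \<O> p}" "finite {p \<in> points C. g p \<notin> \<O> p}"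
  shows "finite {p \<in> points C. f p + g p \<notin> \<O> p}"
  by (rule finite_subset[OF _ finite_UnI[OF assms]]) (auto simp: local_ring_add)

lemma H1_pair:
  "subspace_pair (\<lambda>a r p. h a * r p)
     {r. (\<forall>p. p \<notin> points C \<longrightarrow> r p = 0) \<and> finite {p \<in> points C. r p \<notin> \<O> p}}
     {r. (\<forall>p. p \<notin> points C \<longrightarrow> r p = 0) \<and> (\<exists>f. \<forall>p\<in>points C. r p - f \<in> \<O> p)}"
  (is "subspace_pair _ ?A ?B")
proof -
  interpret R: vector_space "\<lambda>a (r :: ('k, 'i) point \<Rightarrow> 'K) p. h a * r p"
    by (rule vector_space_repartitions)
  have "R.subspace ?A"
    unfolding R.subspace_def
  proof (intro conjI ballI allI)
    have "{p \<in> points C. (0 :: 'K) \<notin> \<O> p} = {}" using local_ring_0(1) by blast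
    then have "finite {p \<in> points C. (0 :: 'K) \<notin> \<O> p}" by (simp only: finite.emptyI)
    then show "0 \<in> ?A" by simp
  next
    fix x y assume "x \<in> ?A" "y \<in> ?A"
    then show "x + y \<in> ?A" by (auto intro: finite_poles_add)
  next
    fix c x assume x: "x \<in> ?A"
    then have "finite {p \<in> points C. x p \<notin> \<O> p}" by simp
    then have "finite {p \<in> points C. h c * x p \<notin> \<O> p}"
      by (rule rev_finite_subset) (auto simp: local_ring_mult local_ring_const)
    then show "(\<lambda>p. h c * x p) \<in> ?A" using x by simp
  qed
  moreover have "R.subspace ?B"
    unfolding R.subspace_def
  proof (intro conjI ballI allI)
    show "0 \<in> ?B" by (auto intro!: exI[of _ 0] simp: local_ring_0)
  next
    fix x y assume xy: "x \<in> ?B" "y \<in> ?B"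
    then obtain f g where fg: "\<And>p. p \<in> points C \<Longrightarrow> x p - f \<in> \<O> p" "\<And>p. p \<in> points C \<Longrightarrow> y p - g \<in> \<O> p"
      by blast
    have "(x + y) p - (f + g) \<in> \<O> p" if "p \<in> points C" for p
      using local_ring_add(1)[OF that fg(1)[OF that] fg(2)[OF that]] by (simp add: algebra_simps)
    then show "x + y \<in> ?B" using xy by (auto intro!: exI[of _ "f + g"])
  next
    fix c x assume x: "x \<in> ?B"
    then obtain f where f: "\<And>p. p \<in> points C \<Longrightarrow> x p - f \<in> \<O> p" by blast
    have "h c * x p - h c * f \<in> \<O> p" if "p \<in> points C" for p
      using local_ring_mult(1)[OF that local_ring_const(1)[OF that] f[OF that], of c]
      by (simp add: algebra_simps)
    then show "(\<lambda>p. h c * x p) \<in> ?B" using x by (auto intro!: exI[of _ "h c * f"])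
  qed
  moreover have "?B \<subseteq> ?A"
  proof
    fix r assume r: "r \<in> ?B"
    then obtain f where f: "\<And>p. p \<in> points C \<Longrightarrow> r p - f \<in> \<O> p" by blast
    have "finite {p \<in> points C. r p \<notin> \<O> p}"
    proof (rule finite_subset[OF _ finite_poles[of f]], clarify)
      fix p assume p: "p \<in> points C" "r p \<notin> \<O> p" "f \<in> \<O> p"
      then show False using local_ring_add(1)[OF p(1) f[OF p(1)] p(3)] by simp
    qed
    then show "r \<in> ?A" using r by simp
  qed
  ultimately show ?thesis by unfold_locales
qed

text \<open>The form in which the genus enters the later count. Adeles are set to zero off the curve
  to meet the definition of \<open>H1_structure_sheaf\<close>.\<close>

lemma genus_spanning:
  "\<exists>\<eta> :: nat \<Rightarrow> ('k, 'i) point \<Rightarrow> 'K. \<forall>r. finite {p \<in> points C. r p \<notin> \<O> p} \<longrightarrow>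
     (\<exists>c f. \<forall>p\<in>points C. r p - (\<Sum>i<genus C. h (c i) * \<eta> i p) - f \<in> \<O> p)"
proof -
  let ?A = "{r. (\<forall>p. p \<notin> points C \<longrightarrow> r p = 0) \<and> finite {p \<in> points C. r p \<notin> \<O> p}}"
  let ?B = "{r. (\<forall>p. p \<notin> points C \<longrightarrow> r p = 0) \<and> (\<exists>f. \<forall>p\<in>points C. r p - f \<in> \<O> p)}"
  interpret H: subspace_pair "\<lambda>a r p. h a * r p" ?A ?B by (rule H1_pair)
  obtain T :: "('K \<times> nat) set" and w where T: "finite T"
    and span: "\<And>r. finite {p \<in> points C. r p \<notin> \<O> p} \<Longrightarrow>
       \<exists>c f. \<forall>p\<in>points C. r p - (\<Sum>x\<in>T. h (c x) * w x p) - f \<in> \<O> p"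
    and w0: "\<And>x p. p \<notin> points C \<Longrightarrow> w x p = 0"
    using H1_finite_spanning by blast
  have "\<exists>c. v - (\<Sum>x\<in>T. (\<lambda>p. h (c x) * w x p)) \<in> ?B" if v: "v \<in> ?A" for v
  proof -
    obtain c f where "\<forall>p\<in>points C. v p - (\<Sum>x\<in>T. h (c x) * w x p) - f \<in> \<O> p"
      using span[of v] v by blast
    then have "v - (\<Sum>x\<in>T. (\<lambda>p. h (c x) * w x p)) \<in> ?B"
      using v by (auto simp: sum_fun_apply w0)
    then show ?thesis by (intro exI[of _ c])
  qed
  from H.has_dim_exists[OF T this] obtain n where n: "has_dim H.Q n" by blast
  have "genus C = n" unfolding genus_def H1_structure_sheaf_def
    using n H.has_dim_unique by (intro the_equality) auto
  then have "has_dim H.Q (genus C)" using n by simp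
  then obtain \<eta> where \<eta>: "\<forall>i<genus C. \<eta> i \<in> ?A" "\<forall>v\<in>?A. \<exists>!c. c \<in> extensional {..<genus C} \<and>
      v - (\<Sum>i<genus C. (\<lambda>p. h (c i) * \<eta> i p)) \<in> ?B"
    unfolding H.has_dim_iff by (elim exE conjE)
  have "\<exists>c f. \<forall>p\<in>points C. r p - (\<Sum>i<genus C. h (c i) * \<eta> i p) - f \<in> \<O> p"
    if r: "finite {p \<in> points C. r p \<notin> \<O> p}" for r
  proof -
    define v where "v p = (if p \<in> points C then r p else 0)" for p
    have "{p \<in> points C. v p \<notin> \<O> p} = {p \<in> points C. r p \<notin> \<O> p}" by (auto simp: v_def)
    then have "v \<in> ?A" using r by (simp add: v_def)
    then obtain c where "v - (\<Sum>i<genus C. (\<lambda>p. h (c i) * \<eta> i p)) \<in> ?B" using \<eta>(2) by blast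
    then obtain f where f: "\<forall>p\<in>points C. (v - (\<Sum>i<genus C. (\<lambda>p. h (c i) * \<eta> i p))) p - f \<in> \<O> p" by blast
    then have "\<forall>p\<in>points C. r p - (\<Sum>i<genus C. h (c i) * \<eta> i p) - f \<in> \<O> p"
      by (simp add: v_def sum_fun_apply)
    then show ?thesis by blast
  qed
  then show ?thesis by blast
qed

end

section \<open>Lattices over the local rings\<close>

locale curve_bundle = smooth_curve C
  for C :: "('k::alg_closed_field, 'K::field, 'i::finite) curve" +
  fixes V :: "('k, 'K, 'i, 'e::ab_group_add) vbundle"
  assumes is_bundle: "vector_bundle C V"
begin

abbreviation "rk \<equiv> rank V"
abbreviation smul (infixr \<open>\<cdot>\<close> 75) where "smul \<equiv> scl V"

sublocale E: vector_space smul
  using is_bundle by (simp add: vector_bundle_def)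

definition lattice :: "('k, 'i) point \<Rightarrow> (nat \<Rightarrow> 'e) \<Rightarrow> 'e set"
  where "lattice p b = {\<Sum>i<rk. f i \<cdot> b i | f. \<forall>i<rk. f i \<in> \<O> p}"

lemma latticeI: "(\<And>i. i < rk \<Longrightarrow> f i \<in> \<O> p) \<Longrightarrow> (\<Sum>i<rk. f i \<cdot> b i) \<in> lattice p b"
  unfolding lattice_def by blast

lemma latticeE:
  assumes "v \<in> lattice p b"
  obtains f where "\<And>i. i < rk \<Longrightarrow> f i \<in> \<O> p" "v = (\<Sum>i<rk. f i \<cdot> b i)"
  using assms unfolding lattice_def by blast

lemma frame_at_iff: "frame_at C V p b \<longleftrightarrow> is_basis V b \<and> stalk V p = lattice p b"
  by (simp add: frame_at_def lattice_def)

lemma lattice_add: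
  assumes p: "p \<in> points C" and "v \<in> lattice p b" "w \<in> lattice p b"
  shows "v + w \<in> lattice p b"
proof -
  obtain f where f: "\<And>i. i < rk \<Longrightarrow> f i \<in> \<O> p" "v = (\<Sum>i<rk. f i \<cdot> b i)" by (rule latticeE[OF assms(2)]) blast
  obtain g where g: "\<And>i. i < rk \<Longrightarrow> g i \<in> \<O> p" "w = (\<Sum>i<rk. g i \<cdot> b i)" by (rule latticeE[OF assms(3)]) blast
  have "v + w = (\<Sum>i<rk. (f i + g i) \<cdot> b i)" by (simp add: f g E.scale_left_distrib sum.distrib)
  then show ?thesis using f(1) g(1) by (auto intro!: latticeI local_ring_add p)
qed

lemma lattice_smul:
  assumes p: "p \<in> points C" and "a \<in> \<O> p" "v \<in> lattice p b"
  shows "a \<cdot> v \<in> lattice p b"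
proof -
  obtain f where f: "\<And>i. i < rk \<Longrightarrow> f i \<in> \<O> p" "v = (\<Sum>i<rk. f i \<cdot> b i)" by (rule latticeE[OF assms(3)]) blast
  have "a \<cdot> v = (\<Sum>i<rk. (a * f i) \<cdot> b i)" by (simp add: f E.scale_sum_right)
  then show ?thesis using f(1) by (auto intro!: latticeI local_ring_mult p assms(2))
qed

lemma lattice_0: "p \<in> points C \<Longrightarrow> 0 \<in> lattice p b"
  using latticeI[of "\<lambda>_. 0" p b] by (simp add: local_ring_0)

lemma lattice_uminus: "p \<in> points C \<Longrightarrow> v \<in> lattice p b \<Longrightarrow> - v \<in> lattice p b"
  using lattice_smul[of p "-1" v b] by (simp add: local_ring_uminus local_ring_1)

lemma lattice_diff: "p \<in> points C \<Longrightarrow> v \<in> lattice p b \<Longrightarrow> w \<in> lattice p b \<Longrightarrow> v - w \<in> lattice p b"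
  using lattice_add[of p v b "- w"] lattice_uminus[of p w b] by simp

lemma lattice_sum:
  "p \<in> points C \<Longrightarrow> (\<And>s. s \<in> S \<Longrightarrow> f s \<in> lattice p b) \<Longrightarrow> sum f S \<in> lattice p b"
  by (induction S rule: infinite_finite_induct) (auto simp: lattice_0 lattice_add)

lemma lattice_mem:
  assumes p: "p \<in> points C" and "j < rk" shows "b j \<in> lattice p b"
proof -
  have "(\<Sum>i<rk. (if i = j then 1 else 0) \<cdot> b i) = (\<Sum>i<rk. if i = j then b i else 0)"
    by (rule sum.cong) auto
  then have "(\<Sum>i<rk. (if i = j then 1 else 0) \<cdot> b i) = b j" using assms by (simp add: sum.delta)
  moreover have "(\<Sum>i<rk. (if i = j then 1 else 0) \<cdot> b i) \<in> lattice p b"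
    by (rule latticeI) (auto simp: local_ring_0 local_ring_1 p)
  ultimately show ?thesis by simp
qed

lemma lattice_subset:
  assumes p: "p \<in> points C" and "\<And>j. j < rk \<Longrightarrow> w j \<in> lattice p b"
  shows "lattice p w \<subseteq> lattice p b"
  using assms(2) by (auto elim!: latticeE intro!: lattice_sum lattice_smul p)

definition indep :: "(nat \<Rightarrow> 'e) \<Rightarrow> bool"
  where "indep e \<longleftrightarrow> (\<forall>c. (\<Sum>i<rk. c i \<cdot> e i) = 0 \<longrightarrow> (\<forall>i<rk. c i = 0))"

lemma indepD: "indep e \<Longrightarrow> (\<Sum>i<rk. c i \<cdot> e i) = 0 \<Longrightarrow> i < rk \<Longrightarrow> c i = 0"
  unfolding indep_def by (elim allE[of _ c]) simp

lemma indep_eq: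
  assumes "indep e" "(\<Sum>i<rk. c i \<cdot> e i) = (\<Sum>i<rk. d i \<cdot> e i)" "i < rk"
  shows "c i = d i"
proof -
  have "(\<Sum>i<rk. (c i - d i) \<cdot> e i) = 0"
    using assms(2) by (simp add: E.scale_left_diff_distrib sum_subtractf)
  then have "c i - d i = 0" by (rule indepD[OF assms(1) _ assms(3), where c = "\<lambda>i. c i - d i"])
  then show ?thesis by simp
qed

lemma is_basis_iff: "is_basis V b \<longleftrightarrow> indep b \<and> (\<forall>v. \<exists>c. v = (\<Sum>i<rk. c i \<cdot> b i))"
proof
  assume b: "is_basis V b"
  have "\<exists>c. v = (\<Sum>i<rk. c i \<cdot> b i)" for v using b unfolding is_basis_def by blast
  moreover have "indep b" unfolding indep_def
  proof (intro allI impI)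
    fix c i assume c: "(\<Sum>i<rk. c i \<cdot> b i) = 0" and i: "i < rk"
    have "\<exists>!c. c \<in> extensional {..<rk} \<and> 0 = (\<Sum>i<rk. c i \<cdot> b i)" using b unfolding is_basis_def by blast
    moreover have "0 = (\<Sum>i<rk. restrict c {..<rk} i \<cdot> b i)" using c by simp
    moreover have "0 = (\<Sum>i<rk. restrict (\<lambda>_. 0) {..<rk} i \<cdot> b i)" by simp
    ultimately have "restrict c {..<rk} = restrict (\<lambda>_. 0) {..<rk}" using restrict_extensional by blast
    then show "c i = 0" using i by (metis lessThan_iff restrict_apply')
  qed
  ultimately show "indep b \<and> (\<forall>v. \<exists>c. v = (\<Sum>i<rk. c i \<cdot> b i))" by blast
next
  assume b: "indep b \<and> (\<forall>v. \<exists>c. v = (\<Sum>i<rk. c i \<cdot> b i))"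
  show "is_basis V b" unfolding is_basis_def
  proof
    fix v
    obtain c where c: "v = (\<Sum>i<rk. c i \<cdot> b i)" using b by blast
    show "\<exists>!c. c \<in> extensional {..<rk} \<and> v = (\<Sum>i<rk. c i \<cdot> b i)"
    proof (intro ex1I[of _ "restrict c {..<rk}"] conjI)
      show "v = (\<Sum>i<rk. restrict c {..<rk} i \<cdot> b i)" using c by simp
      fix d assume d: "d \<in> extensional {..<rk} \<and> v = (\<Sum>i<rk. d i \<cdot> b i)"
      then have "d i = c i" if "i < rk" for i
        using indep_eq[of b d c i] b c that by simp
      then show "d = restrict c {..<rk}"
        using d by (intro extensionalityI[of _ "{..<rk}"]) auto
    qed auto
  qed
qed

section \<open>Change of frame\<close>

text \<open>The columns hold the coordinates of the \<open>b j\<close>, so that a further change of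
  frame is multiplication from the left.\<close>

definition frame_matrix :: "(nat \<Rightarrow> 'e) \<Rightarrow> (nat \<Rightarrow> 'e) \<Rightarrow> 'K mat \<Rightarrow> bool"
  where "frame_matrix b e M \<longleftrightarrow> M \<in> carrier_mat rk rk \<and> (\<forall>j<rk. b j = (\<Sum>i<rk. M $$ (i, j) \<cdot> e i))"

lemma frame_matrix_exists:
  assumes "is_basis V e" shows "\<exists>M. frame_matrix b e M"
proof -
  have "\<forall>j. \<exists>c. b j = (\<Sum>i<rk. c i \<cdot> e i)" using assms unfolding is_basis_iff by blast
  then obtain c where c: "\<And>j. b j = (\<Sum>i<rk. c j i \<cdot> e i)" by metis
  then show ?thesis unfolding frame_matrix_def
    by (intro exI[of _ "mat rk rk (\<lambda>(i, j). c j i)"]) auto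
qed

lemma frame_matrix_unique:
  assumes "indep e" "frame_matrix b e M" "frame_matrix b e N" shows "M = N"
proof (rule eq_matI)
  fix i j assume "i < dim_row N" "j < dim_col N"
  then have ij: "i < rk" "j < rk" using assms(3) by (auto simp: frame_matrix_def)
  have "(\<Sum>i<rk. M $$ (i, j) \<cdot> e i) = (\<Sum>i<rk. N $$ (i, j) \<cdot> e i)"
    using assms(2,3) ij unfolding frame_matrix_def by metis
  then show "M $$ (i, j) = N $$ (i, j)"
    by (rule indep_eq[OF assms(1) _ ij(1), where c = "\<lambda>i. M $$ (i, j)" and d = "\<lambda>i. N $$ (i, j)"])
qed (use assms in \<open>auto simp: frame_matrix_def\<close>)

lemma frame_matrix_mult:
  assumes M: "frame_matrix b e M" and T: "frame_matrix e f T"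
  shows "frame_matrix b f (T * M)"
  unfolding frame_matrix_def
proof (intro conjI allI impI)
  have c: "M \<in> carrier_mat rk rk" "T \<in> carrier_mat rk rk" using M T by (auto simp: frame_matrix_def)
  then show "T * M \<in> carrier_mat rk rk" by simp
  fix j assume j: "j < rk"
  have "b j = (\<Sum>l<rk. M $$ (l, j) \<cdot> (\<Sum>i<rk. T $$ (i, l) \<cdot> f i))"
    using M T j by (simp add: frame_matrix_def)
  also have "\<dots> = (\<Sum>l<rk. \<Sum>i<rk. (T $$ (i, l) * M $$ (l, j)) \<cdot> f i)"
    by (simp add: E.scale_sum_right mult.commute)
  also have "\<dots> = (\<Sum>i<rk. (\<Sum>l<rk. T $$ (i, l) * M $$ (l, j)) \<cdot> f i)"
    by (subst sum.swap) (simp add: E.scale_sum_left)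
  also have "\<dots> = (\<Sum>i<rk. (T * M) $$ (i, j) \<cdot> f i)"
    using c j by (intro sum.cong) (auto simp: scalar_prod_def atLeast0LessThan)
  finally show "b j = (\<Sum>i<rk. (T * M) $$ (i, j) \<cdot> f i)" .
qed

lemma frame_matrix_one: "frame_matrix b b (1\<^sub>m rk)"
proof -
  have "(\<Sum>i<rk. 1\<^sub>m rk $$ (i, j) \<cdot> b i) = b j" if j: "j < rk" for j
  proof -
    have "(\<Sum>i<rk. 1\<^sub>m rk $$ (i, j) \<cdot> b i) = (\<Sum>i<rk. if i = j then b i else 0)"
      using j by (intro sum.cong) auto
    then show ?thesis using j by (simp add: sum.delta)
  qed
  then show ?thesis by (simp add: frame_matrix_def)
qed

lemma frame_matrix_det_inverse:
  assumes "is_basis V b" and M: "frame_matrix b e M" and N: "frame_matrix e b N"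
  shows "det N * det M = 1"
proof -
  have "N * M = 1\<^sub>m rk"
    using frame_matrix_unique[OF _ frame_matrix_mult[OF M N] frame_matrix_one] assms(1)
    by (simp add: is_basis_iff)
  moreover have "M \<in> carrier_mat rk rk" "N \<in> carrier_mat rk rk" using M N by (auto simp: frame_matrix_def)
  ultimately show ?thesis using det_mult[of N rk M] by simp
qed

lemma frame_matrix_local:
  assumes "indep e" "frame_matrix b e M" "\<And>j. j < rk \<Longrightarrow> b j \<in> lattice p e" "i < rk" "j < rk"
  shows "M $$ (i, j) \<in> \<O> p"
proof -
  obtain f where f: "\<And>i. i < rk \<Longrightarrow> f i \<in> \<O> p" "b j = (\<Sum>i<rk. f i \<cdot> e i)"
    by (rule latticeE[OF assms(3)[OF assms(5)]]) blast
  then have "(\<Sum>i<rk. M $$ (i, j) \<cdot> e i) = (\<Sum>i<rk. f i \<cdot> e i)"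
    using assms(2,5) by (simp add: frame_matrix_def)
  then have "M $$ (i, j) = f i" by (rule indep_eq[OF assms(1) _ assms(4), where c = "\<lambda>i. M $$ (i, j)"])
  then show ?thesis using f(1) assms(4) by simp
qed

end

context smooth_curve
begin

text \<open>\<open>res p\<close> is multiplicative on the local ring only, hence the comparison of
  the Leibniz sums term by term.\<close>

lemma det_local:
  assumes p: "p \<in> points C" and M: "M \<in> carrier_mat n n"
    and loc: "\<And>i j. i < n \<Longrightarrow> j < n \<Longrightarrow> M $$ (i, j) \<in> \<O> p"
  shows "det M \<in> \<O> p" "res p (det M) = det (map_mat (res p) M)"
proof -
  have sign: "(signof \<pi> :: 'K) \<in> \<O> p" "res p (signof \<pi>) = (signof \<pi> :: 'k)" for \<pi> :: "nat \<Rightarrow> nat"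
    using local_ring_1[OF p] local_ring_uminus[OF p local_ring_1(1)[OF p]]
    by (cases "sign \<pi> = 1"; simp add: sign_def)+
  have entry: "M $$ (i, \<pi> i) \<in> \<O> p" if "\<pi> permutes {0..<n}" "i \<in> {0..<n}" for \<pi> i
    using permutes_in_image[OF that(1), of i] that(2) by (intro loc) auto
  have prod: "(\<Prod>i=0..<n. M $$ (i, \<pi> i)) \<in> \<O> p"
    "res p (\<Prod>i=0..<n. M $$ (i, \<pi> i)) = (\<Prod>i=0..<n. res p (M $$ (i, \<pi> i)))"
    if "\<pi> permutes {0..<n}" for \<pi>
    using local_ring_prod[OF p, of "{0..<n}" "\<lambda>i. M $$ (i, \<pi> i)"] entry[OF that] by blast+
  show "det M \<in> \<O> p" unfolding det_def'[OF M]
    by (intro local_ring_sum local_ring_mult sign prod p) simp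
  have "res p (det M) = (\<Sum>\<pi> | \<pi> permutes {0..<n}. res p (signof \<pi> * (\<Prod>i=0..<n. M $$ (i, \<pi> i))))"
    unfolding det_def'[OF M]
    by (rule local_ring_sum(2)[OF p]) (rule local_ring_mult(1)[OF p sign(1) prod(1)], simp)
  also have "\<dots> = (\<Sum>\<pi> | \<pi> permutes {0..<n}. signof \<pi> * (\<Prod>i=0..<n. res p (M $$ (i, \<pi> i))))"
  proof (rule sum.cong[OF refl])
    fix \<pi> assume "\<pi> \<in> {\<pi>. \<pi> permutes {0..<n}}"
    then have \<pi>: "\<pi> permutes {0..<n}" by simp
    show "res p (signof \<pi> * (\<Prod>i=0..<n. M $$ (i, \<pi> i))) = signof \<pi> * (\<Prod>i=0..<n. res p (M $$ (i, \<pi> i)))"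
      unfolding local_ring_mult(2)[OF p sign(1) prod(1)[OF \<pi>]] sign(2) prod(2)[OF \<pi>] ..
  qed
  also have "\<dots> = det (map_mat (res p) M)"
  proof -
    have "(\<Prod>i=0..<n. res p (M $$ (i, \<pi> i))) = (\<Prod>i=0..<n. map_mat (res p) M $$ (i, \<pi> i))"
      if "\<pi> permutes {0..<n}" for \<pi>
      using M permutes_in_image[OF that] by (intro prod.cong) auto
    then show ?thesis using M by (subst det_def'[of _ n]) auto
  qed
  finally show "res p (det M) = det (map_mat (res p) M)" .
qed

end

context curve_bundle
begin

text \<open>Two frames of one stalk are related by mutually inverse matrices over the local ring.
  The determinant of the change is a unit, so the order does not depend on the frame.\<close>

lemma det_ord_eq:
  assumes p: "p \<in> points C" and b: "is_basis V b" and e: "frame_at C V p e" and M: "frame_matrix b e M"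
  shows "det_ord C V b p = ord C p (det M)"
proof -
  have eq: "ord C p (det M') = ord C p (det M)" if e': "frame_at C V p e'" and M': "frame_matrix b e' M'" for e' M'
  proof -
    have be: "is_basis V e" "is_basis V e'" using e e' by (auto simp: frame_at_iff)
    obtain T where T: "frame_matrix e e' T" using frame_matrix_exists[OF be(2)] by blast
    obtain T' where T': "frame_matrix e' e T'" using frame_matrix_exists[OF be(1)] by blast
    obtain N where N: "frame_matrix e b N" using frame_matrix_exists[OF b] by blast
    have lat: "lattice p e = lattice p e'" using e e' by (simp add: frame_at_iff)
    have "T $$ (i, j) \<in> \<O> p" if "i < rk" "j < rk" for i j
      using frame_matrix_local[OF _ T _ that] be lattice_mem[OF p, of _ e] lat by (simp add: is_basis_iff)
    then have "det T \<in> \<O> p" using T by (intro det_local[OF p, of _ rk]) (auto simp: frame_matrix_def)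
    moreover have "T' $$ (i, j) \<in> \<O> p" if "i < rk" "j < rk" for i j
      using frame_matrix_local[OF _ T' _ that] be lattice_mem[OF p, of _ e'] lat by (simp add: is_basis_iff)
    then have "det T' \<in> \<O> p" using T' by (intro det_local[OF p, of _ rk]) (auto simp: frame_matrix_def)
    moreover have TT: "det T' * det T = 1" by (rule frame_matrix_det_inverse[OF be(1) T T'])
    ultimately have u: "unit_at p (det T)"
      unfolding unit_at_def by (metis inverse_unique mult.commute mult_zero_right zero_neq_one)
    have "M' = T * M"
      using frame_matrix_unique[OF _ M' frame_matrix_mult[OF M T]] be by (simp add: is_basis_iff)
    then have "det M' = det T * det M" using T M by (simp add: frame_matrix_def det_mult[of T rk M])
    moreover have "det M \<noteq> 0" using frame_matrix_det_inverse[OF b M N] by auto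
    ultimately show ?thesis using u by (simp add: ord_mult[OF p] ord_unit[OF p] unit_at_def)
  qed
  have "det_ord C V b p = (THE m. \<exists>e M. frame_at C V p e \<and> frame_matrix b e M \<and> m = ord C p (det M))"
    unfolding det_ord_def frame_matrix_def conj_assoc ..
  also have "\<dots> = ord C p (det M)"
    by (rule the_equality) (use e M eq in blast)+
  finally show ?thesis .
qed

lemma finite_form_zeros:
  assumes "gval d G \<noteq> 0"
  shows "finite {q \<in> points C. pval d G (rep q) = 0}"
proof -
  have "finite {q \<in> points C. gval d G / coords C i ^ d \<in> \<mm> q \<and> coords C i \<noteq> 0}" for i
    by (cases "coords C i = 0")
      (use assms in \<open>auto intro: rev_finite_subset[OF finite_zeros[of "gval d G / coords C i ^ d"]]\<close>)
  then have "finite (\<Union>i. {q \<in> points C. gval d G / coords C i ^ d \<in> \<mm> q \<and> coords C i \<noteq> 0})" by auto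
  moreover have "{q \<in> points C. pval d G (rep q) = 0} \<subseteq>
      (\<Union>i. {q \<in> points C. gval d G / coords C i ^ d \<in> \<mm> q \<and> coords C i \<noteq> 0})"
  proof
    fix q assume "q \<in> {q \<in> points C. pval d G (rep q) = 0}"
    then have q: "q \<in> points C" "pval d G (rep q) = 0" by blast+
    obtain i where i: "rep q i \<noteq> 0" using rep(1)[OF q(1)] by blast
    have "gval d G / coords C i ^ d \<in> \<mm> q"
      using form_quotient_local[OF q(1) i, of d G] q(2) by (simp add: max_ideal_iff q(1))
    then show "q \<in> (\<Union>i. {q \<in> points C. gval d G / coords C i ^ d \<in> \<mm> q \<and> coords C i \<noteq> 0})"
      using q(1) coords_nonzero[OF q(1) i] by blast
  qed
  ultimately show ?thesis by (rule rev_finite_subset)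
qed

text \<open>A local frame \<open>b0\<close> serves a whole open set. Outside the zeros of
  \<open>G\<close> and the poles of both matrices relating \<open>b\<close> and \<open>b0\<close>,
  the two frames span the same lattice.\<close>

lemma generic_frame:
  assumes b: "is_basis V b"
  obtains P where "finite P" "P \<subseteq> points C"
    "\<And>q. q \<in> points C \<Longrightarrow> q \<notin> P \<Longrightarrow> stalk V q = lattice q b"
    "\<And>q. q \<in> points C \<Longrightarrow> q \<notin> P \<Longrightarrow> det_ord C V b q = 0"
proof (cases "points C = {}")
  case True
  then show thesis using that[of "{}"] by auto
next
  case False
  then obtain p where p: "p \<in> points C" by blast
  have "\<exists>d G b. (\<forall>z\<in>p. pval d G z \<noteq> 0) \<and>
      (\<forall>q\<in>points C. (\<forall>z\<in>q. pval d G z \<noteq> 0) \<longrightarrow> frame_at C V q b)"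
    using is_bundle p unfolding vector_bundle_def by (elim conjE) (rule bspec)
  then obtain d G b0 where G: "\<forall>z\<in>p. pval d G z \<noteq> 0"
    and fr: "\<forall>q\<in>points C. (\<forall>z\<in>q. pval d G z \<noteq> 0) \<longrightarrow> frame_at C V q b0"
    by (elim exE conjE)
  have b0: "is_basis V b0" using fr p G by (simp add: frame_at_iff)
  obtain M where M: "frame_matrix b b0 M" using frame_matrix_exists[OF b0] by blast
  obtain N where N: "frame_matrix b0 b N" using frame_matrix_exists[OF b] by blast
  have G0: "gval d G \<noteq> 0" using G pval_point_iff(2)[OF p] gval_nonzero[OF p] by blast
  define P where "P = {q \<in> points C. pval d G (rep q) = 0} \<union>
    (\<Union>i<rk. \<Union>j<rk. {q \<in> points C. M $$ (i, j) \<notin> \<O> q} \<union> {q \<in> points C. N $$ (i, j) \<notin> \<O> q})"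
  have "finite P" unfolding P_def by (intro finite_UnI finite_UN_I finite_form_zeros[OF G0] finite_poles) auto
  moreover have "P \<subseteq> points C" by (auto simp: P_def)
  moreover have "stalk V q = lattice q b \<and> det_ord C V b q = 0" if q: "q \<in> points C" "q \<notin> P" for q
  proof
    have "pval d G (rep q) \<noteq> 0" using q by (auto simp: P_def)
    then have fq: "frame_at C V q b0" using fr q(1) pval_point_iff(2)[OF q(1), of d G] by blast
    have loc: "M $$ (i, j) \<in> \<O> q" "N $$ (i, j) \<in> \<O> q" if "i < rk" "j < rk" for i j
      using q that by (auto simp: P_def)
    have "b j \<in> lattice q b0" if "j < rk" for j
      using M that loc by (auto simp: frame_matrix_def intro!: latticeI)
    moreover have "b0 j \<in> lattice q b" if "j < rk" for j
      using N that loc by (auto simp: frame_matrix_def intro!: latticeI)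
    ultimately have "lattice q b = lattice q b0" by (intro equalityI lattice_subset q(1))
    then show "stalk V q = lattice q b" using fq by (simp add: frame_at_iff)
    have "det N * det M = 1" by (rule frame_matrix_det_inverse[OF b M N])
    moreover have "det M \<in> \<O> q" "det N \<in> \<O> q"
      using M N loc by (auto intro!: det_local[OF q(1), of _ rk] simp: frame_matrix_def)
    ultimately have "unit_at q (det M)"
      unfolding unit_at_def by (metis inverse_unique mult.commute mult_zero_right zero_neq_one)
    then show "det_ord C V b q = 0" using det_ord_eq[OF q(1) b fq M] ord_unit[OF q(1)] by simp
  qed
  ultimately show thesis using that by blast
qed

text \<open>The elementary modification used in the induction below: \<open>\<lambda>\<close> is a linear form on the fibre with
  \<open>\<lambda>\<^sub>l = 1\<close>, and the new frame spans the sections whose value at \<open>p\<close> is annihilated by \<open>\<lambda>\<close>.\<close>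

definition modified :: "'K \<Rightarrow> nat \<Rightarrow> (nat \<Rightarrow> 'K) \<Rightarrow> (nat \<Rightarrow> 'e) \<Rightarrow> nat \<Rightarrow> 'e"
  where "modified t l lam e i = (if i = l then t \<cdot> e l else e i - lam i \<cdot> e l)"

text \<open>Coordinates in the modified frame and in the old one differ at index \<open>l\<close>
  alone.\<close>

lemma modified_sum:
  assumes l: "l < rk" and lam: "lam l = 1"
  shows "(\<Sum>i<rk. c i \<cdot> modified t l lam e i) =
    (\<Sum>i<rk. (if i = l then c l * t - (\<Sum>j\<in>{..<rk} - {l}. lam j * c j) else c i) \<cdot> e i)"
proof -
  have "(\<Sum>i<rk. c i \<cdot> modified t l lam e i) =
      c l \<cdot> t \<cdot> e l + (\<Sum>i\<in>{..<rk} - {l}. c i \<cdot> modified t l lam e i)"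
    using l by (subst sum.remove[of _ l]) (auto simp: modified_def)
  also have "(\<Sum>i\<in>{..<rk} - {l}. c i \<cdot> modified t l lam e i) =
      (\<Sum>i\<in>{..<rk} - {l}. c i \<cdot> e i - (lam i * c i) \<cdot> e l)"
    by (rule sum.cong) (auto simp: modified_def E.scale_right_diff_distrib mult.commute)
  also have "\<dots> = (\<Sum>i\<in>{..<rk} - {l}. c i \<cdot> e i) - (\<Sum>j\<in>{..<rk} - {l}. lam j * c j) \<cdot> e l"
    by (simp add: sum_subtractf E.scale_sum_left)
  also have "c l \<cdot> t \<cdot> e l + ((\<Sum>i\<in>{..<rk} - {l}. c i \<cdot> e i) - (\<Sum>j\<in>{..<rk} - {l}. lam j * c j) \<cdot> e l)
    = (c l * t - (\<Sum>j\<in>{..<rk} - {l}. lam j * c j)) \<cdot> e l + (\<Sum>i\<in>{..<rk} - {l}. c i \<cdot> e i)"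
    by (simp add: E.scale_left_diff_distrib)
  also have "\<dots> = (\<Sum>i<rk. (if i = l then c l * t - (\<Sum>j\<in>{..<rk} - {l}. lam j * c j) else c i) \<cdot> e i)"
    using l by (subst (3) sum.remove[of _ l]) (auto intro!: sum.cong)
  finally show ?thesis .
qed

text \<open>The colength of the lattice of \<open>w\<close> in that of \<open>e\<close> is at least
  the order of \<open>det M\<close>. Each induction step inserts between them the kernel of a linear
  form on the fibre, which has colength one in \<open>lattice p e\<close>; relative to it the
  determinant has order one less.\<close>

lemma lattice_index:
  assumes p: "p \<in> points C"
  shows "indep e \<Longrightarrow> frame_matrix w e M \<Longrightarrow> (\<And>i j. i < rk \<Longrightarrow> j < rk \<Longrightarrow> M $$ (i, j) \<in> \<O> p) \<Longrightarrow>
    det M \<noteq> 0 \<Longrightarrow> ord C p (det M) = int a \<Longrightarrow>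
    \<exists>\<nu>. (\<forall>k<a. \<nu> k \<in> lattice p e) \<and>
      (\<forall>c. (\<Sum>k<a. h (c k) \<cdot> \<nu> k) \<in> lattice p w \<longrightarrow> (\<forall>k<a. c k = 0))"
proof (induction a arbitrary: e M)
  case 0
  then show ?case by simp
next
  case (Suc a)
  note indep = Suc.prems(1) and M = Suc.prems(2) and loc = Suc.prems(3)
  have Mc: "M \<in> carrier_mat rk rk" using M by (simp add: frame_matrix_def)
  have "det M \<in> \<mm> p" using Suc.prems(4,5) by (simp add: max_ideal_iff_ord p)
  then have "det (map_mat (res p) M) = 0"
    using det_local(2)[OF p Mc loc] by (simp add: max_ideal_iff p)
  then have "det (transpose_mat (map_mat (res p) M)) = 0" using Mc by (subst det_transpose) auto
  \<comment> \<open>A determinant vanishing at \<open>p\<close> yields a linear form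
    \<open>v\<close> on the fibre that kills the values of all the \<open>w j\<close>.\<close>
  then obtain v where v: "v \<in> carrier_vec rk" "v \<noteq> 0\<^sub>v rk" "transpose_mat (map_mat (res p) M) *\<^sub>v v = 0\<^sub>v rk"
    using det_0_iff_vec_prod_zero_field[of "transpose_mat (map_mat (res p) M)" rk] Mc by auto
  define S where "S = {i. i < rk \<and> v $ i \<noteq> 0}"
  have "S \<noteq> {}" using v(1,2) by (auto simp: S_def intro!: eq_vecI)
  moreover have "finite S" by (simp add: S_def)
  ultimately have "Max S \<in> S" "\<And>i. i \<in> S \<Longrightarrow> i \<le> Max S" by auto
  \<comment> \<open>Taking the last nonzero entry makes the matrix \<open>L\<close> below lower
    triangular, with determinant \<open>1 / \<pi>\<close>.\<close>
  then obtain l where l: "l < rk" "v $ l \<noteq> 0" "\<And>i. i < rk \<Longrightarrow> l < i \<Longrightarrow> v $ i = 0"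
    unfolding S_def by (metis (mono_tags, lifting) mem_Collect_eq not_less)
  define lam where "lam i = h (v $ i / v $ l)" for i
  define \<pi> where "\<pi> = unif p"
  have \<pi>: "\<pi> \<noteq> 0" "\<pi> \<in> \<mm> p" "\<pi> \<in> \<O> p" using unif[OF p] by (auto simp: \<pi>_def)
  have lam1: "lam l = 1" using l by (simp add: lam_def)
  have lamO: "lam i \<in> \<O> p" for i unfolding lam_def by (rule local_ring_const[OF p])
  have ann: "(\<Sum>i<rk. lam i * M $$ (i, j)) \<in> \<mm> p" if j: "j < rk" for j
  proof -
    have "(\<Sum>i<rk. res p (M $$ (i, j)) * v $ i) = (transpose_mat (map_mat (res p) M) *\<^sub>v v) $ j"
      using Mc v(1) j by (simp add: scalar_prod_def atLeast0LessThan)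
    also have "\<dots> = 0" using v(3) j by simp
    finally have 0: "(\<Sum>i<rk. res p (M $$ (i, j)) * v $ i) = 0" .
    have O: "lam i * M $$ (i, j) \<in> \<O> p" if "i < rk" for i by (rule local_ring_mult(1)[OF p lamO loc[OF that j]])
    have "res p (lam i * M $$ (i, j)) = v $ i / v $ l * res p (M $$ (i, j))" if "i < rk" for i
      unfolding local_ring_mult(2)[OF p lamO loc[OF that j]] by (simp add: lam_def local_ring_const(2)[OF p])
    then have "res p (\<Sum>i<rk. lam i * M $$ (i, j)) = (\<Sum>i<rk. v $ i / v $ l * res p (M $$ (i, j)))"
      using O by (subst local_ring_sum(2)[OF p]) auto
    also have "\<dots> = (\<Sum>i<rk. res p (M $$ (i, j)) * v $ i) / v $ l"
      by (simp add: sum_divide_distrib mult.commute)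
    finally have "res p (\<Sum>i<rk. lam i * M $$ (i, j)) = 0" using 0 by simp
    moreover have "(\<Sum>i<rk. lam i * M $$ (i, j)) \<in> \<O> p" using O by (intro local_ring_sum p) auto
    ultimately show ?thesis by (simp add: max_ideal_iff p)
  qed
  define L where "L = mat rk rk (\<lambda>(i, j). if i = l then lam j / \<pi> else if i = j then 1 else 0)"
  have Lc: "L \<in> carrier_mat rk rk" by (simp add: L_def)
  have "det L = prod_list (diag_mat L)"
    by (rule det_lower_triangular[OF _ Lc]) (auto simp: L_def lam_def l)
  also have "\<dots> = (\<Prod>i<rk. if i = l then 1 / \<pi> else 1)"
    unfolding prod_list_diag_prod using lam1 by (intro prod.cong) (auto simp: L_def atLeast0LessThan)
  also have "\<dots> = 1 / \<pi>" using l(1) by (simp add: prod.delta)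
  finally have detL: "det L = 1 / \<pi>" .
  define M' where "M' = L * M"
  have M'c: "M' \<in> carrier_mat rk rk" using Lc Mc by (simp add: M'_def)
  have M'_entry: "M' $$ (i, j) = (if i = l then (\<Sum>s<rk. lam s * M $$ (s, j)) / \<pi> else M $$ (i, j))"
    if ij: "i < rk" "j < rk" for i j
  proof -
    have "M' $$ (i, j) = (\<Sum>s<rk. L $$ (i, s) * M $$ (s, j))"
      using Lc Mc ij by (simp add: M'_def scalar_prod_def atLeast0LessThan)
    also have "\<dots> = (\<Sum>s<rk. if i = l then lam s * M $$ (s, j) / \<pi> else if s = i then M $$ (s, j) else 0)"
      using ij by (intro sum.cong) (auto simp: L_def)
    also have "\<dots> = (if i = l then (\<Sum>s<rk. lam s * M $$ (s, j)) / \<pi> else M $$ (i, j))"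
      using ij by (simp add: sum_divide_distrib sum.delta)
    finally show ?thesis .
  qed
  define e' where "e' = modified \<pi> l lam e"
  note sum_e' = modified_sum[where lam = lam and l = l and t = \<pi> and e = e, OF l(1) lam1, folded e'_def]
  have M': "frame_matrix w e' M'"
    unfolding frame_matrix_def
  proof (intro conjI M'c allI impI)
    fix j assume j: "j < rk"
    have "M' $$ (l, j) * \<pi> - (\<Sum>i\<in>{..<rk} - {l}. lam i * M' $$ (i, j)) = M $$ (l, j)"
    proof -
      have "M' $$ (l, j) * \<pi> = (\<Sum>s<rk. lam s * M $$ (s, j))" using \<pi>(1) l j by (simp add: M'_entry)
      also have "\<dots> = M $$ (l, j) + (\<Sum>s\<in>{..<rk} - {l}. lam s * M $$ (s, j))"
        using l lam1 by (subst sum.remove[of _ l]) auto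
      also have "(\<Sum>s\<in>{..<rk} - {l}. lam s * M $$ (s, j)) = (\<Sum>s\<in>{..<rk} - {l}. lam s * M' $$ (s, j))"
        using j by (intro sum.cong) (auto simp: M'_entry)
      finally show ?thesis by simp
    qed
    then have "(\<Sum>i<rk. M' $$ (i, j) \<cdot> e' i) = (\<Sum>i<rk. M $$ (i, j) \<cdot> e i)"
      unfolding sum_e' using j l by (intro sum.cong) (auto simp: M'_entry)
    then show "w j = (\<Sum>i<rk. M' $$ (i, j) \<cdot> e' i)" using M j by (simp add: frame_matrix_def)
  qed
  have indep': "indep e'" unfolding indep_def
  proof (intro allI impI)
    fix c i assume c: "(\<Sum>i<rk. c i \<cdot> e' i) = 0" and i: "i < rk"
    have d: "(if i = l then c l * \<pi> - (\<Sum>j\<in>{..<rk} - {l}. lam j * c j) else c i) = 0" if "i < rk" for i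
      by (rule indepD[OF indep c[unfolded sum_e'] that])
    then have cj: "c j = 0" if "j < rk" "j \<noteq> l" for j using that by (metis (full_types))
    then have "c l * \<pi> = 0" using d[OF l(1)] by simp
    then show "c i = 0" using cj i \<pi>(1) by (cases "i = l") auto
  qed
  have loc': "M' $$ (i, j) \<in> \<O> p" if ij: "i < rk" "j < rk" for i j
  proof -
    obtain a where "a \<in> \<O> p" "(\<Sum>s<rk. lam s * M $$ (s, j)) = \<pi> * a"
      using ann[OF ij(2)] unfolding unif(2)[OF p] \<pi>_def by blast
    then show ?thesis using loc ij \<pi>(1) by (auto simp: M'_entry)
  qed
  have det': "det M' = 1 / \<pi> * det M" unfolding M'_def det_mult[OF Lc Mc] detL ..
  then have det'0: "det M' \<noteq> 0" using Suc.prems(4) \<pi>(1) by simp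
  have "ord C p (det M') = int a"
    using Suc.prems(4,5) \<pi>(1) ord_unif_powi[OF p, of 1]
    unfolding det' by (simp add: ord_mult ord_inverse p divide_inverse \<pi>_def)
  from Suc.IH[OF indep' M' loc' det'0 this] obtain \<nu> where \<nu>: "\<And>k. k < a \<Longrightarrow> \<nu> k \<in> lattice p e'"
    "\<And>c. (\<Sum>k<a. h (c k) \<cdot> \<nu> k) \<in> lattice p w \<Longrightarrow> \<forall>k<a. c k = 0" by blast
  have e'e: "lattice p e' \<subseteq> lattice p e"
    unfolding e'_def modified_def using lattice_mem[OF p, of _ e] l(1)
    by (intro lattice_subset[OF p]) (auto intro!: lattice_diff lattice_smul p \<pi> lamO)
  have we': "lattice p w \<subseteq> lattice p e'"
    using M' loc' by (intro lattice_subset[OF p]) (auto simp: frame_matrix_def intro!: latticeI)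
  \<comment> \<open>The linear form takes the value 1 on \<open>e l\<close>, so no nonzero constant
    multiple of \<open>e l\<close> lies in the smaller lattice.\<close>
  define \<nu>' where "\<nu>' = \<nu>(a := e l)"
  have "\<nu>' k \<in> lattice p e" if "k < Suc a" for k
    using that \<nu>(1) e'e lattice_mem[OF p l(1), of e] by (auto simp: \<nu>'_def less_Suc_eq)
  moreover have "\<forall>k<Suc a. c k = 0" if c: "(\<Sum>k<Suc a. h (c k) \<cdot> \<nu>' k) \<in> lattice p w" for c
  proof -
    have eq: "(\<Sum>k<Suc a. h (c k) \<cdot> \<nu>' k) = (\<Sum>k<a. h (c k) \<cdot> \<nu> k) + h (c a) \<cdot> e l"
      by (simp add: \<nu>'_def)
    have "(\<Sum>k<a. h (c k) \<cdot> \<nu> k) \<in> lattice p e'"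
      using \<nu>(1) by (auto intro!: lattice_sum lattice_smul local_ring_const p)
    then have "(\<Sum>k<Suc a. h (c k) \<cdot> \<nu>' k) - (\<Sum>k<a. h (c k) \<cdot> \<nu> k) \<in> lattice p e'"
      using c we' by (intro lattice_diff p) auto
    then have "h (c a) \<cdot> e l \<in> lattice p e'" unfolding eq by simp
    then obtain f where f: "\<And>i. i < rk \<Longrightarrow> f i \<in> \<O> p" "h (c a) \<cdot> e l = (\<Sum>i<rk. f i \<cdot> e' i)"
      by (rule latticeE) blast
    have "(\<Sum>i<rk. (if i = l then h (c a) else 0) \<cdot> e i) = (\<Sum>i<rk. if i = l then h (c a) \<cdot> e l else 0)"
      by (rule sum.cong) auto
    then have "(\<Sum>i<rk. (if i = l then h (c a) else 0) \<cdot> e i) = h (c a) \<cdot> e l"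
      using l(1) by (simp add: sum.delta)
    then have d: "(if i = l then h (c a) else 0) =
        (if i = l then f l * \<pi> - (\<Sum>j\<in>{..<rk} - {l}. lam j * f j) else f i)" if "i < rk" for i
      using indep_eq[OF indep _ that, of "\<lambda>i. if i = l then h (c a) else 0"
          "\<lambda>i. if i = l then f l * \<pi> - (\<Sum>j\<in>{..<rk} - {l}. lam j * f j) else f i"]
        f(2) unfolding sum_e' by simp
    have "f j = 0" if "j < rk" "j \<noteq> l" for j using d[OF that(1)] that(2) by simp
    then have "h (c a) = f l * \<pi>" using d[OF l(1)] by simp
    also have "\<dots> \<in> \<mm> p" by (rule max_ideal_mult[OF p f(1)[OF l(1)] \<pi>(2)])
    finally have ca: "c a = 0" using local_ring_const(2)[OF p, of "c a"] by (simp add: max_ideal_iff p)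
    then have "(\<Sum>k<a. h (c k) \<cdot> \<nu> k) \<in> lattice p w" using c unfolding eq by simp
    then show ?thesis using \<nu>(2) ca by (auto simp: less_Suc_eq)
  qed
  ultimately show ?case by blast
qed

end

section \<open>Vanishing of the first cohomology\<close>

lemma sum_Sigma_fibre:
  fixes F :: "'a \<times> 'b \<Rightarrow> 'c::comm_monoid_add"
  assumes "finite P" "\<And>p. p \<in> P \<Longrightarrow> finite (B p)"
  shows "(\<Sum>x\<in>Sigma P B. if q = fst x then F x else 0) = (if q \<in> P then \<Sum>y\<in>B q. F (q, y) else 0)"
proof -
  have "(\<Sum>x\<in>Sigma P B. if q = fst x then F x else 0)
      = (\<Sum>p\<in>P. \<Sum>y\<in>B p. if q = p then F (p, y) else 0)"
    using assms by (subst sum.Sigma) (auto intro!: sum.cong)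
  also have "\<dots> = (\<Sum>p\<in>P. if p = q then \<Sum>y\<in>B q. F (q, y) else 0)"
    by (rule sum.cong) auto
  finally show ?thesis using assms(1) by (simp add: sum.delta)
qed

context smooth_curve
begin

lemma unif_expansion:
  assumes p: "p \<in> points C" and f: "f \<in> \<O> p"
  shows "\<exists>a f'. f' \<in> \<O> p \<and> f = (\<Sum>k<N. h (a k) * unif p ^ k) + unif p ^ N * f'"
proof (induction N)
  case 0
  show ?case using f by (intro exI[of _ "\<lambda>_. 0"] exI[of _ f]) simp
next
  case (Suc N)
  then obtain a f' where IH: "f' \<in> \<O> p" "f = (\<Sum>k<N. h (a k) * unif p ^ k) + unif p ^ N * f'" by blast
  have "f' - h (res p f') \<in> \<mm> p"
    using IH(1) by (simp add: max_ideal_iff p local_ring_diff local_ring_const)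
  then obtain f'' where f'': "f'' \<in> \<O> p" "f' - h (res p f') = unif p * f''" unfolding unif(2)[OF p] by blast
  have f': "f' = h (res p f') + unif p * f''" using f''(2) by (simp add: diff_eq_eq add.commute)
  have "f = (\<Sum>k<N. h (a k) * unif p ^ k) + unif p ^ N * (h (res p f') + unif p * f'')"
    unfolding f'[symmetric] by (rule IH(2))
  also have "\<dots> = (\<Sum>k<Suc N. h ((a(N := res p f')) k) * unif p ^ k) + unif p ^ Suc N * f''"
    by (simp add: algebra_simps)
  finally show ?case using f''(1) by blast
qed

end

context curve_bundle
begin

lemma frame_exists:
  assumes "p \<in> points C" obtains e where "frame_at C V p e"
proof -
  have "\<exists>d G b. (\<forall>z\<in>p. pval d G z \<noteq> 0) \<and>
      (\<forall>q\<in>points C. (\<forall>z\<in>q. pval d G z \<noteq> 0) \<longrightarrow> frame_at C V q b)"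
    using is_bundle assms unfolding vector_bundle_def by (elim conjE) (rule bspec)
  then show thesis using assms that by blast
qed

lemma stalk_add: "p \<in> points C \<Longrightarrow> v \<in> stalk V p \<Longrightarrow> w \<in> stalk V p \<Longrightarrow> v + w \<in> stalk V p"
  by (rule frame_exists[of p]) (auto simp: frame_at_iff lattice_add)

lemma stalk_smul: "p \<in> points C \<Longrightarrow> a \<in> \<O> p \<Longrightarrow> v \<in> stalk V p \<Longrightarrow> a \<cdot> v \<in> stalk V p"
  by (rule frame_exists[of p]) (auto simp: frame_at_iff lattice_smul)

lemma stalk_0: "p \<in> points C \<Longrightarrow> 0 \<in> stalk V p"
  by (rule frame_exists[of p]) (auto simp: frame_at_iff lattice_0)

lemma stalk_diff: "p \<in> points C \<Longrightarrow> v \<in> stalk V p \<Longrightarrow> w \<in> stalk V p \<Longrightarrow> v - w \<in> stalk V p"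
  by (rule frame_exists[of p]) (auto simp: frame_at_iff lattice_diff)

lemma stalk_sum:
  "p \<in> points C \<Longrightarrow> (\<And>s. s \<in> S \<Longrightarrow> f s \<in> stalk V p) \<Longrightarrow> sum f S \<in> stalk V p"
  by (induction S rule: infinite_finite_induct) (auto simp: stalk_0 stalk_add)

text \<open>A power of the uniformiser moves the rational frame into the stalk. It multiplies the
  determinant by \<open>(unif p ^ N) ^ rk\<close>, which accounts for the summand
  \<open>rk * N\<close>.\<close>

lemma stalk_colength:
  assumes p: "p \<in> points C" and b: "is_basis V b"
  shows "\<exists>N a \<nu>. int a = int rk * int N + det_ord C V b p \<and>
    lattice p (\<lambda>i. unif p ^ N \<cdot> b i) \<subseteq> stalk V p \<and> (\<forall>k<a. \<nu> k \<in> stalk V p) \<and>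
    (\<forall>c. (\<Sum>k<a. h (c k) \<cdot> \<nu> k) \<in> lattice p (\<lambda>i. unif p ^ N \<cdot> b i) \<longrightarrow> (\<forall>k<a. c k = 0))"
proof -
  obtain e where e: "frame_at C V p e" using frame_exists[OF p] .
  then have be: "is_basis V e" and st: "stalk V p = lattice p e" by (auto simp: frame_at_iff)
  obtain M where M: "frame_matrix b e M" using frame_matrix_exists[OF be] by blast
  obtain N' where N': "frame_matrix e b N'" using frame_matrix_exists[OF b] by blast
  have Mc: "M \<in> carrier_mat rk rk" using M by (simp add: frame_matrix_def)
  \<comment> \<open>Large enough to clear the poles of all entries of \<open>M\<close>, and positive
    as \<open>max_ideal_power_mult\<close> demands.\<close>
  define N where "N = Suc (\<Sum>i<rk. \<Sum>j<rk. nat (- ord C p (M $$ (i, j))))"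
  have N: "nat (- ord C p (M $$ (i, j))) \<le> N" if "i < rk" "j < rk" for i j
  proof -
    have "nat (- ord C p (M $$ (i, j))) \<le> (\<Sum>j<rk. nat (- ord C p (M $$ (i, j))))"
      using that by (intro member_le_sum) auto
    also have "\<dots> \<le> (\<Sum>i<rk. \<Sum>j<rk. nat (- ord C p (M $$ (i, j))))"
      using that by (intro member_le_sum[where f = "\<lambda>i. \<Sum>j<rk. nat (- ord C p (M $$ (i, j)))"]) auto
    finally show ?thesis by (simp add: N_def)
  qed
  define w where "w i = unif p ^ N \<cdot> b i" for i
  define M' where "M' = unif p ^ N \<cdot>\<^sub>m M"
  have M': "frame_matrix w e M'"
    using M Mc by (auto simp: frame_matrix_def w_def M'_def E.scale_sum_right)
  have loc: "M' $$ (i, j) \<in> \<O> p" if "i < rk" "j < rk" for i j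
    using max_ideal_power_mult[OF p unif(3)[OF p] N[OF that]] that Mc by (simp add: M'_def N_def)
  have M0: "det M \<noteq> 0" using frame_matrix_det_inverse[OF b M N'] by auto
  have det: "det M' = (unif p ^ N) ^ rk * det M" using Mc by (simp add: M'_def)
  then have det0: "det M' \<noteq> 0" using M0 unif(1)[OF p] by simp
  have "ord C p (det M') = int rk * int N + ord C p (det M)"
    using M0 unif(1)[OF p] ord_unif_powi[OF p, of 1] unfolding det by (simp add: ord_mult ord_power p)
  then have ord: "ord C p (det M') = int rk * int N + det_ord C V b p" using det_ord_eq[OF p b e M] by simp
  have "det M' \<in> \<O> p" using M' loc by (intro det_local[OF p, of _ rk]) (auto simp: frame_matrix_def)
  then have "ord C p (det M') \<ge> 0" using det0 by (simp add: local_ring_iff_ord p)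
  then have a: "ord C p (det M') = int (nat (ord C p (det M')))" by simp
  have "indep e" using be by (simp add: is_basis_iff)
  from lattice_index[OF p this M' loc det0 a] obtain \<nu> where
    "\<forall>k<nat (ord C p (det M')). \<nu> k \<in> lattice p e"
    "\<forall>c. (\<Sum>k<nat (ord C p (det M')). h (c k) \<cdot> \<nu> k) \<in> lattice p w \<longrightarrow> (\<forall>k<nat (ord C p (det M')). c k = 0)"
    by blast
  moreover have "lattice p w \<subseteq> lattice p e"
    using M' loc by (intro lattice_subset[OF p]) (auto simp: frame_matrix_def intro!: latticeI)
  ultimately show ?thesis
    using a ord st unfolding w_def
    by (intro exI[of _ N] exI[of _ "nat (ord C p (det M'))"] exI[of _ \<nu>]) simp
qed

lemma vector_space_fun: "vector_space (\<lambda>c (y :: 'b \<Rightarrow> 'e) p. h c \<cdot> y p)"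
  by unfold_locales (auto simp: hom_distribs E.scale_right_distrib E.scale_left_distrib fun_eq_iff)

lemma lattice_expansion:
  assumes p: "p \<in> points C" and y: "y \<in> lattice p b"
  shows "\<exists>a. y - (\<Sum>x\<in>{..<rk} \<times> {..<N}. h (a x) \<cdot> unif p ^ snd x \<cdot> b (fst x))
    \<in> lattice p (\<lambda>i. unif p ^ N \<cdot> b i)"
proof -
  obtain f where f: "\<And>i. i < rk \<Longrightarrow> f i \<in> \<O> p" "y = (\<Sum>i<rk. f i \<cdot> b i)" by (rule latticeE[OF y]) blast
  have "\<forall>i. \<exists>a f'. i < rk \<longrightarrow> f' \<in> \<O> p \<and> f i = (\<Sum>k<N. h (a k) * unif p ^ k) + unif p ^ N * f'"
    using unif_expansion[OF p f(1)] by blast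
  then obtain a f' where a: "\<And>i. i < rk \<Longrightarrow> f' i \<in> \<O> p"
    "\<And>i. i < rk \<Longrightarrow> f i = (\<Sum>k<N. h (a i k) * unif p ^ k) + unif p ^ N * f' i"
    unfolding choice_iff by blast
  have "y = (\<Sum>i<rk. (\<Sum>k<N. h (a i k) \<cdot> unif p ^ k \<cdot> b i) + f' i \<cdot> unif p ^ N \<cdot> b i)"
    unfolding f(2) by (rule sum.cong) (auto simp: a(2) E.scale_left_distrib E.scale_sum_left mult.commute)
  then have "y - (\<Sum>x\<in>{..<rk} \<times> {..<N}. h (a (fst x) (snd x)) \<cdot> unif p ^ snd x \<cdot> b (fst x))
      = (\<Sum>i<rk. f' i \<cdot> unif p ^ N \<cdot> b i)"
    by (simp add: sum.distrib sum.cartesian_product split_def)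
  also have "\<dots> \<in> lattice p (\<lambda>i. unif p ^ N \<cdot> b i)" by (intro latticeI a)
  finally show ?thesis by (intro exI[of _ "\<lambda>x. a (fst x) (snd x)"])
qed

text \<open>With \<open>W \<subseteq> V\<close> a small lattice contained in \<open>\<O> b\<^sub>0 \<oplus> \<dots> \<oplus> \<O> b\<^sub>r\<^sub>-\<^sub>1\<close>, a single linear dependence is
  extracted from the adele \<open>x\<close>, representatives of \<open>V / W\<close> and the constants \<open>b\<^sub>j\<close>. The constants are
  what turns the lower bound \<open>h\<^sup>0(\<O>) \<ge> 1\<close> into the missing \<open>r\<close> in the dimension count.\<close>

lemma adelic_vanishing:
  assumes H0: "H0 C V = {0}" and deg: "degree_of C V = int rk * (int (genus C) - 1)"
    and x: "finite {p \<in> points C. x p \<notin> stalk V p}"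
  shows "\<exists>f. \<forall>p\<in>points C. x p - f \<in> stalk V p"
proof (cases "points C = {}")
  case False
  then obtain p0 where "p0 \<in> points C" by blast
  then have "\<exists>b. is_basis V b" using frame_exists[of p0] by (auto simp: frame_at_iff)
  define b where "b = (SOME b. is_basis V b)"
  have b: "is_basis V b" unfolding b_def using \<open>\<exists>b. is_basis V b\<close> by (rule someI_ex)
  obtain P where P: "finite P" "P \<subseteq> points C"
    and P1: "\<And>q. q \<in> points C \<Longrightarrow> q \<notin> P \<Longrightarrow> stalk V q = lattice q b"
    and P2: "\<And>q. q \<in> points C \<Longrightarrow> q \<notin> P \<Longrightarrow> det_ord C V b q = 0"
    by (rule generic_frame[OF b]) blast
  have degP: "(\<Sum>p\<in>P. det_ord C V b p) = int rk * (int (genus C) - 1)"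
  proof -
    have "degree_of C V = (\<Sum>p | p \<in> points C \<and> det_ord C V b p \<noteq> 0. det_ord C V b p)"
      by (simp add: degree_of_def b_def Let_def)
    also have "\<dots> = (\<Sum>p\<in>P. det_ord C V b p)"
      using P P2 by (intro sum.mono_neutral_left) auto
    finally show ?thesis using deg by simp
  qed
  have "\<forall>p\<in>P. \<exists>N a \<nu>. int a = int rk * int N + det_ord C V b p \<and>
      lattice p (\<lambda>i. unif p ^ N \<cdot> b i) \<subseteq> stalk V p \<and> (\<forall>k<a. \<nu> k \<in> stalk V p) \<and>
      (\<forall>c. (\<Sum>k<a. h (c k) \<cdot> \<nu> k) \<in> lattice p (\<lambda>i. unif p ^ N \<cdot> b i) \<longrightarrow> (\<forall>k<a. c k = 0))"
    using stalk_colength[OF _ b] P(2) by blast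
  from bchoice[OF this] obtain N where "\<forall>p\<in>P. \<exists>a \<nu>. int a = int rk * int (N p) + det_ord C V b p \<and>
      lattice p (\<lambda>i. unif p ^ N p \<cdot> b i) \<subseteq> stalk V p \<and> (\<forall>k<a. \<nu> k \<in> stalk V p) \<and>
      (\<forall>c. (\<Sum>k<a. h (c k) \<cdot> \<nu> k) \<in> lattice p (\<lambda>i. unif p ^ N p \<cdot> b i) \<longrightarrow> (\<forall>k<a. c k = 0))" ..
  from bchoice[OF this] obtain a where "\<forall>p\<in>P. \<exists>\<nu>. int (a p) = int rk * int (N p) + det_ord C V b p \<and>
      lattice p (\<lambda>i. unif p ^ N p \<cdot> b i) \<subseteq> stalk V p \<and> (\<forall>k<a p. \<nu> k \<in> stalk V p) \<and>
      (\<forall>c. (\<Sum>k<a p. h (c k) \<cdot> \<nu> k) \<in> lattice p (\<lambda>i. unif p ^ N p \<cdot> b i) \<longrightarrow> (\<forall>k<a p. c k = 0))" ..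
  from bchoice[OF this] obtain \<nu> where "\<forall>p\<in>P. int (a p) = int rk * int (N p) + det_ord C V b p \<and>
      lattice p (\<lambda>i. unif p ^ N p \<cdot> b i) \<subseteq> stalk V p \<and> (\<forall>k<a p. \<nu> p k \<in> stalk V p) \<and>
      (\<forall>c. (\<Sum>k<a p. h (c k) \<cdot> \<nu> p k) \<in> lattice p (\<lambda>i. unif p ^ N p \<cdot> b i) \<longrightarrow> (\<forall>k<a p. c k = 0))" ..
  then have a: "\<And>p. p \<in> P \<Longrightarrow> int (a p) = int rk * int (N p) + det_ord C V b p"
    and sub: "\<And>p. p \<in> P \<Longrightarrow> lattice p (\<lambda>i. unif p ^ N p \<cdot> b i) \<subseteq> stalk V p"
    and \<nu>: "\<And>p k. p \<in> P \<Longrightarrow> k < a p \<Longrightarrow> \<nu> p k \<in> stalk V p"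
    and \<nu>_indep: "\<And>p c k. p \<in> P \<Longrightarrow> (\<Sum>k<a p. h (c k) \<cdot> \<nu> p k) \<in> lattice p (\<lambda>i. unif p ^ N p \<cdot> b i)
      \<Longrightarrow> k < a p \<Longrightarrow> c k = 0" by blast+
  define W where "W p = (if p \<in> P then lattice p (\<lambda>i. unif p ^ N p \<cdot> b i) else lattice p b)" for p
  have W_stalk: "w \<in> stalk V p" if "p \<in> points C" "w \<in> W p" for w p
    using that sub P1 by (cases "p \<in> P") (auto simp: W_def)
  obtain \<eta> where \<eta>: "\<And>r. finite {p \<in> points C. r p \<notin> \<O> p} \<Longrightarrow>
      \<exists>c f. \<forall>p\<in>points C. r p - (\<Sum>i<genus C. h (c i) * \<eta> i p) - f \<in> \<O> p"
    using genus_spanning by blast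
  \<comment> \<open>\<open>T1\<close> indexes generators of \<open>H^1\<close> of the trivial bundle
    with basis \<open>b\<close>, \<open>T2\<close> the local expansion coefficients that span the
    trivial lattice modulo \<open>W\<close>, and \<open>I1\<close> independent classes of
    \<open>V\<close> modulo \<open>W\<close>.\<close>
  define T1 where "T1 = {..<rk} \<times> {..<genus C}"
  define T2 where "T2 = Sigma P (\<lambda>p. {..<rk} \<times> {..<N p})"
  define I1 where "I1 = Sigma P (\<lambda>p. {..<a p})"
  define u1 where "u1 ij p = \<eta> (snd ij) p \<cdot> b (fst ij)" for ij :: "nat \<times> nat" and p
  define u2 where "u2 y q = (if q = fst y then unif q ^ snd (snd y) \<cdot> b (fst (snd y)) else 0)"
    for y :: "('k, 'i) point \<times> nat \<times> nat" and q
  define v where "v y q = (if q = fst y then \<nu> q (snd y) else 0)" for y :: "('k, 'i) point \<times> nat" and q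
  have fin: "finite T1" "finite T2" "finite I1" using P(1) by (auto simp: T1_def T2_def I1_def)
  have span2: "\<exists>c. \<forall>q\<in>points C. y q - (\<Sum>x\<in>T2. h (c x) \<cdot> u2 x q) \<in> W q"
    if y: "\<forall>p\<in>points C. y p \<in> lattice p b" for y
  proof -
    have "\<forall>p\<in>P. \<exists>c. y p - (\<Sum>x\<in>{..<rk} \<times> {..<N p}. h (c x) \<cdot> unif p ^ snd x \<cdot> b (fst x))
        \<in> lattice p (\<lambda>i. unif p ^ N p \<cdot> b i)"
      using lattice_expansion y P(2) by blast
    from bchoice[OF this] obtain c where c: "\<forall>p\<in>P. y p -
        (\<Sum>x\<in>{..<rk} \<times> {..<N p}. h (c p x) \<cdot> unif p ^ snd x \<cdot> b (fst x))
        \<in> lattice p (\<lambda>i. unif p ^ N p \<cdot> b i)" ..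
    have "(\<Sum>x\<in>T2. h (c (fst x) (snd x)) \<cdot> u2 x q) =
        (if q \<in> P then \<Sum>x\<in>{..<rk} \<times> {..<N q}. h (c q x) \<cdot> unif q ^ snd x \<cdot> b (fst x) else 0)" for q
    proof -
      have "(\<Sum>x\<in>T2. h (c (fst x) (snd x)) \<cdot> u2 x q) =
        (\<Sum>x\<in>T2. if q = fst x then h (c (fst x) (snd x)) \<cdot> unif q ^ snd (snd x) \<cdot> b (fst (snd x)) else 0)"
        by (rule sum.cong) (auto simp: u2_def)
      then show ?thesis unfolding T2_def by (subst (asm) sum_Sigma_fibre) (use P(1) in auto)
    qed
    then have "\<forall>q\<in>points C. y q - (\<Sum>x\<in>T2. h (c (fst x) (snd x)) \<cdot> u2 x q) \<in> W q"
      using c y by (auto simp: W_def)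
    then show ?thesis by (intro exI[of _ "\<lambda>x. c (fst x) (snd x)"])
  qed
  have span: "\<exists>c c' F. \<forall>q\<in>points C. z q - (\<Sum>x\<in>T1. h (c x) \<cdot> u1 x q) - (\<Sum>x\<in>T2. h (c' x) \<cdot> u2 x q) - F \<in> W q"
    if z: "finite {p \<in> points C. z p \<notin> stalk V p}" for z
  proof -
    have "\<forall>p. \<exists>c. z p = (\<Sum>i<rk. c i \<cdot> b i)" using b unfolding is_basis_iff by blast
    then obtain \<alpha> where \<alpha>: "\<And>p. z p = (\<Sum>i<rk. \<alpha> p i \<cdot> b i)" unfolding choice_iff by blast
    have "\<exists>c f. \<forall>p\<in>points C. \<alpha> p i - (\<Sum>j<genus C. h (c j) * \<eta> j p) - f \<in> \<O> p" if i: "i < rk" for i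
    proof (rule \<eta>, rule finite_subset)
      show "finite (P \<union> {p \<in> points C. z p \<notin> stalk V p})" using P(1) z by simp
      show "{p \<in> points C. \<alpha> p i \<notin> \<O> p} \<subseteq> P \<union> {p \<in> points C. z p \<notin> stalk V p}"
      proof (intro subsetI, rule ccontr)
        fix p assume p: "p \<in> {p \<in> points C. \<alpha> p i \<notin> \<O> p}" "p \<notin> P \<union> {p \<in> points C. z p \<notin> stalk V p}"
        then have "z p \<in> lattice p b" using P1 by auto
        then obtain f where f: "\<And>i. i < rk \<Longrightarrow> f i \<in> \<O> p" "z p = (\<Sum>i<rk. f i \<cdot> b i)"
          by (rule latticeE) blast
        have "\<alpha> p i = f i"
          using b f(2) \<alpha>[of p] i by (intro indep_eq[of b "\<alpha> p" f]) (auto simp: is_basis_iff)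
        then show False using f(1)[OF i] p(1) by simp
      qed
    qed
    then have "\<forall>i. \<exists>c f. i < rk \<longrightarrow> (\<forall>p\<in>points C. \<alpha> p i - (\<Sum>j<genus C. h (c j) * \<eta> j p) - f \<in> \<O> p)" by blast
    then obtain c f where c: "\<And>i p. i < rk \<Longrightarrow> p \<in> points C \<Longrightarrow>
        \<alpha> p i - (\<Sum>j<genus C. h (c i j) * \<eta> j p) - f i \<in> \<O> p" unfolding choice_iff by blast
    define F where "F = (\<Sum>i<rk. f i \<cdot> b i)"
    define y where "y p = z p - (\<Sum>x\<in>T1. h (c (fst x) (snd x)) \<cdot> u1 x p) - F" for p
    have "y p \<in> lattice p b" if p: "p \<in> points C" for p
    proof -
      have "(\<Sum>x\<in>T1. h (c (fst x) (snd x)) \<cdot> u1 x p) = (\<Sum>i<rk. (\<Sum>j<genus C. h (c i j) * \<eta> j p) \<cdot> b i)"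
        by (simp add: T1_def u1_def sum.cartesian_product' split_def E.scale_sum_left)
      then have "y p = (\<Sum>i<rk. (\<alpha> p i - (\<Sum>j<genus C. h (c i j) * \<eta> j p) - f i) \<cdot> b i)"
        by (simp add: y_def \<alpha>[of p] F_def E.scale_left_diff_distrib sum_subtractf)
      then show ?thesis using c p by (auto intro!: latticeI)
    qed
    then obtain c' where c': "\<forall>q\<in>points C. y q - (\<Sum>x\<in>T2. h (c' x) \<cdot> u2 x q) \<in> W q" using span2 by blast
    have "y q - (\<Sum>x\<in>T2. h (c' x) \<cdot> u2 x q) =
        z q - (\<Sum>x\<in>T1. h (c (fst x) (snd x)) \<cdot> u1 x q) - (\<Sum>x\<in>T2. h (c' x) \<cdot> u2 x q) - F" for q
      by (simp add: y_def algebra_simps)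
    then have "\<forall>q\<in>points C. z q - (\<Sum>x\<in>T1. h (c (fst x) (snd x)) \<cdot> u1 x q) - (\<Sum>x\<in>T2. h (c' x) \<cdot> u2 x q) - F \<in> W q"
      using c' by (simp only:)
    then show ?thesis by (intro exI[of _ "\<lambda>x. c (fst x) (snd x)"] exI[of _ c'] exI[of _ F])
  qed
  define T where "T = T1 <+> T2"
  define u where "u = case_sum u1 u2"
  define I where "I = insert None (Some ` I1) <+> {..<rk}"
  define z where "z i = (case i of Inl None \<Rightarrow> x | Inl (Some y) \<Rightarrow> v y | Inr j \<Rightarrow> (\<lambda>_. b j))"
    for i :: "(('k, 'i) point \<times> nat) option + nat"
  have finT: "finite T" and finI: "finite I" using fin by (auto simp: T_def I_def)
  \<comment> \<open>\<open>card I1\<close> is \<open>card T2\<close> plus the degree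
    \<open>rk * (g - 1)\<close>, and \<open>T1\<close> contributes \<open>rk * g\<close>, where
    \<open>g\<close> is the genus. With the \<open>rk\<close> constants and \<open>x\<close> itself,
    \<open>I\<close> has exactly one member more than \<open>T\<close>.\<close>
  have cardT: "card T < card I"
  proof -
    have "int (card I1) = (\<Sum>p\<in>P. int (a p))"
      unfolding I1_def using P(1) by (simp add: card_SigmaI)
    also have "\<dots> = (\<Sum>p\<in>P. int rk * int (N p)) + int rk * (int (genus C) - 1)"
      using degP by (simp add: a sum.distrib)
    finally have 1: "int (card I1) = (\<Sum>p\<in>P. int rk * int (N p)) + int rk * (int (genus C) - 1)" .
    have 2: "int (card T2) = (\<Sum>p\<in>P. int rk * int (N p))"
      unfolding T2_def using P(1) by (simp add: card_SigmaI)
    have "int (card T) = int rk * int (genus C) + int (card T2)"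
      using fin by (simp add: T_def card_Plus T1_def)
    moreover have "int (card I) = int (card I1) + 1 + int rk"
      using fin by (simp add: I_def card_Plus card_image card_insert_if)
    ultimately have "int (card T) < int (card I)" using 1 2 by (simp add: algebra_simps)
    then show ?thesis by simp
  qed
  have sum_T: "(\<Sum>t\<in>T. h (c t) \<cdot> u t q) =
      (\<Sum>t\<in>T1. h (c (Inl t)) \<cdot> u1 t q) + (\<Sum>t\<in>T2. h (c (Inr t)) \<cdot> u2 t q)" for c q
    unfolding T_def u_def using fin by (simp add: sum.Plus)
  have v_stalk: "v y q \<in> stalk V q" if "y \<in> I1" "q \<in> points C" for y q
    using that \<nu> by (auto simp: v_def I1_def stalk_0)
  have v_fin: "finite {q \<in> points C. v y q \<notin> stalk V q}" if "y \<in> I1" for y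
  proof -
    have "{q \<in> points C. v y q \<notin> stalk V q} = {}" using v_stalk[OF that] by blast
    then show ?thesis by (simp only: finite.emptyI)
  qed
  \<comment> \<open>The constants \<open>b j\<close> lie in the trivial lattice already and take the
    correction \<open>F = 0\<close>. This is what later leaves a relation among the
    \<open>b j\<close> alone.\<close>
  have "\<forall>i\<in>I. \<exists>c F. (\<forall>j. i = Inr j \<longrightarrow> F = 0) \<and>
      (\<forall>q\<in>points C. z i q - F - (\<Sum>t\<in>T. h (c t) \<cdot> u t q) \<in> W q)"
  proof
    fix i assume i: "i \<in> I"
    show "\<exists>c F. (\<forall>j. i = Inr j \<longrightarrow> F = 0) \<and>
        (\<forall>q\<in>points C. z i q - F - (\<Sum>t\<in>T. h (c t) \<cdot> u t q) \<in> W q)"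
    proof (cases i)
      case (Inl y)
      then have "finite {q \<in> points C. z i q \<notin> stalk V q}"
        using i x v_fin by (auto simp: z_def I_def split: option.split)
      from span[OF this] obtain c c' F where
        c: "\<forall>q\<in>points C. z i q - (\<Sum>x\<in>T1. h (c x) \<cdot> u1 x q) - (\<Sum>x\<in>T2. h (c' x) \<cdot> u2 x q) - F \<in> W q" by blast
      have "z i q - F - (\<Sum>t\<in>T. h (case_sum c c' t) \<cdot> u t q) =
          z i q - (\<Sum>x\<in>T1. h (c x) \<cdot> u1 x q) - (\<Sum>x\<in>T2. h (c' x) \<cdot> u2 x q) - F" for q
        by (simp add: sum_T algebra_simps)
      then have "\<forall>q\<in>points C. z i q - F - (\<Sum>t\<in>T. h (case_sum c c' t) \<cdot> u t q) \<in> W q" using c by (simp only:)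
      then show ?thesis using Inl by (intro exI[of _ "case_sum c c'"] exI[of _ F]) simp
    next
      case (Inr j)
      then have "\<forall>p\<in>points C. z i p \<in> lattice p b"
        using i by (auto simp: z_def I_def lattice_mem)
      from span2[OF this] obtain c where c: "\<forall>q\<in>points C. z i q - (\<Sum>x\<in>T2. h (c x) \<cdot> u2 x q) \<in> W q" by blast
      have "z i q - 0 - (\<Sum>t\<in>T. h (case_sum (\<lambda>_. 0) c t) \<cdot> u t q) = z i q - (\<Sum>x\<in>T2. h (c x) \<cdot> u2 x q)" for q
        by (simp add: sum_T)
      then have "\<forall>q\<in>points C. z i q - 0 - (\<Sum>t\<in>T. h (case_sum (\<lambda>_. 0) c t) \<cdot> u t q) \<in> W q" using c by (simp only:)
      then show ?thesis by (intro exI[of _ "case_sum (\<lambda>_. 0) c"] exI[of _ 0]) simp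
    qed
  qed
  from bchoice[OF this] obtain A where "\<forall>i\<in>I. \<exists>F. (\<forall>j. i = Inr j \<longrightarrow> F = 0) \<and>
      (\<forall>q\<in>points C. z i q - F - (\<Sum>t\<in>T. h (A i t) \<cdot> u t q) \<in> W q)" ..
  from bchoice[OF this] obtain F where F: "\<forall>i\<in>I. (\<forall>j. i = Inr j \<longrightarrow> F i = 0) \<and>
      (\<forall>q\<in>points C. z i q - F i - (\<Sum>t\<in>T. h (A i t) \<cdot> u t q) \<in> W q)" ..
  have W_lattice: "\<exists>b'. W p = lattice p b'" for p by (auto simp: W_def)
  interpret Y: vector_space "\<lambda>c (y :: ('k, 'i) point \<Rightarrow> 'e) p. h c \<cdot> y p" by (rule vector_space_fun)
  have subW: "Y.subspace {y. \<forall>p\<in>points C. y p \<in> W p}"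
    unfolding Y.subspace_def
  proof (intro conjI ballI allI CollectI)
    fix p assume p: "p \<in> points C"
    obtain b' where b': "W p = lattice p b'" using W_lattice by blast
    show "(0 :: ('k, 'i) point \<Rightarrow> 'e) p \<in> W p" using p by (simp add: b' lattice_0)
    fix y assume y: "y \<in> {y. \<forall>p\<in>points C. y p \<in> W p}"
    show "h c \<cdot> y p \<in> W p" for c using p y by (auto simp: b' intro!: lattice_smul local_ring_const)
    fix y' assume "y' \<in> {y. \<forall>p\<in>points C. y p \<in> W p}"
    then show "(y + y') p \<in> W p" using p y by (auto simp: b' intro!: lattice_add)
  qed
  obtain c where c0: "\<exists>i\<in>I. c i \<noteq> 0"
    and cW: "(\<Sum>i\<in>I. (\<lambda>p. h (c i) \<cdot> (z i p - F i))) \<in> {y. \<forall>p\<in>points C. y p \<in> W p}"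
  proof (rule Y.dependent_mod[OF subW finI finT cardT, of "\<lambda>i p. z i p - F i" A u])
    fix i assume "i \<in> I"
    then show "(\<lambda>p. z i p - F i) - (\<Sum>t\<in>T. (\<lambda>p. h (A i t) \<cdot> u t p)) \<in> {y. \<forall>p\<in>points C. y p \<in> W p}"
      using F by (simp add: sum_fun_apply)
  qed
  have sum_I: "(\<Sum>i\<in>I. G i) = G (Inl None) + (\<Sum>y\<in>I1. G (Inl (Some y))) + (\<Sum>j<rk. G (Inr j))"
    for G :: "(('k, 'i) point \<times> nat) option + nat \<Rightarrow> 'e"
    unfolding I_def using fin by (simp add: sum.Plus sum.reindex)
  define Ft where "Ft = (\<Sum>i\<in>I. h (c i) \<cdot> F i)"
  have cW': "h (c (Inl None)) \<cdot> x q + (\<Sum>y\<in>I1. h (c (Inl (Some y))) \<cdot> v y q)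
      + (\<Sum>j<rk. h (c (Inr j)) \<cdot> b j) - Ft \<in> W q" if "q \<in> points C" for q
  proof -
    have "(\<Sum>i\<in>I. h (c i) \<cdot> (z i q - F i)) = (\<Sum>i\<in>I. h (c i) \<cdot> z i q) - Ft"
      by (simp add: Ft_def E.scale_right_diff_distrib sum_subtractf)
    also have "(\<Sum>i\<in>I. h (c i) \<cdot> z i q) = h (c (Inl None)) \<cdot> x q +
        (\<Sum>y\<in>I1. h (c (Inl (Some y))) \<cdot> v y q) + (\<Sum>j<rk. h (c (Inr j)) \<cdot> b j)"
      unfolding sum_I by (simp add: z_def)
    finally have eq: "(\<Sum>i\<in>I. h (c i) \<cdot> (z i q - F i)) = h (c (Inl None)) \<cdot> x q +
        (\<Sum>y\<in>I1. h (c (Inl (Some y))) \<cdot> v y q) + (\<Sum>j<rk. h (c (Inr j)) \<cdot> b j) - Ft" .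
    have "(\<Sum>i\<in>I. h (c i) \<cdot> (z i q - F i)) \<in> W q" using cW that by (simp add: sum_fun_apply)
    then show ?thesis unfolding eq .
  qed
  have vsum_stalk: "(\<Sum>y\<in>I1. h (c (Inl (Some y))) \<cdot> v y q) \<in> stalk V q" if "q \<in> points C" for q
    using that by (intro stalk_sum stalk_smul local_ring_const v_stalk)
  \<comment> \<open>If \<open>x\<close> occurs in the relation, it can be solved for. Otherwise the
    relation exhibits a global section \<open>K\<close> of \<open>V\<close>, which is zero, and then
    all coefficients vanish in turn.\<close>
  show ?thesis
  proof (cases "c (Inl None) = 0")
    case False
    define f where "f = h (inverse (c (Inl None))) \<cdot> (Ft - (\<Sum>j<rk. h (c (Inr j)) \<cdot> b j))"
    have "x q - f \<in> stalk V q" if q: "q \<in> points C" for q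
    proof -
      have "(h (c (Inl None)) \<cdot> x q + (\<Sum>y\<in>I1. h (c (Inl (Some y))) \<cdot> v y q)
          + (\<Sum>j<rk. h (c (Inr j)) \<cdot> b j) - Ft) - (\<Sum>y\<in>I1. h (c (Inl (Some y))) \<cdot> v y q) \<in> stalk V q"
        by (intro stalk_diff vsum_stalk W_stalk cW' q)
      then have "h (c (Inl None)) \<cdot> x q - (Ft - (\<Sum>j<rk. h (c (Inr j)) \<cdot> b j)) \<in> stalk V q"
        by (simp add: algebra_simps)
      then have "h (inverse (c (Inl None))) \<cdot> (h (c (Inl None)) \<cdot> x q - (Ft - (\<Sum>j<rk. h (c (Inr j)) \<cdot> b j))) \<in> stalk V q"
        by (intro stalk_smul local_ring_const q)
      moreover have "h (inverse (c (Inl None))) * h (c (Inl None)) = 1"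
        using False by (simp flip: emb.hom_mult)
      ultimately show ?thesis by (simp add: f_def E.scale_right_diff_distrib)
    qed
    then show ?thesis by blast
  next
    case True
    define K where "K = (\<Sum>j<rk. h (c (Inr j)) \<cdot> b j) - Ft"
    have W1: "(\<Sum>y\<in>I1. h (c (Inl (Some y))) \<cdot> v y q) + K \<in> W q" if "q \<in> points C" for q
      using cW'[OF that] True by (simp add: K_def algebra_simps)
    have "K \<in> stalk V q" if q: "q \<in> points C" for q
      using stalk_diff[OF q W_stalk[OF q W1[OF q]] vsum_stalk[OF q]] by simp
    then have "K \<in> H0 C V" by (simp add: H0_def)
    then have K0: "K = 0" using H0 by simp
    \<comment> \<open>With \<open>K = 0\<close> the representatives of \<open>V\<close> modulo
      \<open>W\<close> at each point of \<open>P\<close> satisfy a relation by themselves.\<close>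
    have cv: "c (Inl (Some y)) = 0" if y: "y \<in> I1" for y
    proof -
      obtain p k where pk: "y = (p, k)" "p \<in> P" "k < a p" using y by (auto simp: I1_def)
      have "(\<Sum>y\<in>I1. h (c (Inl (Some y))) \<cdot> v y p) =
          (\<Sum>y\<in>I1. if p = fst y then h (c (Inl (Some y))) \<cdot> \<nu> p (snd y) else 0)"
        by (rule sum.cong) (auto simp: v_def)
      also have "\<dots> = (\<Sum>k<a p. h (c (Inl (Some (p, k)))) \<cdot> \<nu> p k)"
        unfolding I1_def using P(1) pk(2) by (subst sum_Sigma_fibre) auto
      finally have "(\<Sum>k<a p. h (c (Inl (Some (p, k)))) \<cdot> \<nu> p k) \<in> lattice p (\<lambda>i. unif p ^ N p \<cdot> b i)"
        using W1[of p] pk(2) P(2) K0 by (auto simp: W_def)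
      then show ?thesis using \<nu>_indep[OF pk(2), of "\<lambda>k. c (Inl (Some (p, k)))"] pk by blast
    qed
    have "Ft = 0" unfolding Ft_def
    proof (rule sum.neutral, rule ballI)
      fix i assume i: "i \<in> I"
      show "h (c i) \<cdot> F i = 0"
      proof (cases i)
        case (Inl o')
        then have "c i = 0" using i True cv by (cases o') (auto simp: I_def)
        then show ?thesis by simp
      next
        case (Inr j)
        then show ?thesis using F i by simp
      qed
    qed
    then have "(\<Sum>j<rk. h (c (Inr j)) \<cdot> b j) = 0" using K0 by (simp add: K_def)
    then have cb: "c (Inr j) = 0" if "j < rk" for j
      using indepD[of b "\<lambda>j. h (c (Inr j))" j] b that by (simp add: is_basis_iff)
    obtain i where i: "i \<in> I" "c i \<noteq> 0" using c0 by blast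
    have "c i = 0"
    proof (cases i)
      case (Inl o')
      then show ?thesis using i(1) True cv by (cases o') (auto simp: I_def)
    next
      case (Inr j)
      then show ?thesis using i(1) cb by (auto simp: I_def)
    qed
    then show ?thesis using i(2) by blast
  qed
qed simp

end

section \<open>Twists and the map \<open>m\<^sub>3\<close>\<close>

context curve_bundle
begin

text \<open>The stalk at \<open>p\<close> of \<open>V(k p)\<close>. Testing a multiple by a power of
  the uniformiser avoids products of fractional ideals and lets closure properties pass over from
  \<open>stalk\<close>.\<close>

definition tstalk :: "int \<Rightarrow> ('k, 'i) point \<Rightarrow> 'e set"
  where "tstalk k p = {v. unif p powi k \<cdot> v \<in> stalk V p}"

definition sections :: "(('k, 'i) point \<Rightarrow> int) \<Rightarrow> 'e set"
  where "sections D = {s. \<forall>p\<in>points C. s \<in> tstalk (D p) p}"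

text \<open>The fibre at \<open>p\<close> of \<open>V(k p)\<close>: multiplication by the maximal
  ideal lowers the index by one.\<close>

abbreviation "Fib k p \<equiv> quotient_space (\<lambda>a v. h a \<cdot> v) (tstalk k p) (tstalk (k - 1) p)"

lemma tstalk_smul:
  assumes "p \<in> points C" "a \<in> \<O> p" "v \<in> tstalk k p" shows "a \<cdot> v \<in> tstalk k p"
  using stalk_smul[OF assms(1,2), of "unif p powi k \<cdot> v"] assms(3) by (simp add: tstalk_def mult.commute)

lemma tstalk_add: "p \<in> points C \<Longrightarrow> v \<in> tstalk k p \<Longrightarrow> w \<in> tstalk k p \<Longrightarrow> v + w \<in> tstalk k p"
  by (simp add: tstalk_def E.scale_right_distrib stalk_add)

lemma tstalk_diff: "p \<in> points C \<Longrightarrow> v \<in> tstalk k p \<Longrightarrow> w \<in> tstalk k p \<Longrightarrow> v - w \<in> tstalk k p"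
  by (simp add: tstalk_def E.scale_right_diff_distrib stalk_diff)

lemma tstalk_0: "p \<in> points C \<Longrightarrow> 0 \<in> tstalk k p"
  by (simp add: tstalk_def stalk_0)

lemma tstalk_sum: "p \<in> points C \<Longrightarrow> (\<And>s. s \<in> S \<Longrightarrow> f s \<in> tstalk k p) \<Longrightarrow> sum f S \<in> tstalk k p"
  by (induction S rule: infinite_finite_induct) (auto simp: tstalk_0 tstalk_add)

lemma tstalk_const: "p \<in> points C \<Longrightarrow> v \<in> tstalk k p \<Longrightarrow> h c \<cdot> v \<in> tstalk k p"
  by (rule tstalk_smul[OF _ local_ring_const(1)])

lemma unif_powi_add: "p \<in> points C \<Longrightarrow> unif p powi (j + k) = unif p powi j * unif p powi k"
  by (simp add: power_int_add unif(1))

lemma tstalk_mono: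
  assumes p: "p \<in> points C" and "k \<le> l" shows "tstalk k p \<subseteq> tstalk l p"
proof
  fix v assume v: "v \<in> tstalk k p"
  have "unif p powi (l - k) = unif p ^ nat (l - k)" using assms(2) by (simp add: power_int_def)
  then have "unif p powi (l - k) \<in> \<O> p" by (simp add: local_ring_power p unif)
  then have "unif p powi (l - k) \<cdot> unif p powi k \<cdot> v \<in> stalk V p"
    by (rule stalk_smul[OF p]) (use v in \<open>simp add: tstalk_def\<close>)
  then show "v \<in> tstalk l p" using unif_powi_add[OF p, of "l - k" k] by (simp add: tstalk_def)
qed

lemma stalk_eq_tstalk: "stalk V p = tstalk 0 p"
  by (simp add: tstalk_def)

lemma sections_add: "s \<in> sections D \<Longrightarrow> s' \<in> sections D \<Longrightarrow> s + s' \<in> sections D"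
  by (auto simp: sections_def tstalk_add)

lemma sections_diff: "s \<in> sections D \<Longrightarrow> s' \<in> sections D \<Longrightarrow> s - s' \<in> sections D"
  by (auto simp: sections_def tstalk_diff)

lemma sections_const: "s \<in> sections D \<Longrightarrow> h c \<cdot> s \<in> sections D"
  by (auto simp: sections_def tstalk_const)

lemma sections_sum: "(\<And>x. x \<in> S \<Longrightarrow> f x \<in> sections D) \<Longrightarrow> sum f S \<in> sections D"
  by (auto simp: sections_def intro!: tstalk_sum)

lemma fibre_pair:
  assumes p: "p \<in> points C"
  shows "subspace_pair (\<lambda>a v. h a \<cdot> v) (tstalk k p) (tstalk (k - 1) p)"
proof -
  interpret k: vector_space "\<lambda>a v. h a \<cdot> v"
    by unfold_locales (auto simp: hom_distribs E.scale_right_distrib E.scale_left_distrib)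
  have "k.subspace (tstalk j p)" for j
    unfolding k.subspace_def using p by (auto simp: tstalk_0 tstalk_add tstalk_const)
  then show ?thesis using tstalk_mono[OF p, of "k - 1" k] by unfold_locales auto
qed

text \<open>Stalks are compared at points of the curve only, so that \<open>V\<close> itself is a
  twist by zero and repeated twisting adds divisors.\<close>

definition is_twist :: "('k, 'K, 'i, 'e) vbundle \<Rightarrow> (('k, 'i) point \<Rightarrow> int) \<Rightarrow> bool"
  where "is_twist U D \<longleftrightarrow> scl U = smul \<and> (\<forall>p\<in>points C. stalk U p = tstalk (D p) p)"

lemma is_twist_self: "is_twist V (\<lambda>_. 0)"
  by (simp add: is_twist_def stalk_eq_tstalk)

lemma is_twist_twist:
  assumes U: "is_twist U D"
  shows "is_twist (twist C U E) (\<lambda>p. D p + E p)"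
proof -
  have "stalk (twist C U E) p = tstalk (D p + E p) p" if p: "p \<in> points C" for p
  proof -
    have st: "stalk (twist C U E) p = {f \<cdot> v | f v. (f = 0 \<or> ord C p f \<ge> - E p) \<and> v \<in> tstalk (D p) p}"
      using U p by (simp add: is_twist_def twist_def)
    show ?thesis
    proof (intro equalityI subsetI)
      fix w assume "w \<in> stalk (twist C U E) p"
      then obtain f v where w: "w = f \<cdot> v" "f = 0 \<or> ord C p f \<ge> - E p" "v \<in> tstalk (D p) p"
        unfolding st by blast
      have "unif p powi E p * f \<in> \<O> p"
      proof (cases "f = 0")
        case False
        then show ?thesis using w(2) unif(1)[OF p]
          by (auto simp: local_ring_iff_ord p ord_mult ord_unif_powi)
      qed (simp add: local_ring_0 p)
      then have "(unif p powi E p * f) \<cdot> unif p powi D p \<cdot> v \<in> stalk V p"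
        by (rule stalk_smul[OF p]) (use w(3) in \<open>simp add: tstalk_def\<close>)
      then show "w \<in> tstalk (D p + E p) p"
        using unif_powi_add[OF p, of "D p" "E p"] by (simp add: tstalk_def w(1) mult_ac)
    next
      fix w assume w: "w \<in> tstalk (D p + E p) p"
      define v where "v = unif p powi E p \<cdot> w"
      have "v \<in> tstalk (D p) p"
        using w unif_powi_add[OF p, of "D p" "E p"] by (simp add: tstalk_def v_def)
      moreover have "w = unif p powi (- E p) \<cdot> v"
        using unif_powi_add[OF p, of "- E p" "E p"] by (simp add: v_def)
      ultimately show "w \<in> stalk (twist C U E) p"
        unfolding st using ord_unif_powi[OF p, of "- E p"] by fastforce
    qed
  qed
  moreover have "scl (twist C U E) = smul" using U by (simp add: is_twist_def twist_def)
  ultimately show ?thesis by (simp add: is_twist_def)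
qed

lemma fibre_ker_twist:
  assumes U: "is_twist U D" and p: "p \<in> points C"
  shows "fibre_ker C U p = tstalk (D p - 1) p"
proof -
  have fk: "fibre_ker C U p = {f \<cdot> v | f v. f \<in> \<mm> p \<and> v \<in> tstalk (D p) p}"
    using U p by (simp add: is_twist_def fibre_ker_def)
  have shift: "v \<in> tstalk (D p) p \<longleftrightarrow> unif p \<cdot> v \<in> tstalk (D p - 1) p" for v
    using unif_powi_add[OF p, of "D p - 1" 1] by (simp add: tstalk_def)
  show ?thesis
  proof (intro equalityI subsetI)
    fix w assume "w \<in> fibre_ker C U p"
    then obtain f v where w: "w = f \<cdot> v" "f \<in> \<mm> p" "v \<in> tstalk (D p) p" unfolding fk by blast
    then obtain a where a: "a \<in> \<O> p" "f = unif p * a" unfolding unif(2)[OF p] by blast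
    have "a \<cdot> unif p \<cdot> v \<in> tstalk (D p - 1) p" using w(3) unfolding shift by (rule tstalk_smul[OF p a(1)])
    then show "w \<in> tstalk (D p - 1) p" by (simp add: w(1) a(2) mult.commute)
  next
    fix w assume w: "w \<in> tstalk (D p - 1) p"
    have "w = unif p \<cdot> inverse (unif p) \<cdot> w" using unif(1)[OF p] by simp
    moreover have "inverse (unif p) \<cdot> w \<in> tstalk (D p) p" unfolding shift using w unif(1)[OF p] by simp
    ultimately show "w \<in> fibre_ker C U p" unfolding fk using unif(3)[OF p] by blast
  qed
qed

lemma fibre_twist:
  assumes "is_twist U D" "p \<in> points C" shows "fibre C U p = Fib (D p) p"
  using assms fibre_ker_twist[OF assms] by (simp add: fibre_def is_twist_def)

lemma evaluate_twist:
  assumes "is_twist U D" "p \<in> points C" shows "evaluate C U p s = coset_of (tstalk (D p - 1) p) s"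
  by (simp add: evaluate_def fibre_ker_twist[OF assms])

lemma H0_twist: "is_twist U D \<Longrightarrow> H0 C U = sections D"
  by (auto simp: H0_def sections_def is_twist_def)

text \<open>Together the last two assumptions make evaluation at \<open>x\<close> bijective on
  sections of \<open>V(D + x)\<close>. Surjectivity is a hypothesis because it is obtained in
  different ways for \<open>V\<close> and for the twist by the divisor of the theorem.\<close>

lemma m3_twist:
  assumes U: "is_twist U D" and x: "x \<in> points C" and y: "y \<in> points C" "y \<noteq> x"
    and inj: "sections D = {0}"
    and surj: "\<And>v. v \<in> tstalk (D x + 1) x \<Longrightarrow> \<exists>s\<in>sections (\<lambda>p. D p + pt_divisor x p). s - v \<in> tstalk (D x) x"
  shows "m3 C U x y \<in> linear_maps (Fib (D x + 1) x) (Fib (D y) y)"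
    and "\<And>s. s \<in> sections (\<lambda>p. D p + pt_divisor x p) \<Longrightarrow>
      m3 C U x y (coset_of (tstalk (D x) x) s) = coset_of (tstalk (D y - 1) y) s"
proof -
  let ?W = "twist C U (pt_divisor x)" and ?S = "sections (\<lambda>p. D p + pt_divisor x p)"
  let ?X = "Fib (D x + 1) x" and ?Y = "Fib (D y) y"
  let ?cx = "coset_of (tstalk (D x) x)" and ?cy = "coset_of (tstalk (D y - 1) y)"
  have W: "is_twist ?W (\<lambda>p. D p + pt_divisor x p)" by (rule is_twist_twist[OF U])
  have X: "subspace_pair (\<lambda>a v. h a \<cdot> v) (tstalk (D x + 1) x) (tstalk (D x) x)"
    using fibre_pair[OF x, of "D x + 1"] by simp
  interpret X: subspace_pair "\<lambda>a v. h a \<cdot> v" "tstalk (D x + 1) x" "tstalk (D x) x" by (rule X)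
  interpret Y: subspace_pair "\<lambda>a v. h a \<cdot> v" "tstalk (D y) y" "tstalk (D y - 1) y" by (rule fibre_pair[OF y(1)])
  have Xeq: "?X = X.Q" by simp
  have Sx: "s \<in> tstalk (D x + 1) x" if "s \<in> ?S" for s
    using bspec[OF that[unfolded sections_def mem_Collect_eq] x] by (simp add: pt_divisor_def)
  have Sy: "s \<in> tstalk (D y) y" if "s \<in> ?S" for s
    using bspec[OF that[unfolded sections_def mem_Collect_eq] y(1)] y(2) by (simp add: pt_divisor_def)
  have eq: "s = s'" if s: "s \<in> ?S" "s' \<in> ?S" "?cx s = ?cx s'" for s s'
  proof -
    have "s - s' \<in> tstalk (D p) p" if p: "p \<in> points C" for p
    proof (cases "p = x")
      case True
      then show ?thesis using s(3) by (simp add: X.coset_eq_iff)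
    next
      case False
      then show ?thesis
        using bspec[OF sections_diff[OF s(1,2), unfolded sections_def mem_Collect_eq] p]
        by (simp add: pt_divisor_def)
    qed
    then have "s - s' \<in> sections D" by (simp add: sections_def)
    then show ?thesis using inj by simp
  qed
  have lift: "\<exists>s\<in>?S. X = ?cx s" if car: "X \<in> carrier ?X" for X
  proof -
    obtain v where v: "v \<in> tstalk (D x + 1) x" "X = ?cx v" using car unfolding Xeq by (rule X.carrierE)
    then show ?thesis using surj[OF v(1)] X.coset_eq_iff by metis
  qed
  \<comment> \<open>\<open>sec\<close> inverts evaluation at \<open>x\<close>; the description in
    \<open>m3\<close> is then met by evaluation at \<open>y\<close> after
    \<open>sec\<close>.\<close>
  define sec where "sec X = (SOME s. s \<in> ?S \<and> X = ?cx s)" for X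
  have sec: "sec (?cx s) = s" if "s \<in> ?S" for s
  proof -
    have "sec (?cx s) \<in> ?S \<and> ?cx s = ?cx (sec (?cx s))"
      unfolding sec_def by (rule someI[of _ s]) (use that in simp)
    then show ?thesis using eq that by metis
  qed
  define m where "m = (\<lambda>X\<in>carrier ?X. ?cy (sec X))"
  have mem: "?cx s \<in> carrier ?X" if "s \<in> ?S" for s unfolding Xeq by (rule X.coset_mem[OF Sx[OF that]])
  have m: "m (?cx s) = ?cy s" if "s \<in> ?S" for s using that by (simp only: m_def restrict_apply' mem sec)
  have lin: "m \<in> linear_maps ?X ?Y"
    unfolding linear_maps_def
  proof (intro CollectI conjI ballI allI)
    show "m \<in> carrier ?X \<rightarrow>\<^sub>E carrier ?Y"
    proof (rule PiE_I)
      fix X assume "X \<in> carrier ?X"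
      then obtain s where s: "s \<in> ?S" "X = ?cx s" using lift by blast
      then show "m X \<in> carrier ?Y" using m Y.coset_mem[OF Sy] by simp
    qed (simp add: m_def)
    fix X assume "X \<in> carrier ?X"
    then obtain s where s: "s \<in> ?S" "X = ?cx s" using lift by blast
    show "m (a \<odot>\<^bsub>?X\<^esub> X) = a \<odot>\<^bsub>?Y\<^esub> m X" for a
      unfolding s(2) m[OF s(1)] Xeq X.smult_coset Y.smult_coset by (rule m[OF sections_const[OF s(1)]])
    fix X' assume "X' \<in> carrier ?X"
    then obtain s' where s': "s' \<in> ?S" "X' = ?cx s'" using lift by blast
    show "m (X \<oplus>\<^bsub>?X\<^esub> X') = m X \<oplus>\<^bsub>?Y\<^esub> m X'"
      unfolding s(2) s'(2) m[OF s(1)] m[OF s'(1)] Xeq X.add_coset Y.add_coset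
      by (rule m[OF sections_add[OF s(1) s'(1)]])
  qed
  have "m3 C U x y = (THE m. m \<in> linear_maps ?X ?Y \<and> (\<forall>s\<in>?S. m (?cx s) = ?cy s))"
  proof -
    have "pt_divisor x x = 1" "pt_divisor x y = 0" using y(2) by (simp_all add: pt_divisor_def)
    then show ?thesis
      unfolding m3_def Let_def fibre_twist[OF W x] fibre_twist[OF U y(1)] H0_twist[OF W]
        evaluate_twist[OF W x] evaluate_twist[OF W y(1)] by simp
  qed
  also have "\<dots> = m"
  proof (rule the_equality)
    show "m \<in> linear_maps ?X ?Y \<and> (\<forall>s\<in>?S. m (?cx s) = ?cy s)" using lin m by blast
    fix m' assume m': "m' \<in> linear_maps ?X ?Y \<and> (\<forall>s\<in>?S. m' (?cx s) = ?cy s)"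
    show "m' = m"
    proof (rule extensionalityI[of _ "carrier ?X"])
      show "m' \<in> extensional (carrier ?X)" using m' by (auto simp: linear_maps_def PiE_def)
      show "m \<in> extensional (carrier ?X)" by (simp add: m_def)
      fix X assume "X \<in> carrier ?X"
      then obtain s where "s \<in> ?S" "X = ?cx s" using lift by blast
      then show "m' X = m X" using m' m by simp
    qed
  qed
  finally have m3: "m3 C U x y = m" .
  show "m3 C U x y \<in> linear_maps ?X ?Y" unfolding m3 by (rule lin)
  show "m3 C U x y (?cx s) = ?cy s" if "s \<in> ?S" for s unfolding m3 by (rule m[OF that])
qed

text \<open>A local section of \<open>V(x)\<close>, extended by zero, is an adele. Its decomposition into a global
  rational section and an integral adele provides the global section of \<open>V(x)\<close>.\<close>

lemma section_with_pole:
  assumes H0: "H0 C V = {0}" and deg: "degree_of C V = int rk * (int (genus C) - 1)"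
    and x: "x \<in> points C" and v: "v \<in> tstalk 1 x"
  shows "\<exists>s\<in>sections (pt_divisor x). s - v \<in> tstalk 0 x"
proof -
  have "{p \<in> points C. (if p = x then v else 0) \<notin> stalk V p} \<subseteq> {x}" by (auto simp: stalk_0)
  then have "finite {p \<in> points C. (if p = x then v else 0) \<notin> stalk V p}" by (rule finite_subset) simp
  from adelic_vanishing[OF H0 deg this] obtain f where
    f: "\<And>p. p \<in> points C \<Longrightarrow> (if p = x then v else 0) - f \<in> tstalk 0 p"
    unfolding stalk_eq_tstalk by blast
  have fv: "f - v \<in> tstalk 0 x" using tstalk_diff[OF x tstalk_0[OF x] f[OF x]] by simp
  have "f \<in> tstalk (pt_divisor x p) p" if p: "p \<in> points C" for p
  proof (cases "p = x")
    case True
    have "v + (f - v) \<in> tstalk 1 x"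
      using tstalk_mono[OF x, of 0 1] fv v by (intro tstalk_add x) auto
    then show ?thesis using True by (simp add: pt_divisor_def)
  next
    case False
    then show ?thesis using tstalk_diff[OF p tstalk_0[OF p] f[OF p]] by (simp add: pt_divisor_def)
  qed
  then show ?thesis using fv by (auto simp: sections_def)
qed

text \<open>Bounds the dimension of a fibre of \<open>V\<close> from above by the rank; the
  coefficients are the residues of the coordinates in the frame.\<close>

lemma fibre_coordinates:
  assumes p: "p \<in> points C" and e: "frame_at C V p e" and v: "v \<in> tstalk 0 p"
  shows "\<exists>c. v - (\<Sum>k<rk. h (c k) \<cdot> e k) \<in> tstalk (- 1) p"
proof -
  have st: "stalk V p = lattice p e" using e by (simp add: frame_at_iff)
  obtain f where f: "\<And>k. k < rk \<Longrightarrow> f k \<in> \<O> p" "v = (\<Sum>k<rk. f k \<cdot> e k)"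
    using v latticeE[of v p e] unfolding stalk_eq_tstalk[symmetric] st by blast
  have "inverse (unif p) * (f k - h (res p (f k))) \<in> \<O> p" if "k < rk" for k
  proof -
    have "f k - h (res p (f k)) \<in> \<mm> p"
      using f(1)[OF that] by (simp add: max_ideal_iff p local_ring_diff local_ring_const)
    then show ?thesis unfolding unif(2)[OF p] using unif(1)[OF p] by (auto simp: mult.assoc[symmetric])
  qed
  then have "(\<Sum>k<rk. (inverse (unif p) * (f k - h (res p (f k)))) \<cdot> e k) \<in> lattice p e" by (rule latticeI)
  also have "(\<Sum>k<rk. (inverse (unif p) * (f k - h (res p (f k)))) \<cdot> e k)
      = inverse (unif p) \<cdot> (v - (\<Sum>k<rk. h (res p (f k)) \<cdot> e k))"
  proof -
    have "v - (\<Sum>k<rk. h (res p (f k)) \<cdot> e k) = (\<Sum>k<rk. (f k - h (res p (f k))) \<cdot> e k)"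
      by (simp add: f(2) E.scale_left_diff_distrib sum_subtractf)
    then show ?thesis by (simp add: E.scale_sum_right)
  qed
  finally show ?thesis unfolding st[symmetric]
    by (intro exI[of _ "\<lambda>k. res p (f k)"]) (simp add: tstalk_def power_int_minus)
qed

text \<open>Bounds the dimension of the fibre of \<open>V(p)\<close> at \<open>p\<close> from below
  by the rank, through polar parts of first order that are independent modulo
  \<open>V\<close>.\<close>

lemma fibre_basis_lift:
  assumes p: "p \<in> points C" and e: "frame_at C V p e"
  shows "k < rk \<Longrightarrow> inverse (unif p) \<cdot> e k \<in> tstalk 1 p"
    and "(\<Sum>k<rk. h (c k) \<cdot> inverse (unif p) \<cdot> e k) \<in> tstalk 0 p \<Longrightarrow> k < rk \<Longrightarrow> c k = 0"
proof -
  have st: "stalk V p = lattice p e" and ind: "indep e" using e by (auto simp: frame_at_iff is_basis_iff)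
  show "inverse (unif p) \<cdot> e k \<in> tstalk 1 p" if "k < rk"
    using lattice_mem[OF p that, of e] unif(1)[OF p] by (simp add: tstalk_def st)
  assume "(\<Sum>k<rk. h (c k) \<cdot> inverse (unif p) \<cdot> e k) \<in> tstalk 0 p" and k: "k < rk"
  then obtain f where f: "\<And>k. k < rk \<Longrightarrow> f k \<in> \<O> p"
    "(\<Sum>k<rk. h (c k) \<cdot> inverse (unif p) \<cdot> e k) = (\<Sum>k<rk. f k \<cdot> e k)"
    unfolding stalk_eq_tstalk[symmetric] st by (elim latticeE) blast
  then have "h (c k) * inverse (unif p) = f k"
    by (intro indep_eq[OF ind _ k, of "\<lambda>k. h (c k) * inverse (unif p)" f]) simp
  then have "h (c k) = unif p * f k" using unif(1)[OF p] by (auto simp: field_simps)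
  then have "h (c k) \<in> \<mm> p" unfolding unif(2)[OF p] using f(1)[OF k] by blast
  then show "c k = 0" using local_ring_const(2)[OF p, of "c k"] by (simp add: max_ideal_iff p)
qed


section \<open>The quasideterminant\<close>

lemma pt_divisor_sum:
  fixes x :: "nat \<Rightarrow> ('k, 'i) point"
  assumes "inj_on x {0..n}" "j \<le> n"
  shows "(\<Sum>i=1..n. pt_divisor (x i)) (x j) = (if j \<ge> 1 then 1 else 0)"
proof -
  have "(\<Sum>i=1..n. pt_divisor (x i)) (x j) = (\<Sum>i=1..n. pt_divisor (x i) (x j))"
    by (rule sum_fun_apply)
  also have "\<dots> = (\<Sum>i=1..n. if i = j then 1 else 0)"
  proof (rule sum.cong[OF refl])
    fix i assume "i \<in> {1..n}"
    then have "x j = x i \<longleftrightarrow> j = i" using assms by (intro inj_on_eq_iff) auto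
    then show "pt_divisor (x i) (x j) = (if i = j then 1 else 0)" by (auto simp: pt_divisor_def)
  qed
  finally show ?thesis using assms(2) by (simp add: sum.delta)
qed

lemma pt_divisor_sum_0:
  fixes x :: "nat \<Rightarrow> ('k, 'i) point"
  assumes "p \<notin> x ` {1..n}" shows "(\<Sum>i=1..n. pt_divisor (x i)) p = 0"
proof -
  have "(\<Sum>i=1..n. pt_divisor (x i)) p = (\<Sum>i=1..n. pt_divisor (x i) p)" by (rule sum_fun_apply)
  also have "\<dots> = 0" using assms by (intro sum.neutral) (auto simp: pt_divisor_def)
  finally show ?thesis .
qed

section \<open>Sections of \<open>V(D)\<close> and the invertible block\<close>

context
  fixes n :: nat and x y :: "nat \<Rightarrow> ('k, 'i) point" and D :: "('k, 'i) point \<Rightarrow> int"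
  assumes H0: "H0 C V = {0}" and deg: "degree_of C V = int rk * (int (genus C) - 1)"
    and xC: "x ` {0..n} \<subseteq> points C" and yC: "y ` {0..n} \<subseteq> points C"
    and injx: "inj_on x {0..n}" and injy: "inj_on y {0..n}" and disj: "x ` {0..n} \<inter> y ` {0..n} = {}"
    and D: "D = (\<Sum>i=1..n. pt_divisor (x i)) - (\<Sum>i=1..n. pt_divisor (y i))"
    and HD: "sections D = {0}"
begin

lemma xy: "j \<le> n \<Longrightarrow> x j \<in> points C" "i \<le> n \<Longrightarrow> y i \<in> points C" "i \<le> n \<Longrightarrow> j \<le> n \<Longrightarrow> y i \<noteq> x j"
proof -
  show "j \<le> n \<Longrightarrow> x j \<in> points C" "i \<le> n \<Longrightarrow> y i \<in> points C" using xC yC by (simp_all add: image_subset_iff)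
  assume "i \<le> n" "j \<le> n"
  then have "y i \<in> y ` {0..n}" "x j \<in> x ` {0..n}" by simp_all
  then show "y i \<noteq> x j" using disj by (metis IntI empty_iff)
qed

lemma D_x: "j \<le> n \<Longrightarrow> D (x j) = (if j \<ge> 1 then 1 else 0)"
  and D_y: "i \<le> n \<Longrightarrow> D (y i) = (if i \<ge> 1 then - 1 else 0)"
proof -
  assume j: "j \<le> n"
  have 0: "x j \<notin> y ` {1..n}" using xy(3)[OF _ j] by (metis atLeastAtMost_iff imageE)
  then show "D (x j) = (if j \<ge> 1 then 1 else 0)"
    unfolding D minus_apply pt_divisor_sum[OF injx j] pt_divisor_sum_0[OF 0] by simp
next
  assume i: "i \<le> n"
  have 0: "y i \<notin> x ` {1..n}" using xy(3)[OF i] by (metis atLeastAtMost_iff imageE)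
  then show "D (y i) = (if i \<ge> 1 then - 1 else 0)"
    unfolding D minus_apply pt_divisor_sum[OF injy i] pt_divisor_sum_0[OF 0] by simp
qed

lemma D_else:
  assumes "p \<notin> x ` {1..n}" "p \<notin> y ` {1..n}" shows "D p = 0"
  unfolding D minus_apply pt_divisor_sum_0[OF assms(1)] pt_divisor_sum_0[OF assms(2)] by simp

lemma sections_0: "sections (\<lambda>_. 0) = {0}"
  using H0 H0_twist[OF is_twist_self] by simp

lemma poles:
  assumes s: "s \<in> sections (pt_divisor q)" and p: "p \<in> points C"
  shows "s \<in> tstalk 1 p" "p \<noteq> q \<Longrightarrow> s \<in> tstalk 0 p"
proof -
  have s': "s \<in> tstalk (pt_divisor q p) p" using s p unfolding sections_def by blast
  have "pt_divisor q p \<le> 1" by (simp add: pt_divisor_def)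
  then show "s \<in> tstalk 1 p" using s' tstalk_mono[OF p] by blast
  show "s \<in> tstalk 0 p" if "p \<noteq> q" using s' that by (simp add: pt_divisor_def)
qed

text \<open>The case \<open>t = 0\<close> gives sections of \<open>V(D)\<close>, used for the
  injectivity of the block; a section \<open>t\<close> with a pole at \<open>x 0\<close> gives
  sections of \<open>V(D + x 0)\<close>. The conditional divisor treats both at once.\<close>

lemma sections_D:
  assumes t0: "t \<in> sections (pt_divisor (x 0)) \<or> t = 0"
    and s: "\<And>j. j \<in> {1..n} \<Longrightarrow> s j \<in> sections (pt_divisor (x j))"
    and van: "\<And>i. i \<in> {1..n} \<Longrightarrow> t + (\<Sum>j=1..n. s j) \<in> tstalk (- 1) (y i)"
  shows "t + (\<Sum>j=1..n. s j) \<in> sections (\<lambda>p. D p + (if t = 0 then 0 else pt_divisor (x 0) p))"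
  unfolding sections_def
proof (intro CollectI ballI)
  fix p assume p: "p \<in> points C"
  let ?E = "\<lambda>p. D p + (if t = 0 then 0 else pt_divisor (x 0) p)"
  have t1: "t \<in> tstalk 1 p" "p \<noteq> x 0 \<Longrightarrow> t \<in> tstalk 0 p"
    using t0 poles[of t "x 0", OF _ p] tstalk_0[OF p] by auto
  show "t + (\<Sum>j=1..n. s j) \<in> tstalk (?E p) p"
  proof (cases "p \<in> x ` {1..n} \<or> p \<in> y ` {1..n}")
    case True
    then show ?thesis
    proof
      assume "p \<in> x ` {1..n}"
      then obtain l where l: "l \<in> {1..n}" "p = x l" by blast
      have "x l \<noteq> x 0" using l inj_onD[OF injx, of l 0] by auto
      then have "?E p = 1" using l D_x[of l] by (simp add: pt_divisor_def)
      moreover have "t + (\<Sum>j=1..n. s j) \<in> tstalk 1 p"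
        by (intro tstalk_add tstalk_sum p t1 poles(1)[OF s])
      ultimately show ?thesis by simp
    next
      assume "p \<in> y ` {1..n}"
      then obtain i where i: "i \<in> {1..n}" "p = y i" by blast
      then have "?E p = - 1" using D_y[of i] xy(3)[of i 0] by (simp add: pt_divisor_def)
      then show ?thesis using van[OF i(1)] i(2) by simp
    qed
  next
    case False
    then have D0: "D p = 0" by (intro D_else) auto
    have s0: "(\<Sum>j=1..n. s j) \<in> tstalk 0 p"
      by (rule tstalk_sum[OF p], rule poles(2)[OF s p]) (use False in auto)
    show ?thesis
    proof (cases "p = x 0 \<and> t \<noteq> 0")
      case True
      then have "?E p = 1" using D0 by (simp add: pt_divisor_def)
      moreover have "(\<Sum>j=1..n. s j) \<in> tstalk 1 p" using s0 tstalk_mono[OF p, of 0 1] by auto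
      ultimately show ?thesis using tstalk_add[OF p t1(1)] by simp
    next
      case F: False
      then have "?E p = 0" using D0 by (auto simp: pt_divisor_def)
      moreover have "t \<in> tstalk 0 p" using F t1(2) tstalk_0[OF p] by metis
      ultimately show ?thesis using tstalk_add[OF p _ s0] by simp
    qed
  qed
qed

text \<open>The sum is a section of \<open>V(D)\<close>, hence zero, so \<open>s l\<close> is minus
  a sum of sections regular at \<open>x l\<close>. In terms of fibres, \<open>A^00\<close> is
  injective.\<close>

lemma minor_kernel:
  assumes s: "\<And>j. j \<in> {1..n} \<Longrightarrow> s j \<in> sections (pt_divisor (x j))"
    and van: "\<And>i. i \<in> {1..n} \<Longrightarrow> (\<Sum>j=1..n. s j) \<in> tstalk (- 1) (y i)" and l: "l \<in> {1..n}"
  shows "s l \<in> tstalk 0 (x l)"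
proof -
  have "0 + (\<Sum>j=1..n. s j) \<in> sections (\<lambda>p. D p + (if (0 :: 'e) = 0 then 0 else pt_divisor (x 0) p))"
    by (rule sections_D) (use s van in auto)
  then have "(\<Sum>j=1..n. s j) \<in> sections D" by simp
  then have "(\<Sum>j=1..n. s j) = 0" using HD by blast
  then have sl: "s l = 0 - (\<Sum>j\<in>{1..n} - {l}. s j)" using l by (simp add: sum.remove add_eq_0_iff2)
  have xl: "x l \<in> points C" using l xy(1) by simp
  have "(\<Sum>j\<in>{1..n} - {l}. s j) \<in> tstalk 0 (x l)"
  proof (rule tstalk_sum[OF xl])
    fix j assume j: "j \<in> {1..n} - {l}"
    then have "x l \<noteq> x j" using l inj_onD[OF injx, of l j] by auto
    then show "s j \<in> tstalk 0 (x l)" using j by (intro poles(2)[OF s xl]) auto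
  qed
  then show ?thesis unfolding sl by (rule tstalk_diff[OF xl tstalk_0[OF xl]])
qed

text \<open>\<open>A^00\<close> is onto because it is injective between spaces of dimension
  \<open>n * rk\<close>. The count is again a dependence: lifts of a basis of polar parts together
  with the target \<open>v\<close> exceed by one a spanning set of the fibres at the
  \<open>y i\<close>.\<close>

lemma minor_solvable:
  assumes v: "\<And>i. i \<in> {1..n} \<Longrightarrow> v i \<in> tstalk 0 (y i)"
  obtains s where "\<And>j. j \<in> {1..n} \<Longrightarrow> s j \<in> sections (pt_divisor (x j))"
    "\<And>i. i \<in> {1..n} \<Longrightarrow> (\<Sum>j=1..n. s j) - v i \<in> tstalk (- 1) (y i)"
proof -
  have "\<forall>j\<in>{1..n}. \<exists>e. frame_at C V (x j) e" using frame_exists xy(1) by (metis atLeastAtMost_iff)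
  from bchoice[OF this] obtain e where e: "\<forall>j\<in>{1..n}. frame_at C V (x j) (e j)" ..
  have "\<forall>i\<in>{1..n}. \<exists>e. frame_at C V (y i) e" using frame_exists xy(2) by (metis atLeastAtMost_iff)
  from bchoice[OF this] obtain e' where e': "\<forall>i\<in>{1..n}. frame_at C V (y i) (e' i)" ..
  have "\<forall>jk\<in>{1..n} \<times> {..<rk}. \<exists>s. s \<in> sections (pt_divisor (x (fst jk))) \<and>
      s - inverse (unif (x (fst jk))) \<cdot> e (fst jk) (snd jk) \<in> tstalk 0 (x (fst jk))"
  proof
    fix jk assume jk: "jk \<in> {1..n} \<times> {..<rk}"
    then have xj: "x (fst jk) \<in> points C" using xy(1) by auto
    have "inverse (unif (x (fst jk))) \<cdot> e (fst jk) (snd jk) \<in> tstalk 1 (x (fst jk))"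
      using jk e by (intro fibre_basis_lift(1)[OF xj]) auto
    from section_with_pole[OF H0 deg xj this]
    show "\<exists>s. s \<in> sections (pt_divisor (x (fst jk))) \<and>
      s - inverse (unif (x (fst jk))) \<cdot> e (fst jk) (snd jk) \<in> tstalk 0 (x (fst jk))" by blast
  qed
  from bchoice[OF this] obtain \<sigma> where \<sigma>: "\<forall>jk\<in>{1..n} \<times> {..<rk}. \<sigma> jk \<in> sections (pt_divisor (x (fst jk))) \<and>
      \<sigma> jk - inverse (unif (x (fst jk))) \<cdot> e (fst jk) (snd jk) \<in> tstalk 0 (x (fst jk))" ..
  \<comment> \<open>\<open>J\<close> indexes both the sections \<open>\<sigma>\<close>, by pole and
    frame vector, and the frame vectors at the points \<open>y i\<close>.\<close>
  define J where "J = {1..n} \<times> {..<rk}"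
  define g where "g o' i = (case o' of None \<Rightarrow> v i | Some jk \<Rightarrow> \<sigma> jk)" for o' and i :: nat
  define u where "u ik i = (if i = fst ik then e' i (snd ik) else 0)" for ik :: "nat \<times> nat" and i :: nat
  have g0: "g o' i \<in> tstalk 0 (y i)" if "o' \<in> insert None (Some ` J)" "i \<in> {1..n}" for o' i
  proof (cases o')
    case None
    then show ?thesis using v that by (simp add: g_def)
  next
    case (Some jk)
    then have "jk \<in> {1..n} \<times> {..<rk}" using that(1) by (auto simp: J_def)
    then have "\<sigma> jk \<in> sections (pt_divisor (x (fst jk)))" "y i \<noteq> x (fst jk)" "y i \<in> points C"
      using \<sigma> that(2) xy(3)[of i "fst jk"] xy(2)[of i] by auto
    then show ?thesis using poles(2) Some by (simp add: g_def)
  qed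
  have "\<forall>o'\<in>insert None (Some ` J). \<exists>a. \<forall>i\<in>{1..n}. g o' i - (\<Sum>ik\<in>J. h (a ik) \<cdot> u ik i) \<in> tstalk (- 1) (y i)"
  proof
    fix o' assume o': "o' \<in> insert None (Some ` J)"
    have "\<forall>i\<in>{1..n}. \<exists>c. g o' i - (\<Sum>k<rk. h (c k) \<cdot> e' i k) \<in> tstalk (- 1) (y i)"
      using fibre_coordinates[OF xy(2) _ g0[OF o']] e' by auto
    from bchoice[OF this] obtain c where
      c: "\<forall>i\<in>{1..n}. g o' i - (\<Sum>k<rk. h (c i k) \<cdot> e' i k) \<in> tstalk (- 1) (y i)" ..
    have "(\<Sum>ik\<in>J. h (c (fst ik) (snd ik)) \<cdot> u ik i) = (\<Sum>k<rk. h (c i k) \<cdot> e' i k)" if "i \<in> {1..n}" for i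
    proof -
      have "(\<Sum>ik\<in>J. h (c (fst ik) (snd ik)) \<cdot> u ik i) =
          (\<Sum>ik\<in>J. if i = fst ik then h (c (fst ik) (snd ik)) \<cdot> e' (fst ik) (snd ik) else 0)"
        by (rule sum.cong) (auto simp: u_def)
      also have "\<dots> = (\<Sum>k<rk. h (c i k) \<cdot> e' i k)"
        unfolding J_def using that by (subst sum_Sigma_fibre) auto
      finally show ?thesis .
    qed
    then show "\<exists>a. \<forall>i\<in>{1..n}. g o' i - (\<Sum>ik\<in>J. h (a ik) \<cdot> u ik i) \<in> tstalk (- 1) (y i)"
      using c by (intro exI[of _ "\<lambda>ik. c (fst ik) (snd ik)"]) simp
  qed
  from bchoice[OF this] obtain a where a: "\<forall>o'\<in>insert None (Some ` J). \<forall>i\<in>{1..n}.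
      g o' i - (\<Sum>ik\<in>J. h (a o' ik) \<cdot> u ik i) \<in> tstalk (- 1) (y i)" ..
  interpret Y: vector_space "\<lambda>c (w :: nat \<Rightarrow> 'e) i. h c \<cdot> w i" by (rule vector_space_fun)
  have sub: "Y.subspace {w. \<forall>i\<in>{1..n}. w i \<in> tstalk (- 1) (y i)}"
    unfolding Y.subspace_def using xy(2) by (auto simp: tstalk_0 tstalk_add tstalk_const)
  have J: "finite J" by (simp add: J_def)
  have card: "card J < card (insert None (Some ` J))"
    using J by (simp add: card_insert_if card_image)
  obtain c where c0: "\<exists>o'\<in>insert None (Some ` J). c o' \<noteq> 0"
    and c: "(\<Sum>o'\<in>insert None (Some ` J). (\<lambda>i. h (c o') \<cdot> g o' i)) \<in> {w. \<forall>i\<in>{1..n}. w i \<in> tstalk (- 1) (y i)}"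
  proof (rule Y.dependent_mod[OF sub _ J card, of g a u])
    fix o' assume o': "o' \<in> insert None (Some ` J)"
    show "g o' - (\<Sum>t\<in>J. (\<lambda>i. h (a o' t) \<cdot> u t i)) \<in> {w. \<forall>i\<in>{1..n}. w i \<in> tstalk (- 1) (y i)}"
      using bspec[OF a o'] by (simp add: sum_fun_apply)
  qed (use J in auto)
  define s where "s j = (\<Sum>k<rk. h (c (Some (j, k))) \<cdot> \<sigma> (j, k))" for j
  have s: "s j \<in> sections (pt_divisor (x j))" if "j \<in> {1..n}" for j
    unfolding s_def using \<sigma> that by (intro sections_sum sections_const) auto
  have cs: "h (c None) \<cdot> v i + (\<Sum>j=1..n. s j) \<in> tstalk (- 1) (y i)" if "i \<in> {1..n}" for i
  proof -
    have "(\<Sum>o'\<in>insert None (Some ` J). h (c o') \<cdot> g o' i) =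
        h (c None) \<cdot> v i + (\<Sum>jk\<in>J. h (c (Some jk)) \<cdot> \<sigma> jk)"
      using J by (simp add: sum.reindex g_def)
    also have "(\<Sum>jk\<in>J. h (c (Some jk)) \<cdot> \<sigma> jk) = (\<Sum>j=1..n. s j)"
      unfolding J_def s_def by (simp add: sum.cartesian_product)
    finally have eq: "(\<Sum>o'\<in>insert None (Some ` J). h (c o') \<cdot> g o' i) = h (c None) \<cdot> v i + (\<Sum>j=1..n. s j)" .
    have "(\<Sum>o'\<in>insert None (Some ` J). h (c o') \<cdot> g o' i) \<in> tstalk (- 1) (y i)"
      using c that by (simp only: sum_fun_apply mem_Collect_eq) 
    then show ?thesis unfolding eq .
  qed
  \<comment> \<open>Without \<open>v\<close> the relation would be an element of the kernel of
    \<open>A^00\<close>, and its polar parts would vanish by \<open>minor_kernel\<close>.\<close>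
  have cN: "c None \<noteq> 0"
  proof
    assume N: "c None = 0"
    have "c (Some jk) = 0" if jkJ: "jk \<in> J" for jk
    proof -
      obtain j k where jk: "jk = (j, k)" "j \<in> {1..n}" "k < rk" using jkJ by (auto simp: J_def)
      have xj: "x j \<in> points C" using jk xy(1) by simp
      have fj: "frame_at C V (x j) (e j)" using e jk(2) by blast
      have "s j \<in> tstalk 0 (x j)" using cs N by (intro minor_kernel[OF s _ jk(2)]) auto
      moreover have "(\<Sum>k<rk. h (c (Some (j, k))) \<cdot> (\<sigma> (j, k) - inverse (unif (x j)) \<cdot> e j k)) \<in> tstalk 0 (x j)"
        using \<sigma> jk(2) by (intro tstalk_sum tstalk_const xj) auto
      ultimately have "s j - (\<Sum>k<rk. h (c (Some (j, k))) \<cdot> (\<sigma> (j, k) - inverse (unif (x j)) \<cdot> e j k)) \<in> tstalk 0 (x j)"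
        by (rule tstalk_diff[OF xj])
      also have "s j - (\<Sum>k<rk. h (c (Some (j, k))) \<cdot> (\<sigma> (j, k) - inverse (unif (x j)) \<cdot> e j k))
          = (\<Sum>k<rk. h (c (Some (j, k))) \<cdot> inverse (unif (x j)) \<cdot> e j k)"
        unfolding s_def sum_subtractf[symmetric]
        by (rule sum.cong) (auto simp only: E.scale_right_diff_distrib diff_diff_eq2 add_diff_cancel_left')
      finally have "(\<Sum>k<rk. h (c (Some (j, k))) \<cdot> inverse (unif (x j)) \<cdot> e j k) \<in> tstalk 0 (x j)" .
      from fibre_basis_lift(2)[OF xj fj, where c = "\<lambda>k. c (Some (j, k))", OF this jk(3)]
      show ?thesis unfolding jk(1) .
    qed
    then show False using c0 N by auto
  qed
  \<comment> \<open>Normalises the coefficient of \<open>v\<close> to -1.\<close>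
  define d where "d = - inverse (c None)"
  have "(\<Sum>j=1..n. h d \<cdot> s j) - v i \<in> tstalk (- 1) (y i)" if i: "i \<in> {1..n}" for i
  proof -
    have "h d * h (c None) = - 1" using cN by (simp flip: emb.hom_mult add: d_def hom_distribs)
    then have "h d \<cdot> (h (c None) \<cdot> v i + (\<Sum>j=1..n. s j)) = (\<Sum>j=1..n. h d \<cdot> s j) - v i"
      by (simp add: E.scale_right_distrib E.scale_sum_right)
    moreover have "h d \<cdot> (h (c None) \<cdot> v i + (\<Sum>j=1..n. s j)) \<in> tstalk (- 1) (y i)"
      using cs[OF i] xy(2)[of i] i by (intro tstalk_const) auto
    ultimately show ?thesis by simp
  qed
  then show thesis using s by (intro that[of "\<lambda>j. h d \<cdot> s j"] sections_const) auto
qed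

context
  fixes S T :: "nat \<Rightarrow> ('k, 'e set) module" and A :: "nat \<Rightarrow> nat \<Rightarrow> 'e set \<Rightarrow> 'e set"
  assumes S: "\<And>j. j \<le> n \<Longrightarrow> S j = Fib 1 (x j)" and T: "\<And>i. i \<le> n \<Longrightarrow> T i = Fib 0 (y i)"
    and A: "\<And>i j. A i j = m3 C V (x j) (y i)"
begin

abbreviation "cx j \<equiv> coset_of (tstalk 0 (x j))"
abbreviation "cy i \<equiv> coset_of (tstalk (- 1) (y i))"

lemma S_pair: "j \<le> n \<Longrightarrow> subspace_pair (\<lambda>a v. h a \<cdot> v) (tstalk 1 (x j)) (tstalk 0 (x j))"
  using fibre_pair[OF xy(1), of j 1] by simp

lemma T_pair: "i \<le> n \<Longrightarrow> subspace_pair (\<lambda>a v. h a \<cdot> v) (tstalk 0 (y i)) (tstalk (- 1) (y i))"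
  using fibre_pair[OF xy(2), of i 0] by simp

lemma S_lift:
  assumes j: "j \<le> n" and X: "X \<in> carrier (S j)"
  shows "\<exists>s\<in>sections (pt_divisor (x j)). X = cx j s"
proof -
  interpret subspace_pair "\<lambda>a v. h a \<cdot> v" "tstalk 1 (x j)" "tstalk 0 (x j)" by (rule S_pair[OF j])
  have "X \<in> carrier Q" using X S[OF j] by simp
  then obtain v where v: "v \<in> tstalk 1 (x j)" "X = cx j v" by (rule carrierE)
  then show ?thesis using section_with_pole[OF H0 deg xy(1)[OF j] v(1)] coset_eq_iff by metis
qed

lemma S_mem: "j \<le> n \<Longrightarrow> s \<in> sections (pt_divisor (x j)) \<Longrightarrow> cx j s \<in> carrier (S j)"
  using subspace_pair.coset_mem[OF S_pair, of j s] poles(1)[OF _ xy(1)] by (simp add: S)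

lemma sections_y: "j \<le> n \<Longrightarrow> i \<le> n \<Longrightarrow> s \<in> sections (pt_divisor (x j)) \<Longrightarrow> s \<in> tstalk 0 (y i)"
  using poles(2)[OF _ xy(2) xy(3)] by blast

lemma A_coset:
  assumes "i \<le> n" "j \<le> n" "s \<in> sections (pt_divisor (x j))"
  shows "A i j (cx j s) = cy i s"
  using m3_twist(2)[OF is_twist_self xy(1)[OF assms(2)] xy(2)[OF assms(1)] xy(3)[OF assms(1,2)] sections_0]
    section_with_pole[OF H0 deg xy(1)[OF assms(2)]] assms(3) by (simp add: A)

text \<open>A row of the matrix applied to polar parts is the value at \<open>y i\<close> of one
  section with all these poles. This turns matrix identities into statements on sections.\<close>

lemma finsum_A:
  assumes i: "i \<le> n" and s: "\<And>j. j \<in> {1..n} \<Longrightarrow> s j \<in> sections (pt_divisor (x j))"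
    and w: "\<And>j. j \<in> {1..n} \<Longrightarrow> w j = cx j (s j)"
  shows "(\<Oplus>\<^bsub>T i\<^esub>j\<in>{1..n}. A i j (w j)) = cy i (\<Sum>j=1..n. s j)"
proof -
  interpret subspace_pair "\<lambda>a v. h a \<cdot> v" "tstalk 0 (y i)" "tstalk (- 1) (y i)" by (rule T_pair[OF i])
  interpret Q: abelian_group Q by (rule abelian_group_Q)
  have sy: "s j \<in> tstalk 0 (y i)" if "j \<in> {1..n}" for j using that i by (intro sections_y[OF _ _ s]) auto
  have "(\<Oplus>\<^bsub>Q\<^esub>j\<in>{1..n}. A i j (w j)) = (\<Oplus>\<^bsub>Q\<^esub>j\<in>{1..n}. cy i (s j))"
    using i s w sy by (intro Q.finsum_cong') (auto simp: A_coset intro!: coset_mem)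
  also have "\<dots> = cy i (\<Sum>j=1..n. s j)" by (rule finsum_coset[OF sy])
  finally show ?thesis using T[OF i] by simp
qed

lemma minor_invertible: "minor00_invertible S T n A"
  unfolding minor00_invertible_def bij_betw_def
proof
  let ?dom = "\<Pi>\<^sub>E j\<in>{1..n}. carrier (S j)" and ?cod = "\<Pi>\<^sub>E i\<in>{1..n}. carrier (T i)"
  have lift: "\<exists>s. \<forall>j\<in>{1..n}. s j \<in> sections (pt_divisor (x j)) \<and> w j = cx j (s j)" if w: "w \<in> ?dom" for w
  proof (rule bchoice, rule ballI)
    fix j assume j: "j \<in> {1..n}"
    then show "\<exists>s. s \<in> sections (pt_divisor (x j)) \<and> w j = cx j s"
      using S_lift[OF _ PiE_mem[OF w j]] by auto
  qed
  show "inj_on (minor00 S T n A) ?dom"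
  proof (rule inj_onI)
    fix w w' assume w: "w \<in> ?dom" "w' \<in> ?dom" and eq: "minor00 S T n A w = minor00 S T n A w'"
    obtain s where s: "\<forall>j\<in>{1..n}. s j \<in> sections (pt_divisor (x j)) \<and> w j = cx j (s j)" using lift[OF w(1)] ..
    obtain s' where s': "\<forall>j\<in>{1..n}. s' j \<in> sections (pt_divisor (x j)) \<and> w' j = cx j (s' j)" using lift[OF w(2)] ..
    have "(\<Sum>j=1..n. s j - s' j) \<in> tstalk (- 1) (y i)" if i: "i \<in> {1..n}" for i
    proof -
      have "cy i (\<Sum>j=1..n. s j) = cy i (\<Sum>j=1..n. s' j)"
        using fun_cong[OF eq, of i] w i s s' finsum_A[of i s w] finsum_A[of i s' w'] by (simp add: minor00_def)
      then show ?thesis using subspace_pair.coset_eq_iff[OF T_pair, of i] i by (simp add: sum_subtractf)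
    qed
    then have "s j - s' j \<in> tstalk 0 (x j)" if "j \<in> {1..n}" for j
      using s s' that by (intro minor_kernel[where s = "\<lambda>j. s j - s' j"] sections_diff) auto
    then have "w j = w' j" if "j \<in> {1..n}" for j
      using that s s' subspace_pair.coset_eq_iff[OF S_pair, of j] by auto
    then show "w = w'" using w by (intro PiE_ext) auto
  qed
  show "minor00 S T n A ` ?dom = ?cod"
  proof (intro equalityI subsetI)
    fix z assume "z \<in> minor00 S T n A ` ?dom"
    then obtain w where w: "w \<in> ?dom" "z = minor00 S T n A w" by blast
    obtain s where s: "\<forall>j\<in>{1..n}. s j \<in> sections (pt_divisor (x j)) \<and> w j = cx j (s j)" using lift[OF w(1)] ..
    have "cy i (\<Sum>j=1..n. s j) \<in> carrier (T i)" if i: "i \<in> {1..n}" for i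
    proof -
      have "(\<Sum>j=1..n. s j) \<in> tstalk 0 (y i)"
      proof (rule tstalk_sum[OF xy(2)])
        show "s j \<in> tstalk 0 (y i)" if "j \<in> {1..n}" for j
          using that i s sections_y[of j i "s j"] by simp
      qed (use i in simp)
      then show ?thesis using subspace_pair.coset_mem[OF T_pair, of i] i by (simp add: T)
    qed
    then show "z \<in> ?cod" unfolding w(2) using w(1) s finsum_A[of _ s w] by (auto simp: minor00_def)
  next
    fix z assume z: "z \<in> ?cod"
    have "\<forall>i\<in>{1..n}. \<exists>v. v \<in> tstalk 0 (y i) \<and> z i = cy i v"
    proof
      fix i assume i: "i \<in> {1..n}"
      then have "z i \<in> coset_of (tstalk (- 1) (y i)) ` tstalk 0 (y i)"
        using z T[of i] by (auto simp: quotient_space_def dest!: PiE_mem)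
      then show "\<exists>v. v \<in> tstalk 0 (y i) \<and> z i = cy i v" by blast
    qed
    from bchoice[OF this] obtain v where v: "\<forall>i\<in>{1..n}. v i \<in> tstalk 0 (y i) \<and> z i = cy i (v i)" ..
    obtain s where s: "\<And>j. j \<in> {1..n} \<Longrightarrow> s j \<in> sections (pt_divisor (x j))"
      "\<And>i. i \<in> {1..n} \<Longrightarrow> (\<Sum>j=1..n. s j) - v i \<in> tstalk (- 1) (y i)"
      by (rule minor_solvable[of v]) (use v in auto)
    define w where "w = (\<lambda>j\<in>{1..n}. cx j (s j))"
    have w: "w \<in> ?dom" using s(1) by (auto simp: w_def intro!: S_mem)
    have "minor00 S T n A w = z"
    proof (rule extensionalityI[of _ "{1..n}"])
      show "minor00 S T n A w \<in> extensional {1..n}" using w by (simp add: minor00_def)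
      show "z \<in> extensional {1..n}" using z by (simp add: PiE_def)
      fix i assume i: "i \<in> {1..n}"
      have "minor00 S T n A w i = cy i (\<Sum>j=1..n. s j)"
        using w i finsum_A[of i s w] s(1) by (simp add: minor00_def w_def)
      also have "\<dots> = cy i (v i)" using subspace_pair.coset_eq_iff[OF T_pair, of i] i s(2) by simp
      finally show "minor00 S T n A w i = z i" using v i by simp
    qed
    then show "z \<in> minor00 S T n A ` ?dom" using w by blast
  qed
qed

text \<open>Sections matching the values of \<open>s0\<close> at the \<open>y i\<close> are
  subtracted from it. The polar part at \<open>x 0\<close> is unaffected, since they are regular at
  that point.\<close>

lemma correction:
  assumes s0: "s0 \<in> sections (pt_divisor (x 0))"
  obtains s where "\<And>j. j \<in> {1..n} \<Longrightarrow> s j \<in> sections (pt_divisor (x j))"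
    "\<And>i. i \<in> {1..n} \<Longrightarrow> (\<Sum>j=1..n. s j) - s0 \<in> tstalk (- 1) (y i)"
    "s0 - (\<Sum>j=1..n. s j) \<in> sections (\<lambda>p. D p + pt_divisor (x 0) p)"
    "(s0 - (\<Sum>j=1..n. s j)) - s0 \<in> tstalk 0 (x 0)"
proof -
  obtain s where s: "\<And>j. j \<in> {1..n} \<Longrightarrow> s j \<in> sections (pt_divisor (x j))"
    "\<And>i. i \<in> {1..n} \<Longrightarrow> (\<Sum>j=1..n. s j) - s0 \<in> tstalk (- 1) (y i)"
    by (rule minor_solvable[of "\<lambda>_. s0"]) (use sections_y[OF _ _ s0] in auto)
  have x0: "x 0 \<in> points C" using xy(1) by simp
  have neg: "- s j \<in> sections (pt_divisor (x j))" if "j \<in> {1..n}" for j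
    using sections_const[OF s(1)[OF that], of "- 1"] by (simp add: hom_distribs)
  have "s0 + (\<Sum>j=1..n. - s j) \<in> sections (\<lambda>p. D p + (if s0 = 0 then 0 else pt_divisor (x 0) p))"
  proof (rule sections_D[OF disjI1[OF s0] neg])
    fix i assume i: "i \<in> {1..n}"
    have yi: "y i \<in> points C" using i xy(2) by simp
    have "0 - ((\<Sum>j=1..n. s j) - s0) \<in> tstalk (- 1) (y i)" by (rule tstalk_diff[OF yi tstalk_0[OF yi] s(2)[OF i]])
    then show "s0 + (\<Sum>j=1..n. - s j) \<in> tstalk (- 1) (y i)" by (simp add: sum_negf)
  qed
  \<comment> \<open>For \<open>s0 = 0\<close> the conditional divisor is smaller, so monotonicity in
    the divisor covers both cases.\<close>
  moreover have "sections (\<lambda>p. D p + (if s0 = 0 then 0 else pt_divisor (x 0) p)) \<subseteq> sections (\<lambda>p. D p + pt_divisor (x 0) p)"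
  proof
    fix t assume t: "t \<in> sections (\<lambda>p. D p + (if s0 = 0 then 0 else pt_divisor (x 0) p))"
    have "t \<in> tstalk (D p + pt_divisor (x 0) p) p" if p: "p \<in> points C" for p
    proof -
      have "D p + (if s0 = 0 then 0 else pt_divisor (x 0) p) \<le> D p + pt_divisor (x 0) p"
        by (simp add: pt_divisor_def)
      from tstalk_mono[OF p this] show ?thesis using t p unfolding sections_def by blast
    qed
    then show "t \<in> sections (\<lambda>p. D p + pt_divisor (x 0) p)" by (simp add: sections_def)
  qed
  ultimately have t: "s0 - (\<Sum>j=1..n. s j) \<in> sections (\<lambda>p. D p + pt_divisor (x 0) p)" by (auto simp: sum_negf)
  have "(\<Sum>j=1..n. - s j) \<in> tstalk 0 (x 0)"
  proof (rule tstalk_sum[OF x0])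
    fix j assume j: "j \<in> {1..n}"
    then have "x 0 \<noteq> x j" using inj_onD[OF injx, of 0 j] by auto
    then show "- s j \<in> tstalk 0 (x 0)" by (rule poles(2)[OF neg[OF j] x0])
  qed
  then have "(s0 - (\<Sum>j=1..n. s j)) - s0 \<in> tstalk 0 (x 0)" by (simp add: sum_negf)
  with s t show thesis by (rule that[of s])
qed

lemma m3_quasidet: "m3 C (twist C V D) (x 0) (y 0) = quasidet00 S T n A"
proof -
  let ?U = "twist C V D" and ?S = "sections (\<lambda>p. D p + pt_divisor (x 0) p)"
  have U: "is_twist ?U D" using is_twist_twist[OF is_twist_self, of D] by simp
  have x0: "x 0 \<in> points C" and y0: "y 0 \<in> points C" "y 0 \<noteq> x 0" using xy(1)[of 0] xy(2)[of 0] xy(3)[of 0 0] by simp_all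
  have D0: "D (x 0) = 0" "D (y 0) = 0" using D_x[of 0] D_y[of 0] by simp_all
  interpret X: subspace_pair "\<lambda>a v. h a \<cdot> v" "tstalk 1 (x 0)" "tstalk 0 (x 0)" by (rule S_pair) simp
  interpret Y: subspace_pair "\<lambda>a v. h a \<cdot> v" "tstalk 0 (y 0)" "tstalk (- 1) (y 0)" by (rule T_pair) simp
  \<comment> \<open>Evaluation at \<open>x 0\<close> on sections of \<open>V(D + x 0)\<close>
    inherits surjectivity from \<open>V\<close> through the correction.\<close>
  have surj: "\<exists>t\<in>?S. t - v \<in> tstalk (D (x 0)) (x 0)" if v: "v \<in> tstalk (D (x 0) + 1) (x 0)" for v
  proof -
    obtain s0 where s0: "s0 \<in> sections (pt_divisor (x 0))" "s0 - v \<in> tstalk 0 (x 0)"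
      using section_with_pole[OF H0 deg x0] v by (auto simp: D0)
    obtain s where s: "s0 - (\<Sum>j=1..n. s j) \<in> ?S" "(s0 - (\<Sum>j=1..n. s j)) - s0 \<in> tstalk 0 (x 0)"
      by (rule correction[OF s0(1)])
    have eq: "((s0 - (\<Sum>j=1..n. s j)) - s0) + (s0 - v) = (s0 - (\<Sum>j=1..n. s j)) - v" by simp
    show ?thesis unfolding D0 using tstalk_add[OF x0 s(2) s0(2), unfolded eq] s(1)
      by (intro bexI[of _ "s0 - (\<Sum>j=1..n. s j)"])
  qed
  note m3 = m3_twist[OF U x0 y0 HD surj]
  show ?thesis
  proof (rule extensionalityI[of _ "carrier (S 0)"])
    show "m3 C ?U (x 0) (y 0) \<in> extensional (carrier (S 0))"
      using m3(1) by (auto simp: linear_maps_def PiE_def D0 S)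
    show "quasidet00 S T n A \<in> extensional (carrier (S 0))" by (simp add: quasidet00_def)
    fix X assume X: "X \<in> carrier (S 0)"
    obtain s0 where s0: "s0 \<in> sections (pt_divisor (x 0))" "X = cx 0 s0" using S_lift[OF _ X] by auto
    obtain s where s: "\<And>j. j \<in> {1..n} \<Longrightarrow> s j \<in> sections (pt_divisor (x j))"
      "\<And>i. i \<in> {1..n} \<Longrightarrow> (\<Sum>j=1..n. s j) - s0 \<in> tstalk (- 1) (y i)"
      "s0 - (\<Sum>j=1..n. s j) \<in> ?S" "(s0 - (\<Sum>j=1..n. s j)) - s0 \<in> tstalk 0 (x 0)"
      by (rule correction[OF s0(1)]) blast
    define w where "w = (\<lambda>j\<in>{1..n}. cx j (s j))"
    have w: "w \<in> (\<Pi>\<^sub>E j\<in>{1..n}. carrier (S j))" using s(1) by (auto simp: w_def intro!: S_mem)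
    have "minor00 S T n A w = (\<lambda>i\<in>{1..n}. A i 0 X)"
    proof (rule extensionalityI[of _ "{1..n}"])
      show "minor00 S T n A w \<in> extensional {1..n}" using w by (simp add: minor00_def)
      fix i assume i: "i \<in> {1..n}"
      have "minor00 S T n A w i = cy i (\<Sum>j=1..n. s j)"
        using w i finsum_A[of i s w] s(1) by (simp add: minor00_def w_def)
      also have "\<dots> = cy i s0" using subspace_pair.coset_eq_iff[OF T_pair, of i] i s(2) by simp
      also have "\<dots> = A i 0 X" using A_coset[of i 0 s0] i s0 by simp
      finally show "minor00 S T n A w i = (\<lambda>i\<in>{1..n}. A i 0 X) i" using i by simp
    qed simp
    \<comment> \<open>The polar parts of the correcting sections are the inverse of
      \<open>A^00\<close> applied to the column \<open>A i 0 X\<close>.\<close>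
    then have inv: "inv_into (\<Pi>\<^sub>E j\<in>{1..n}. carrier (S j)) (minor00 S T n A) (\<lambda>i\<in>{1..n}. A i 0 X) = w"
      using minor_invertible w unfolding minor00_invertible_def bij_betw_def by (metis inv_into_f_f)
    have sum_y: "(\<Sum>j=1..n. s j) \<in> tstalk 0 (y 0)"
    proof (rule tstalk_sum[OF y0(1)])
      show "s j \<in> tstalk 0 (y 0)" if "j \<in> {1..n}" for j
        using that s(1)[OF that] sections_y[of j 0 "s j"] by simp
    qed
    have s0_y: "s0 \<in> tstalk 0 (y 0)" using sections_y[of 0 0 s0] s0(1) by simp
    have "quasidet00 S T n A X = A 0 0 X \<ominus>\<^bsub>T 0\<^esub> (\<Oplus>\<^bsub>T 0\<^esub>j\<in>{1..n}. A 0 j (w j))"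
      using X inv by (simp add: quasidet00_def Let_def)
    also have "\<dots> = cy 0 s0 \<ominus>\<^bsub>Y.Q\<^esub> cy 0 (\<Sum>j=1..n. s j)"
      using finsum_A[of 0 s w] s(1) A_coset[of 0 0 s0] s0 by (simp add: w_def T)
    also have "\<dots> = cy 0 (s0 - (\<Sum>j=1..n. s j))" by (rule Y.minus_coset[OF s0_y sum_y])
    also have "\<dots> = m3 C ?U (x 0) (y 0) (cx 0 (s0 - (\<Sum>j=1..n. s j)))"
      using m3(2)[OF _ s(3)] by (simp add: D0)
    also have "cx 0 (s0 - (\<Sum>j=1..n. s j)) = X" unfolding s0(2) X.coset_eq_iff by (rule s(4))
    finally show "m3 C ?U (x 0) (y 0) X = quasidet00 S T n A X" ..
  qed
qed

end

end

end

theorem theorem3p4: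
  fixes C :: "('k::alg_closed_field, 'K::field, 'i::finite) curve"
    and V :: "('k, 'K, 'i, 'e::ab_group_add) vbundle"
    and n :: nat
    and x y :: "nat \<Rightarrow> ('k, 'i) point"
    and D :: "('k, 'i) point \<Rightarrow> int"
    and S T :: "nat \<Rightarrow> ('k, 'e set) module"
    and A :: "nat \<Rightarrow> nat \<Rightarrow> 'e set \<Rightarrow> 'e set"
  assumes "smooth_projective_curve C"
    and "vector_bundle C V" and "rank V > 0"
    and "slope C V = of_nat (genus C) - 1"
    and "H0 C V = {0}"
    and "x ` {0..n} \<subseteq> points C" and "y ` {0..n} \<subseteq> points C"
    and "inj_on x {0..n}" and "inj_on y {0..n}" and "x ` {0..n} \<inter> y ` {0..n} = {}"
    and D: "D = (\<Sum>i=1..n. pt_divisor (x i)) - (\<Sum>i=1..n. pt_divisor (y i))"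
    and "H0 C (twist C V D) = {0}"
    and S: "\<And>j. S j = fibre C (twist C V (pt_divisor (x j))) (x j)"
    and T: "\<And>i. T i = fibre C V (y i)"
    and A: "\<And>i j. A i j = m3 C V (x j) (y i)"
  shows "minor00_invertible S T n A \<and>
    m3 C (twist C V D) (x 0) (y 0) = quasidet00 S T n A"
proof -
  interpret curve_bundle C V
    using assms(1,2) by (simp add: curve_bundle_def curve_bundle_axioms_def smooth_curve_def)
  \<comment> \<open>The slope condition is multiplied by the positive rank to become an identity of
    integers.\<close>
  have "(of_int (degree_of C V) :: rat) = of_int (int rk * (int (genus C) - 1))"
    using assms(3,4) by (simp add: slope_def field_simps)
  then have deg: "degree_of C V = int rk * (int (genus C) - 1)" by (simp only: of_int_eq_iff)
  have HD: "sections D = {0}"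
    using assms(12) H0_twist[OF is_twist_twist[OF is_twist_self, of D]] by simp
  have xy: "x j \<in> points C" "y j \<in> points C" if "j \<le> n" for j
    using assms(6,7) that by (simp_all add: image_subset_iff)
  have Sj: "S j = Fib 1 (x j)" if "j \<le> n" for j
    using fibre_twist[OF is_twist_twist[OF is_twist_self, of "pt_divisor (x j)"] xy(1)[OF that]]
    by (simp add: S pt_divisor_def)
  have Ti: "T i = Fib 0 (y i)" if "i \<le> n" for i
    using fibre_twist[OF is_twist_self xy(2)[OF that]] by (simp add: T)
  note facts = assms(5) deg assms(6-10) D HD
  show ?thesis
    using minor_invertible[OF facts Sj Ti A] m3_quasidet[OF facts Sj Ti A] by blast
qed

end
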